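(* Let $\mathfrak g$ be a simple Lie algebra over an algebraically closed field of characteristic zero. For any $\mathbb Z$-grading $\mathfrak g=\bigoplus_{i\in\mathbb Z}\mathfrak g(i)$ and any $i\neq0$ with $\mathfrak g(i)\ne0$, one has $\deg\mathcal K_{\Delta(i)}(t)\le3$.
   Context: For a $\mathbb Z$-grading, $\mathfrak g(0)$ is reductive and contains a Cartan subalgebra $\mathfrak t$ of $\mathfrak g$. Fix a set of simple roots of $\mathfrak g(0)$. $\Delta(i)$ is the set of $\mathfrak t$-weights (roots of $\mathfrak g$) in $\mathfrak g(i)$, regarded as a poset under the root order: $\mu$ covers $\gamma$ if and only if $\mu-\gamma$ is a simple root of $\mathfrak g(0)$ (the order being generated by these relations). The upper covering polynomial of a finite poset $\mathcal P$ is $\mathcal K_{\mathcal P}(t)=\sum_{j\ge0}\#(\mathcal P^{(j)})\,t^j$, where $\mathcal P^{(j)}$ is the set of elements of $\mathcal P$ that cover exactly $j$ elements of $\mathcal P$. *)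

theory Defs
  imports
    "HOL-Computational_Algebra.Polynomial"
    "HOL-Library.Function_Algebras"
begin

section \<open>Lie algebras\<close>

locale lie_algebra = vector_space scale
  for scale :: "'k::field \<Rightarrow> 'g::ab_group_add \<Rightarrow> 'g" (infixr "*s" 75) +
  fixes br :: "'g \<Rightarrow> 'g \<Rightarrow> 'g"
  assumes br_add_left: "br (x + y) z = br x z + br y z"
    and br_add_right: "br x (y + z) = br x y + br x z"
    and br_scale_left: "br (c *s x) y = c *s br x y"
    and br_scale_right: "br x (c *s y) = c *s br x y"
    and br_self: "br x x = 0"
    and jacobi: "br x (br y z) + br y (br z x) + br z (br x y) = 0"
begin

definition finite_dim :: bool where
  "finite_dim \<longleftrightarrow> (\<exists>B. finite_dimensional_vector_space scale B)"

definition lie_ideal :: "'g set \<Rightarrow> bool" where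
  "lie_ideal I \<longleftrightarrow> subspace I \<and> (\<forall>x. \<forall>y\<in>I. br x y \<in> I)"

definition simple :: bool where
  "simple \<longleftrightarrow> (\<exists>x y. br x y \<noteq> 0) \<and> (\<forall>I. lie_ideal I \<longrightarrow> I = {0} \<or> I = UNIV)"

definition lie_subalgebra :: "'g set \<Rightarrow> bool" where
  "lie_subalgebra H \<longleftrightarrow> subspace H \<and> (\<forall>x\<in>H. \<forall>y\<in>H. br x y \<in> H)"

primrec lower_central :: "'g set \<Rightarrow> nat \<Rightarrow> 'g set" where
  "lower_central H 0 = H"
| "lower_central H (Suc n) = span {br x y |x y. x \<in> H \<and> y \<in> lower_central H n}"

definition nilpotent :: "'g set \<Rightarrow> bool" where
  "nilpotent H \<longleftrightarrow> (\<exists>n. lower_central H n = {0})"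

definition normalizer :: "'g set \<Rightarrow> 'g set" where
  "normalizer H = {x. \<forall>h\<in>H. br x h \<in> H}"

definition cartan_subalgebra :: "'g set \<Rightarrow> bool" where
  "cartan_subalgebra H \<longleftrightarrow> lie_subalgebra H \<and> nilpotent H \<and> normalizer H = H"

text \<open>The component of degree \<open>i\<close> is \<open>G i\<close>; the last conjunct expresses that the whole space
  is the (internal) direct sum of the \<open>G i\<close>.\<close>

definition Z_grading :: "(int \<Rightarrow> 'g set) \<Rightarrow> bool" where
  "Z_grading G \<longleftrightarrow>
     (\<forall>i. subspace (G i)) \<and>
     (\<forall>i j. \<forall>x\<in>G i. \<forall>y\<in>G j. br x y \<in> G (i + j)) \<and>
     (\<forall>x. \<exists>!f. (\<forall>i. f i \<in> G i) \<and> finite {i. f i \<noteq> 0} \<and> x = (\<Sum>i | f i \<noteq> 0. f i))"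

text \<open>The dual space of a subspace \<open>H\<close>. A functional on \<open>H\<close> is represented by its extension by
  zero outside \<open>H\<close>, so that equality, sums and differences of functionals on \<open>H\<close> are those of
  functions on the whole type.\<close>

definition dual :: "'g set \<Rightarrow> ('g \<Rightarrow> 'k) set" where
  "dual H = {\<phi>. (\<forall>x\<in>H. \<forall>y\<in>H. \<phi> (x + y) = \<phi> x + \<phi> y) \<and>
                (\<forall>c. \<forall>x\<in>H. \<phi> (c *s x) = c * \<phi> x) \<and> (\<forall>x. x \<notin> H \<longrightarrow> \<phi> x = 0)}"

text \<open>The nonzero weights of \<open>H\<close> in \<open>V\<close>. For a Cartan subalgebra \<open>H\<close> of a semisimple algebra
  contained in the component \<open>G 0\<close> of a grading, \<open>roots H (G i)\<close> is the set of all \<open>H\<close>-weights in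
  \<open>G i\<close> when \<open>i \<noteq> 0\<close> (the zero weight space, being \<open>H\<close>, lies in \<open>G 0\<close>), and the root system of
  the reductive algebra \<open>G 0\<close> when \<open>i = 0\<close>.\<close>

definition roots :: "'g set \<Rightarrow> 'g set \<Rightarrow> ('g \<Rightarrow> 'k) set" where
  "roots H V = {\<alpha> \<in> dual H. \<alpha> \<noteq> 0 \<and> (\<exists>x\<in>V. x \<noteq> 0 \<and> (\<forall>h\<in>H. br h x = \<alpha> h *s x))}"

end

abbreviation scale_fun :: "'k::field \<Rightarrow> ('g \<Rightarrow> 'k) \<Rightarrow> 'g \<Rightarrow> 'k" where
  "scale_fun c \<phi> \<equiv> (\<lambda>h. c * \<phi> h)"

text \<open>Independence is over the ground field. For the root system \<open>\<Phi>\<close> of a reductive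
  Lie algebra the rational span of \<open>\<Phi>\<close> is a rational form of its span, so this agrees with independence in the real vector space of the root system.\<close>

definition simple_roots :: "('g \<Rightarrow> 'k::field) set \<Rightarrow> ('g \<Rightarrow> 'k) set \<Rightarrow> bool" where
  "simple_roots \<Phi> \<Pi> \<longleftrightarrow>
     \<Pi> \<subseteq> \<Phi> \<and> finite \<Pi> \<and> \<not> module.dependent scale_fun \<Pi> \<and>
     (\<forall>\<beta>\<in>\<Phi>. \<exists>c :: ('g \<Rightarrow> 'k) \<Rightarrow> nat.
        \<beta> = (\<Sum>\<alpha>\<in>\<Pi>. scale_fun (of_nat (c \<alpha>)) \<alpha>) \<or>
        \<beta> = - (\<Sum>\<alpha>\<in>\<Pi>. scale_fun (of_nat (c \<alpha>)) \<alpha>))"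


section \<open>Finite posets and the upper covering polynomial\<close>

definition covers :: "'a set \<Rightarrow> ('a \<Rightarrow> 'a \<Rightarrow> bool) \<Rightarrow> 'a \<Rightarrow> 'a \<Rightarrow> bool" where
  "covers P le y x \<longleftrightarrow> x \<in> P \<and> y \<in> P \<and> le x y \<and> x \<noteq> y \<and>
     (\<forall>z\<in>P. le x z \<and> le z y \<longrightarrow> z = x \<or> z = y)"

definition covering_exactly :: "'a set \<Rightarrow> ('a \<Rightarrow> 'a \<Rightarrow> bool) \<Rightarrow> nat \<Rightarrow> 'a set" where
  "covering_exactly P le j = {y \<in> P. card {x \<in> P. covers P le y x} = j}"

text \<open>For finite \<open>P\<close> no element covers more than \<open>card P\<close> elements, so the sum may be truncated.\<close>

definition upper_covering_poly :: "'a set \<Rightarrow> ('a \<Rightarrow> 'a \<Rightarrow> bool) \<Rightarrow> nat poly" where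
  "upper_covering_poly P le = (\<Sum>j\<le>card P. monom (card (covering_exactly P le j)) j)"

lemma coeff_upper_covering_poly:
  assumes "finite P"
  shows "coeff (upper_covering_poly P le) j = card (covering_exactly P le j)"
proof (cases "j \<le> card P")
  case True
  have "coeff (upper_covering_poly P le) j =
      (\<Sum>i\<le>card P. if i = j then card (covering_exactly P le i) else 0)"
    unfolding upper_covering_poly_def by (simp add: coeff_sum)
  with True show ?thesis by simp
next
  case False
  have "card {x \<in> P. covers P le y x} \<le> card P" for y
    using assms by (intro card_mono) auto
  with False have "covering_exactly P le j = {}"
    by (auto simp: covering_exactly_def)
  with False show ?thesis
    unfolding upper_covering_poly_def by (simp add: coeff_sum)
qed

text \<open>The order on \<open>P\<close> generated by adding elements of \<open>\<Pi>\<close>.\<close>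

definition root_step :: "'a::ab_group_add set \<Rightarrow> 'a set \<Rightarrow> 'a \<Rightarrow> 'a \<Rightarrow> bool" where
  "root_step \<Pi> P \<gamma> \<mu> \<longleftrightarrow> \<gamma> \<in> P \<and> \<mu> \<in> P \<and> \<mu> - \<gamma> \<in> \<Pi>"

definition root_order :: "'a::ab_group_add set \<Rightarrow> 'a set \<Rightarrow> 'a \<Rightarrow> 'a \<Rightarrow> bool" where
  "root_order \<Pi> P = (root_step \<Pi> P)\<^sup>*\<^sup>*"

lemma vector_space_fun: "vector_space (scale_fun :: 'k::field \<Rightarrow> ('g \<Rightarrow> 'k) \<Rightarrow> _)"
  by unfold_locales (auto simp: fun_eq_iff algebra_simps)

text \<open>Passing to the transitive closure does not create or destroy covering relations.\<close>

lemma covers_root_order_iff: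
  fixes \<Phi> \<Pi> P :: "('g \<Rightarrow> 'k::field_char_0) set"
  assumes "simple_roots \<Phi> \<Pi>"
  shows "covers P (root_order \<Pi> P) \<mu> \<gamma> \<longleftrightarrow> \<gamma> \<in> P \<and> \<mu> \<in> P \<and> \<mu> - \<gamma> \<in> \<Pi>"
proof -
  interpret V: vector_space "scale_fun :: 'k \<Rightarrow> ('g \<Rightarrow> 'k) \<Rightarrow> _" by (rule vector_space_fun)
  interpret K: vector_space "(*) :: 'k \<Rightarrow> 'k \<Rightarrow> 'k" by unfold_locales (auto simp: algebra_simps)
  interpret VK: vector_space_pair "scale_fun :: 'k \<Rightarrow> ('g \<Rightarrow> 'k) \<Rightarrow> _" "(*) :: 'k \<Rightarrow> 'k \<Rightarrow> 'k" ..
  have ind: "V.independent \<Pi>" using assms by (simp add: simple_roots_def)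
  obtain f where f: "Vector_Spaces.linear scale_fun (*) f" and f1: "\<forall>x\<in>\<Pi>. f x = 1"
    using VK.linear_independent_extend[OF ind, of "\<lambda>_. 1"] by blast
  interpret f: Vector_Spaces.linear scale_fun "(*)" f by (rule f)
  have step: "f y = f x + 1" if "root_step \<Pi> P x y" for x y
    using that f1 f.diff[of y x] by (auto simp: root_step_def algebra_simps)
  have order: "\<exists>n. f y = f x + of_nat n \<and> (n = 0 \<longrightarrow> x = y)" if "root_order \<Pi> P x y" for x y
    using that unfolding root_order_def
  proof (induction rule: rtranclp_induct)
    case base
    show ?case by (rule exI[of _ 0]) simp
  next
    case (step y z)
    then obtain n where "f y = f x + of_nat n" by blast
    with \<open>root_step \<Pi> P y z\<close> have "f z = f x + of_nat (Suc n)"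
      using \<open>\<And>x y. root_step \<Pi> P x y \<Longrightarrow> f y = f x + 1\<close> by simp
    then show ?case by blast
  qed
  have step_order: "root_order \<Pi> P x y" if "root_step \<Pi> P x y" for x y
    using that by (auto simp: root_order_def)
  show ?thesis
  proof
    assume c: "covers P (root_order \<Pi> P) \<mu> \<gamma>"
    then have "root_order \<Pi> P \<gamma> \<mu>" "\<gamma> \<noteq> \<mu>" by (auto simp: covers_def)
    then obtain z where z: "root_step \<Pi> P \<gamma> z" "root_order \<Pi> P z \<mu>"
      unfolding root_order_def by (metis converse_rtranclpE)
    have "z \<in> P" "z \<noteq> \<gamma>" using z(1) step[OF z(1)] by (auto simp: root_step_def)
    with c z step_order have "z = \<mu>" by (auto simp: covers_def)
    with z(1) show "\<gamma> \<in> P \<and> \<mu> \<in> P \<and> \<mu> - \<gamma> \<in> \<Pi>" by (simp add: root_step_def)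
  next
    assume a: "\<gamma> \<in> P \<and> \<mu> \<in> P \<and> \<mu> - \<gamma> \<in> \<Pi>"
    then have s: "root_step \<Pi> P \<gamma> \<mu>" by (simp add: root_step_def)
    have "z = \<gamma> \<or> z = \<mu>" if z: "root_order \<Pi> P \<gamma> z" "root_order \<Pi> P z \<mu>" for z
    proof -
      obtain m where m: "f z = f \<gamma> + of_nat m" "m = 0 \<longrightarrow> \<gamma> = z"
        using order[OF z(1)] by blast
      obtain n where n: "f \<mu> = f z + of_nat n" "n = 0 \<longrightarrow> z = \<mu>"
        using order[OF z(2)] by blast
      have "(of_nat (m + n) :: 'k) = of_nat 1" using m(1) n(1) step[OF s] by simp
      then have "m + n = 1" by (simp only: of_nat_eq_iff)
      with m(2) n(2) show ?thesis by (cases m) auto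
    qed
    moreover have "\<gamma> \<noteq> \<mu>" using step[OF s] by auto
    ultimately show "covers P (root_order \<Pi> P) \<mu> \<gamma>"
      using a step_order[OF s] by (auto simp: covers_def)
  qed
qed

end

theory Submission
  imports Defs "HOL-Library.Groups_Big_Fun"
begin

text \<open>
  Suppose that \<open>\<mu>\<close> is a root of degree \<open>i \<noteq> 0\<close> and that \<open>a\<close> runs through four simple roots of \<open>G 0\<close>
  for which \<open>\<mu> - a\<close> is again a root. A difference of two roots of equal degree with positive inner
  product is a root of \<open>G 0\<close>, but a difference of two simple roots is not; hence both the \<open>a\<close> and
  the \<open>\<mu> - a\<close> are pairwise obtuse. If \<open>|a|\<^sup>2 + |\<mu> - a|\<^sup>2 \<le> 2 |\<mu>|\<^sup>2\<close> for all four, expanding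
  \<open>|2 \<mu> - \<Sum> a|\<^sup>2\<close> makes it \<open>\<le> 0\<close>, although \<open>\<mu>\<close> is independent of the \<open>a\<close> because \<open>i \<noteq> 0\<close>.
  Otherwise some \<open>a\<close> and \<open>\<mu>\<close> are short with \<open>\<mu> - a\<close> long (or with \<open>a\<close> and \<open>\<mu> - a\<close> exchanged), and
  integrality of the Cartan numbers yields two more roots \<open>b\<close>, \<open>c\<close> with \<open>|a + b + c - \<mu>|\<^sup>2 \<le> 0\<close>.

  The root space structure is obtained from traces alone: for \<open>x\<close> and \<open>y\<close> in opposite weight spaces,
  \<open>ad [x, y]\<close> has trace zero on every subspace stable under \<open>x\<close> and \<open>y\<close>. Suitable choices of that
  subspace give Cartan's criterion, one-dimensionality of root spaces, and integrality.
\<close>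

section \<open>Generalized eigenspaces\<close>

text \<open>The ground field carries no order, so "obtuse", "short" and "positive" mean nothing
  there. Inner products are moved to \<open>rat\<close>: a functional is recorded by its values on
  the elements of \<open>H\<close> dual to the roots, and the form becomes a sum of products over
  all roots. Rationality of these values rests on dimension counts and Cartan integers, which must
  first be won inside the ground field; traces do this without any order.

  That \<open>i\<close> is nonzero enters through an element of \<open>H\<close> on which every root
  takes its degree as value. It gives i at \<mu> and 0 at each a, so a combination in which \<mu>
  has nonzero total coefficient cannot vanish and has positive length. This applies to 2 \<mu> - a -
  b - c - d as well as to a + b + c - \<mu>.

  In the exceptional configuration |\<mu> - a|^2 = w |\<mu>|^2 and |a|^2 = |\<mu>|^2 with w = 2 or
  3. Every other b is then as long as \<mu> (only if w = 2) or has |b|^2 = w |\<mu>|^2. Two of the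
  first kind give the vector of length <= 0; two of the second kind violate the strict
  Cauchy-Schwarz inequality for \<mu> - b and \<mu> - c. Three further roots cannot be distributed
  over the two kinds.\<close>

locale alg_closed_space = finite_dimensional_vector_space scale Basis
  for scale :: "'a::{field_char_0, alg_closed_field} \<Rightarrow> 'b::ab_group_add \<Rightarrow> 'b" (infixr "*s" 75)
    and Basis
begin

abbreviation lin :: "('b \<Rightarrow> 'b) \<Rightarrow> bool" where
  "lin \<equiv> Vector_Spaces.linear scale scale"

lemma linI:
  assumes "\<And>x y. f (x + y) = f x + f y" "\<And>c x. f (c *s x) = c *s f x"
  shows "lin f"
  using assms vector_space_axioms by (simp add: Vector_Spaces.linear_iff)

lemma lin_add: "lin f \<Longrightarrow> f (x + y) = f x + f y"
  and lin_scale: "lin f \<Longrightarrow> f (c *s x) = c *s f x"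
  by (auto simp: Vector_Spaces.linear_iff)

lemma lin_zero: "lin f \<Longrightarrow> f 0 = 0"
  using lin_scale[of f 0 0] by simp

lemma lin_diff: "lin f \<Longrightarrow> f (x - y) = f x - f y"
  using lin_add[of f "x - y" y] by simp

lemma lin_sum: "lin f \<Longrightarrow> f (sum g A) = (\<Sum>a\<in>A. f (g a))"
  by (induction A rule: infinite_finite_induct) (simp_all add: lin_zero lin_add)

lemma lin_comp: "lin f \<Longrightarrow> lin g \<Longrightarrow> lin (\<lambda>x. g (f x))"
  by (rule linI) (simp_all add: lin_add lin_scale)

lemma lin_diff_scale: "lin f \<Longrightarrow> lin (\<lambda>x. f x - c *s x)"
  by (rule linI) (simp_all add: lin_add lin_scale algebra_simps)

lemma lin_funpow: "lin f \<Longrightarrow> lin (f ^^ n)"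
  by (induction n) (auto intro!: linI simp: lin_add lin_scale)

lemma lin_minus_fun: "lin f \<Longrightarrow> lin g \<Longrightarrow> lin (\<lambda>x. f x - g x)"
  by (rule linI) (simp_all add: lin_add lin_scale algebra_simps)

lemma lin_ident: "lin (\<lambda>x. x)"
  by (rule linI) simp_all

lemma lin_span_subset:
  assumes "lin f" "\<And>x. x \<in> A \<Longrightarrow> f x \<in> T" "subspace T" "x \<in> span A"
  shows "f x \<in> T"
  using assms(4)
proof (induction rule: span_induct_alt)
  case base
  show ?case using assms by (simp add: lin_zero subspace_0)
next
  case (step c x y)
  then show ?case using assms by (simp add: lin_add lin_scale subspace_add subspace_scale)
qed

definition geneig :: "('b \<Rightarrow> 'b) \<Rightarrow> 'a \<Rightarrow> 'b set" where
  "geneig f c = {x. \<exists>n. ((\<lambda>x. f x - c *s x) ^^ n) x = 0}"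

lemma funpow_zero_mono:
  assumes "lin g" "(g ^^ n) x = 0" "n \<le> m"
  shows "(g ^^ m) x = 0"
proof -
  have "(g ^^ m) x = (g ^^ (m - n)) ((g ^^ n) x)"
    using assms(3) by (metis comp_apply funpow_add le_add_diff_inverse2)
  with assms show ?thesis by (simp add: lin_funpow lin_zero)
qed

lemma subspace_geneig:
  assumes "lin f" shows "subspace (geneig f c)"
proof (rule subspaceI)
  let ?g = "\<lambda>x. f x - c *s x"
  have g: "lin ?g" by (rule lin_diff_scale[OF assms])
  show "0 \<in> geneig f c" unfolding geneig_def by (auto intro: exI[of _ 0])
  show "x + y \<in> geneig f c" if x: "x \<in> geneig f c" and y: "y \<in> geneig f c" for x y
  proof -
    from x y obtain n m where "(?g ^^ n) x = 0" "(?g ^^ m) y = 0"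
      unfolding geneig_def by blast
    then have "(?g ^^ max n m) x = 0" "(?g ^^ max n m) y = 0"
      using funpow_zero_mono[OF g] by auto
    then have "(?g ^^ max n m) (x + y) = 0" by (simp add: lin_add[OF lin_funpow[OF g]])
    then show ?thesis unfolding geneig_def by blast
  qed
  show "a *s x \<in> geneig f c" if "x \<in> geneig f c" for a x
    using that by (auto simp: geneig_def lin_scale[OF lin_funpow[OF g]])
qed

lemma funpow_shift:
  "((\<lambda>x. f x - c *s x) ^^ n) (f x - c *s x) = ((\<lambda>x. f x - c *s x) ^^ Suc n) x"
  using funpow_swap1[of "\<lambda>x. f x - c *s x" n x] by simp

lemma geneig_shiftI:
  assumes "f x - c *s x \<in> geneig f c"
  shows "x \<in> geneig f c"
proof -
  from assms obtain n where "((\<lambda>x. f x - c *s x) ^^ n) (f x - c *s x) = 0"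
    unfolding geneig_def by blast
  then have "((\<lambda>x. f x - c *s x) ^^ Suc n) x = 0" by (rule trans[OF funpow_shift[symmetric]])
  then show ?thesis unfolding geneig_def by blast
qed

lemma geneig_shift:
  assumes "lin f" "x \<in> geneig f c"
  shows "f x - c *s x \<in> geneig f c"
proof -
  from assms obtain n where "((\<lambda>x. f x - c *s x) ^^ n) x = 0"
    unfolding geneig_def by blast
  then have "((\<lambda>x. f x - c *s x) ^^ Suc n) x = 0" by (simp add: lin_zero[OF assms(1)])
  then have "((\<lambda>x. f x - c *s x) ^^ n) (f x - c *s x) = 0"
    by (rule trans[OF funpow_shift])
  then show ?thesis unfolding geneig_def by blast
qed

text \<open>Induction on the nilpotency exponent in disguise: a claim about \<open>x\<close> is
  reduced to the claim about \<open>f x - c *s x\<close>. The facts below on brackets and on the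
  Killing form are obtained by nesting this rule.\<close>

lemma geneig_induct [consumes 2, case_names zero step]:
  assumes "lin f" "x \<in> geneig f c" "P 0"
    "\<And>x. x \<in> geneig f c \<Longrightarrow> P (f x - c *s x) \<Longrightarrow> P x"
  shows "P x"
proof -
  from assms(2) obtain n where "((\<lambda>x. f x - c *s x) ^^ n) x = 0" unfolding geneig_def by blast
  then show ?thesis
  proof (induction n arbitrary: x)
    case 0
    then show ?case using assms(3) by simp
  next
    case (Suc n)
    from Suc.prems have *: "((\<lambda>x. f x - c *s x) ^^ n) (f x - c *s x) = 0"
      by (rule trans[OF funpow_shift])
    then have "f x - c *s x \<in> geneig f c" unfolding geneig_def by blast
    then show ?case by (rule assms(4)[OF geneig_shiftI Suc.IH[OF *]])
  qed
qed

lemma geneig_disjoint: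
  assumes f: "lin f" and "c \<noteq> d" and x: "x \<in> geneig f c" and y: "x \<in> geneig f d"
  shows "x = 0"
  using f x y
proof (induction rule: geneig_induct)
  case zero
  show ?case by simp
next
  case (step x)
  have "f x - c *s x \<in> geneig f d"
  proof -
    have "f x - c *s x = (f x - d *s x) + (d - c) *s x" by (simp add: algebra_simps)
    then show ?thesis using geneig_shift[OF f step.prems] step.prems subspace_geneig[OF f]
      by (metis subspace_add subspace_scale)
  qed
  \<comment> \<open>The induction hypothesis kills \<open>f x - c *s x\<close>, so \<open>x\<close>
    is a true eigenvector and powers of \<open>f - d\<close> act on it as powers of
    \<open>c - d\<close>.\<close>
  then have fx: "f x = c *s x" using step.IH by simp
  have pow: "((\<lambda>x. f x - d *s x) ^^ n) x = (c - d) ^ n *s x" for n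
    by (induction n) (simp_all add: fx lin_scale[OF f] algebra_simps)
  from step.prems obtain n where "((\<lambda>x. f x - d *s x) ^^ n) x = 0" unfolding geneig_def by blast
  with pow have "(c - d) ^ n *s x = 0" by simp
  with \<open>c \<noteq> d\<close> show ?case by simp
qed

text \<open>On the generalized eigenspace of \<open>d \<noteq> c\<close> the map \<open>f - c\<close> is invertible, since it is
  \<open>d - c\<close> plus a nilpotent map.\<close>

lemma geneig_surj:
  assumes f: "lin f" and V: "subspace V" "\<And>x. x \<in> V \<Longrightarrow> f x \<in> V"
    and "c \<noteq> d" and y: "y \<in> geneig f d" "y \<in> V"
  shows "\<exists>z \<in> geneig f d \<inter> V. f z - c *s z = y"
  using f y
proof (induction rule: geneig_induct)
  case zero
  show ?case using f V subspace_geneig[OF f] by (intro bexI[of _ 0]) (auto simp: lin_zero subspace_0)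
next
  case (step y)
  have "f y - d *s y \<in> V" using V step.prems by (simp add: subspace_diff subspace_scale)
  with step.IH obtain z where z: "z \<in> geneig f d" "z \<in> V" "f z - c *s z = f y - d *s y" by blast
  let ?w = "inverse (d - c) *s (y - z)"
  have "f ?w - c *s ?w = inverse (d - c) *s ((f y - c *s y) - (f z - c *s z))"
    by (simp add: lin_scale[OF f] lin_diff[OF f] algebra_simps)
  also have "\<dots> = inverse (d - c) *s ((d - c) *s y)" unfolding z(3) by (simp add: algebra_simps)
  also have "\<dots> = y" using \<open>c \<noteq> d\<close> by simp
  finally show ?case using z step V(1) subspace_geneig[OF f]
    by (intro bexI[of _ ?w]) (auto intro: subspace_scale subspace_diff)
qed

text \<open>It suffices to find \<open>z\<close> in the span with \<open>(f - c) z\<close> equal to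
  \<open>(f - c) x\<close> modulo \<open>geneig f c\<close>, for then \<open>x - z\<close> lies in
  \<open>geneig f c\<close>. On components of eigenvalue \<open>d \<noteq> c\<close> the equation is
  exactly solvable; a component of eigenvalue \<open>c\<close> is absorbed by the congruence with
  \<open>z = 0\<close>.\<close>

lemma span_geneig_step:
  assumes f: "lin f" and V: "subspace V" "\<And>x. x \<in> V \<Longrightarrow> f x \<in> V" and "x \<in> V"
    and y: "f x - c *s x \<in> span (\<Union>d. geneig f d \<inter> V)"
  shows "x \<in> span (\<Union>d. geneig f d \<inter> V)"
proof -
  let ?S = "span (\<Union>d. geneig f d \<inter> V)"
  let ?P = "\<lambda>y. \<exists>z\<in>?S \<inter> V. f z - c *s z - y \<in> geneig f c \<inter> V"
  have Vc: "subspace (geneig f c \<inter> V)" using subspace_geneig[OF f] V(1) by (rule subspace_inter)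
  have "?P (f x - c *s x)"
    using y
  proof (induction rule: span_induct_alt)
    case base
    show ?case using Vc V subspace_geneig[OF f]
      by (intro bexI[of _ 0]) (auto simp: lin_zero[OF f] subspace_0 span_zero)
  next
    case (step a u v)
    then obtain d z where d: "u \<in> geneig f d" "u \<in> V" and
      z: "z \<in> ?S" "z \<in> V" "f z - c *s z - v \<in> geneig f c \<inter> V" by blast
    have "?P u"
    proof (cases "c = d")
      case True
      show ?thesis using V Vc d True subspace_geneig[OF f]
        by (intro bexI[of _ 0]) (auto simp: lin_zero[OF f] subspace_0 span_zero intro: subspace_neg)
    next
      case False
      from geneig_surj[OF f V False d] obtain w where "w \<in> geneig f d \<inter> V" "f w - c *s w = u" by blast
      then show ?thesis using subspace_0[OF Vc] by (intro bexI[of _ w]) (auto intro: span_base)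
    qed
    then obtain w where w: "w \<in> ?S" "w \<in> V" "f w - c *s w - u \<in> geneig f c \<inter> V" by blast
    let ?t = "a *s w + z"
    have "f ?t - c *s ?t - (a *s u + v) = a *s (f w - c *s w - u) + (f z - c *s z - v)"
      by (simp add: lin_add[OF f] lin_scale[OF f] algebra_simps)
    then have "f ?t - c *s ?t - (a *s u + v) \<in> geneig f c \<inter> V"
      using w(3) z(3) Vc by (metis subspace_add subspace_scale)
    moreover have "?t \<in> ?S \<inter> V" using w z V(1) by (auto intro: span_add span_scale subspace_add subspace_scale)
    ultimately show ?case by blast
  qed
  then obtain z where z: "z \<in> ?S" "z \<in> V" "f z - c *s z - (f x - c *s x) \<in> geneig f c" by blast
  have "f (x - z) - c *s (x - z) = - (f z - c *s z - (f x - c *s x))"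
    by (simp add: lin_diff[OF f] algebra_simps)
  then have "f (x - z) - c *s (x - z) \<in> geneig f c"
    using z(3) subspace_geneig[OF f] by (metis subspace_neg)
  then have "x - z \<in> geneig f c" by (rule geneig_shiftI)
  then have "x - z \<in> (\<Union>d. geneig f d \<inter> V)" using z(2) \<open>x \<in> V\<close> subspace_diff[OF V(1)] by blast
  then have "x - z \<in> ?S" by (rule span_base)
  then show ?thesis using z(1) by (metis diff_add_cancel span_add)
qed

section \<open>Polynomials in an endomorphism and the generalized eigenspace decomposition\<close>

definition poly_app :: "('b \<Rightarrow> 'b) \<Rightarrow> 'a poly \<Rightarrow> 'b \<Rightarrow> 'b" where
  "poly_app f p x = (\<Sum>i\<le>degree p. coeff p i *s (f ^^ i) x)"

lemma poly_app_eq: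
  assumes "degree p \<le> n"
  shows "poly_app f p x = (\<Sum>i\<le>n. coeff p i *s (f ^^ i) x)"
  unfolding poly_app_def using assms
  by (intro sum.mono_neutral_left) (auto simp: coeff_eq_0 not_le)

lemma poly_app_add: "poly_app f (p + q) x = poly_app f p x + poly_app f q x"
proof -
  let ?n = "max (degree p) (degree q)"
  have "poly_app f (p + q) x = (\<Sum>i\<le>?n. coeff (p + q) i *s (f ^^ i) x)"
    by (rule poly_app_eq) (rule degree_add_le_max)
  then show ?thesis
    using poly_app_eq[of p ?n f x] poly_app_eq[of q ?n f x]
    by (simp add: scale_left_distrib sum.distrib)
qed

lemma poly_app_smult: "poly_app f (smult a p) x = a *s poly_app f p x"
  using poly_app_eq[of "smult a p" "degree p" f x] degree_smult_le[of a p]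
  by (simp add: poly_app_def scale_sum_right)

lemma poly_app_diff: "poly_app f (p - q) x = poly_app f p x - poly_app f q x"
  using poly_app_add[of f "p - q" q x] by simp

lemma poly_app_monom: "poly_app f (monom 1 n) x = (f ^^ n) x"
proof -
  have "poly_app f (monom 1 n) x = (\<Sum>i\<le>n. (if i = n then (f ^^ i) x else 0))"
    unfolding poly_app_def by (intro sum.cong) (auto simp: degree_monom_eq)
  then show ?thesis by simp
qed

lemma poly_app_pCons_0: "poly_app f (pCons 0 p) x = poly_app f p (f x)"
proof -
  have "poly_app f (pCons 0 p) x = (\<Sum>i\<le>Suc (degree p). coeff (pCons 0 p) i *s (f ^^ i) x)"
    by (rule poly_app_eq) (rule degree_pCons_le)
  also have "\<dots> = (\<Sum>i\<le>degree p. coeff p i *s (f ^^ Suc i) x)"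
    by (subst sum.atMost_Suc_shift) simp
  finally show ?thesis by (simp add: poly_app_def funpow_swap1)
qed

lemma lin_poly_app: "lin f \<Longrightarrow> lin (poly_app f p)"
  by (rule linI)
    (simp_all add: poly_app_def lin_add[OF lin_funpow] lin_scale[OF lin_funpow] scale_right_distrib
      sum.distrib scale_sum_right mult.commute)

lemma poly_app_linear_factor:
  assumes "lin f"
  shows "poly_app f ([:- c, 1:] * p) x = poly_app f p (f x - c *s x)"
proof -
  have "[:- c, 1:] * p = pCons 0 p - smult c p" by simp
  then show ?thesis
    by (simp only: poly_app_diff poly_app_pCons_0 poly_app_smult
        lin_diff[OF lin_poly_app[OF assms]] lin_scale[OF lin_poly_app[OF assms]])
qed

lemma poly_app_annihilates:
  assumes f: "lin f"
  shows "\<exists>p. p \<noteq> 0 \<and> poly_app f p x = 0"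
proof -
  let ?W = "\<lambda>n. span ((\<lambda>i. (f ^^ i) x) ` {..<n})"
  have "\<exists>n. (f ^^ n) x \<in> ?W n"
  proof (rule ccontr)
    assume "\<not> ?thesis"
    then have no: "(f ^^ n) x \<notin> ?W n" for n by blast
    have "dim (?W n) = n" for n
    proof (induction n)
      case (Suc n)
      have "?W (Suc n) = span (insert ((f ^^ n) x) ((\<lambda>i. (f ^^ i) x) ` {..<n}))"
        by (simp add: lessThan_Suc)
      with no[of n] Suc show ?case by (simp add: dim_insert)
    qed simp
    then show False using dim_subset_UNIV[of "?W (Suc dimension)"] by simp
  qed
  then obtain n where n: "(f ^^ n) x \<in> ?W n" by blast
  \<comment> \<open>Polynomials of degree below \<open>n\<close>, phrased by coefficients so that
    \<open>n = 0\<close> leaves exactly the zero polynomial.\<close>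
  let ?T = "{y. \<exists>q. (\<forall>i\<ge>n. coeff q i = 0) \<and> y = poly_app f q x}"
  have "?W n \<subseteq> ?T"
  proof (rule span_minimal)
    show "(\<lambda>i. (f ^^ i) x) ` {..<n} \<subseteq> ?T"
    proof clarsimp
      fix i assume "i < n"
      then show "\<exists>q. (\<forall>i\<ge>n. coeff q i = 0) \<and> (f ^^ i) x = poly_app f q x"
        by (intro exI[of _ "monom 1 i"]) (simp add: poly_app_monom)
    qed
    show "subspace ?T"
    proof (rule subspaceI)
      show "0 \<in> ?T" by (auto intro!: exI[of _ 0] simp: poly_app_def)
      show "y + z \<in> ?T" if "y \<in> ?T" "z \<in> ?T" for y z
      proof -
        from that obtain p q where "\<forall>i\<ge>n. coeff p i = 0" "y = poly_app f p x"
          "\<forall>i\<ge>n. coeff q i = 0" "z = poly_app f q x" by blast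
        then show ?thesis by (auto intro!: exI[of _ "p + q"] simp: poly_app_add)
      qed
      show "c *s y \<in> ?T" if "y \<in> ?T" for c y
      proof -
        from that obtain p where "\<forall>i\<ge>n. coeff p i = 0" "y = poly_app f p x" by blast
        then show ?thesis by (auto intro!: exI[of _ "smult c p"] simp: poly_app_smult)
      qed
    qed
  qed
  with n obtain q where q: "\<forall>i\<ge>n. coeff q i = 0" "(f ^^ n) x = poly_app f q x" by blast
  have "coeff (monom 1 n - q) n = 1" using q(1) by simp
  then have "monom 1 n - q \<noteq> 0" by force
  then show ?thesis using q(2)
    by (intro exI[of _ "monom 1 n - q"]) (simp add: poly_app_diff poly_app_monom)
qed

text \<open>Induction on the degree of a polynomial annihilating \<open>x\<close>: algebraic
  closedness splits off a linear factor, the cofactor annihilates \<open>f x - c *s x\<close>, and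
  \<open>span_geneig_step\<close> returns to \<open>x\<close>. Working inside a stable
  \<open>V\<close> allows a decomposition to be refined by one operator after another.\<close>

lemma span_geneig:
  assumes f: "lin f" and V: "subspace V" "\<And>x. x \<in> V \<Longrightarrow> f x \<in> V"
  shows "V \<subseteq> span (\<Union>c. geneig f c \<inter> V)"
proof
  let ?S = "span (\<Union>c. geneig f c \<inter> V)"
  fix x assume "x \<in> V"
  obtain p where "p \<noteq> 0" "poly_app f p x = 0" using poly_app_annihilates[OF f] by blast
  then show "x \<in> ?S" using \<open>x \<in> V\<close>
  proof (induction "degree p" arbitrary: p x)
    case 0
    then have "poly_app f p x = coeff p 0 *s x" "coeff p 0 \<noteq> 0"
      using leading_coeff_neq_0[of p] by (simp_all add: poly_app_def)
    with 0 show ?case by (simp add: span_zero)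
  next
    case (Suc n)
    then obtain c where "poly p c = 0" using alg_closed_imp_poly_has_root[of p] by auto
    then obtain q where q: "p = [:- c, 1:] * q" by (metis poly_eq_0_iff_dvd dvdE)
    with Suc have "q \<noteq> 0" by auto
    moreover have "degree q = n"
    proof -
      have "degree p = degree [:- c, 1:] + degree q"
        unfolding q by (rule degree_mult_eq) (use \<open>q \<noteq> 0\<close> in auto)
      with Suc(2) show ?thesis by simp
    qed
    moreover have "poly_app f q (f x - c *s x) = 0"
      using Suc.prems(2) unfolding q poly_app_linear_factor[OF f] .
    moreover have "f x - c *s x \<in> V" using Suc.prems V by (simp add: subspace_diff subspace_scale)
    ultimately have "f x - c *s x \<in> ?S" using Suc(1) by blast
    then show ?case using span_geneig_step[OF f V] Suc.prems(3) by blast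
  qed
qed

section \<open>Traces on subspaces\<close>

definition basis_of :: "'b set \<Rightarrow> 'b set" where
  "basis_of S = (SOME B. B \<subseteq> S \<and> independent B \<and> span B = S)"

lemma basis_of:
  assumes "subspace S"
  shows "basis_of S \<subseteq> S" "independent (basis_of S)" "span (basis_of S) = S" "finite (basis_of S)"
proof -
  obtain B where "B \<subseteq> S" "independent B" "S \<subseteq> span B"
    by (rule maximal_independent_subset)
  then have "B \<subseteq> S \<and> independent B \<and> span B = S"
    using span_subspace[OF _ _ assms] by blast
  then have "basis_of S \<subseteq> S \<and> independent (basis_of S) \<and> span (basis_of S) = S"
    unfolding basis_of_def by (rule someI)
  then show "basis_of S \<subseteq> S" "independent (basis_of S)" "span (basis_of S) = S" "finite (basis_of S)"
    using finiteI_independent by auto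
qed

text \<open>A genuine trace only when \<open>f\<close> maps \<open>S\<close> into itself, because
  \<open>representation\<close> is 0 off the span; independence of the chosen basis is
  \<open>trace_eq\<close>.\<close>

definition trace :: "'b set \<Rightarrow> ('b \<Rightarrow> 'b) \<Rightarrow> 'a" where
  "trace S f = (\<Sum>b\<in>basis_of S. representation (basis_of S) (f b) b)"

lemma representation_lincomb:
  assumes "independent B" "\<And>c. c \<in> C \<Longrightarrow> v c \<in> span B"
  shows "representation B (\<Sum>c\<in>C. a c *s v c) b = (\<Sum>c\<in>C. a c * representation B (v c) b)"
proof -
  have "representation B (\<Sum>c\<in>C. a c *s v c) b = (\<Sum>c\<in>C. representation B (a c *s v c) b)"
    using assms by (subst representation_sum) (auto intro: span_scale)
  also have "\<dots> = (\<Sum>c\<in>C. a c * representation B (v c) b)"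
    using assms by (intro sum.cong) (simp_all add: representation_scale)
  finally show ?thesis .
qed

lemma representation_comp:
  assumes B: "independent B" and C: "independent C" and g: "lin g"
    and gC: "\<And>c. c \<in> C \<Longrightarrow> g c \<in> span B" and v: "v \<in> span C"
  shows "representation B (g v) b = (\<Sum>c\<in>C. representation C v c * representation B (g c) b)"
proof -
  have "v = (\<Sum>c\<in>C. representation C v c *s c)"
    using sum_representation_eq[OF C v finiteI_independent[OF C] subset_refl] by simp
  then have "g v = (\<Sum>c\<in>C. representation C v c *s g c)"
    by (metis (no_types, lifting) lin_sum[OF g] lin_scale[OF g] sum.cong)
  then show ?thesis using representation_lincomb[OF B gC] by simp
qed

text \<open>Both sides expand to the same double sum of products of matrix entries. With one map the
  identity this yields independence of the basis and restriction to a subspace containing the image;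
  with equal subspaces it makes commutators traceless.\<close>

lemma trace_swap_bases:
  assumes B: "independent B" and C: "independent C" and f: "lin f" and g: "lin g"
    and fB: "\<And>b. b \<in> B \<Longrightarrow> f b \<in> span C" and gC: "\<And>c. c \<in> C \<Longrightarrow> g c \<in> span B"
  shows "(\<Sum>b\<in>B. representation B (g (f b)) b) = (\<Sum>c\<in>C. representation C (f (g c)) c)"
proof -
  have "(\<Sum>b\<in>B. representation B (g (f b)) b)
      = (\<Sum>b\<in>B. \<Sum>c\<in>C. representation C (f b) c * representation B (g c) b)"
    using assms by (intro sum.cong) (simp_all add: representation_comp)
  also have "\<dots> = (\<Sum>c\<in>C. \<Sum>b\<in>B. representation B (g c) b * representation C (f b) c)"
    by (subst sum.swap) (simp add: mult.commute)
  also have "\<dots> = (\<Sum>c\<in>C. representation C (f (g c)) c)"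
    using assms by (intro sum.cong) (simp_all add: representation_comp[OF C B f])
  finally show ?thesis .
qed

lemma trace_swap:
  assumes "subspace S" "subspace T" "lin f" "lin g"
    and "\<And>x. x \<in> S \<Longrightarrow> f x \<in> T" "\<And>x. x \<in> T \<Longrightarrow> g x \<in> S"
  shows "trace S (\<lambda>x. g (f x)) = trace T (\<lambda>x. f (g x))"
  unfolding trace_def using assms basis_of[of S] basis_of[of T]
  by (intro trace_swap_bases) auto

lemma trace_eq:
  assumes "independent B" "span B = S" "lin f" "\<And>x. x \<in> S \<Longrightarrow> f x \<in> S"
  shows "trace S f = (\<Sum>b\<in>B. representation B (f b) b)"
proof -
  have S: "subspace S" using assms(2) by auto
  have "(\<Sum>b\<in>B. representation B ((\<lambda>x. x) (f b)) b)
      = (\<Sum>c\<in>basis_of S. representation (basis_of S) (f ((\<lambda>x. x) c)) c)"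
    using assms basis_of[OF S] span_superset[of B]
    by (intro trace_swap_bases) (auto simp: lin_ident)
  then show ?thesis by (simp add: trace_def)
qed

lemma trace_cong: "subspace S \<Longrightarrow> (\<And>x. x \<in> S \<Longrightarrow> f x = g x) \<Longrightarrow> trace S f = trace S g"
  unfolding trace_def using basis_of(1)[of S] by (intro sum.cong) auto

lemma trace_zero: "subspace S \<Longrightarrow> trace S (\<lambda>x. 0) = 0"
  by (simp add: trace_def representation_zero)

lemma trace_diff:
  assumes "subspace S" "\<And>x. x \<in> S \<Longrightarrow> f x \<in> S" "\<And>x. x \<in> S \<Longrightarrow> g x \<in> S"
  shows "trace S (\<lambda>x. f x - g x) = trace S f - trace S g"
  unfolding trace_def sum_subtractf[symmetric]
  using basis_of[OF assms(1)] assms by (intro sum.cong refl) (subst representation_diff, auto)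

lemma trace_add:
  assumes "subspace S" "\<And>x. x \<in> S \<Longrightarrow> f x \<in> S" "\<And>x. x \<in> S \<Longrightarrow> g x \<in> S"
  shows "trace S (\<lambda>x. f x + g x) = trace S f + trace S g"
  unfolding trace_def sum.distrib[symmetric]
  using basis_of[OF assms(1)] assms by (intro sum.cong refl) (subst representation_add, auto)

lemma trace_scale:
  assumes "subspace S" "\<And>x. x \<in> S \<Longrightarrow> f x \<in> S"
  shows "trace S (\<lambda>x. c *s f x) = c * trace S f"
  unfolding trace_def sum_distrib_left
  using basis_of[OF assms(1)] assms by (intro sum.cong refl) (subst representation_scale, auto)

lemma trace_scalar:
  assumes "subspace S"
  shows "trace S (\<lambda>x. c *s x) = of_nat (dim S) * c"
proof -
  have "trace S (\<lambda>x. x) = (\<Sum>b\<in>basis_of S. 1)"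
    unfolding trace_def using basis_of(2)[OF assms] by (intro sum.cong) (simp_all add: representation_basis)
  also have "\<dots> = of_nat (dim S)"
    using basis_of[OF assms] dim_span_eq_card_independent[of "basis_of S"] by simp
  finally show ?thesis using trace_scale[OF assms, of "\<lambda>x. x" c] by simp
qed

lemma trace_restrict:
  assumes S: "subspace S" and T: "subspace T" "T \<subseteq> S" and f: "lin f"
    and fS: "\<And>x. x \<in> S \<Longrightarrow> f x \<in> T"
  shows "trace S f = trace T f"
  using trace_swap[OF S T(1) f lin_ident] assms by auto

text \<open>Passing to the image of \<open>S\<close> preserves the trace by
  \<open>trace_restrict\<close>, and the image is strictly smaller unless \<open>S\<close> is
  zero.\<close>

lemma trace_nilpotent:
  assumes f: "lin f" and S: "subspace S" and fS: "\<And>x. x \<in> S \<Longrightarrow> f x \<in> S" and "S \<subseteq> geneig f 0"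
  shows "trace S f = 0"
  using S fS assms(4)
proof (induction "dim S" arbitrary: S rule: less_induct)
  case less
  show ?case
  proof (cases "f ` S = S")
    case True
    let ?B = "basis_of S"
    note B = basis_of[OF less.prems(1)]
    have "\<forall>b\<in>?B. \<exists>n. (f ^^ n) b = 0"
      using B(1) less.prems(3) by (auto simp: geneig_def)
    then obtain n where "\<forall>b\<in>?B. (f ^^ n b) b = 0" unfolding bchoice_iff by blast
    then have n: "(f ^^ n b) b = 0" if "b \<in> ?B" for b using that by blast
    \<comment> \<open>A single exponent that works on all of \<open>S\<close>: the sum over a basis
      dominates each individual exponent.\<close>
    let ?N = "\<Sum>b\<in>?B. n b"
    have "(f ^^ ?N) x = 0" if "x \<in> S" for x
    proof -
      have "(f ^^ ?N) b = 0" if "b \<in> ?B" for b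
        using funpow_zero_mono[OF f n[OF that]] B(4) that by (simp add: member_le_sum)
      moreover have "x \<in> span ?B" using that B(3) by simp
      ultimately have "(f ^^ ?N) x \<in> {0}"
        using lin_span_subset[OF lin_funpow[OF f], of ?B ?N "{0}" x] by simp
      then show ?thesis by simp
    qed
    moreover have "(f ^^ k) ` S = S" for k
    proof (induction k)
      case (Suc k)
      have "(f ^^ Suc k) ` S = f ` (f ^^ k) ` S" by (simp only: funpow.simps image_comp)
      then show ?case using Suc True by simp
    qed simp
    ultimately have "S \<subseteq> {0}" by (metis image_subset_iff insertI1)
    then have "trace S f = trace S (\<lambda>x. 0)"
      using less.prems(1) by (intro trace_cong) (auto simp: lin_zero[OF f])
    with less.prems(1) show ?thesis by (simp add: trace_zero)
  next
    case False
    have sub: "subspace (f ` S)"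
      using less.prems(1) by (rule module_hom.subspace_image[rotated])
        (use f in \<open>simp add: module_hom_iff_linear\<close>)
    have ss: "f ` S \<subset> S" using False less.prems(2) by auto
    then have "dim (f ` S) < dim S"
      using dim_psubset[of "f ` S" S] sub less.prems(1) by (metis span_eq_iff)
    then have "trace (f ` S) f = 0"
      using less.prems sub by (intro less.hyps) auto
    then show ?thesis
      using trace_restrict[OF less.prems(1) sub _ f] ss by auto
  qed
qed

lemma geneig_shift_eq: "geneig (\<lambda>x. f x - c *s x) 0 = geneig f c"
  by (simp add: geneig_def)

lemma trace_geneig:
  assumes f: "lin f" and S: "subspace S" and fS: "\<And>x. x \<in> S \<Longrightarrow> f x \<in> S" and "S \<subseteq> geneig f c"
  shows "trace S f = of_nat (dim S) * c"
proof -
  have "trace S (\<lambda>x. f x - c *s x) = 0"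
    using assms by (intro trace_nilpotent)
      (auto simp: geneig_shift_eq lin_diff_scale subspace_diff subspace_scale)
  moreover have "trace S (\<lambda>x. f x - c *s x) = trace S f - of_nat (dim S) * c"
    using assms by (subst trace_diff) (auto simp: trace_scalar subspace_scale)
  ultimately show ?thesis by simp
qed

lemma independent_Un:
  assumes "independent B" "independent C" "span B \<inter> span C \<subseteq> {0}"
  shows "independent (B \<union> C)" "B \<inter> C = {}"
proof -
  show "B \<inter> C = {}"
  proof (rule equals0I)
    fix b assume b: "b \<in> B \<inter> C"
    then have "b \<in> span B \<inter> span C" by (auto intro: span_base)
    with assms(3) have "b = 0" by blast
    with b dependent_zero[of B] assms(1) show False by simp
  qed
  have "finite C" using assms finiteI_independent by blast
  then show "independent (B \<union> C)"
    using assms(2,3)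
  proof (induction C rule: finite_induct)
    case empty
    then show ?case using assms by simp
  next
    case (insert c C)
    have C: "independent C" "c \<notin> span C"
      using insert.prems(1) insert.hyps by (auto simp: independent_insert)
    have "span C \<subseteq> span (insert c C)" by (rule span_mono) auto
    then have ind: "independent (B \<union> C)" using insert C by auto
    have "c \<notin> span (B \<union> C)"
    proof
      assume "c \<in> span (B \<union> C)"
      then obtain b d where bd: "c = b + d" "b \<in> span B" "d \<in> span C" by (auto simp: span_Un)
      then have "b = c - d" by simp
      then have "b \<in> span (insert c C)"
        using bd(3) \<open>span C \<subseteq> _\<close> by (auto intro!: span_diff intro: span_base)
      with bd insert.prems have "b = 0" by auto
      with bd C show False by simp
    qed
    with ind show ?case by (simp add: independent_insert)
  qed
qed

lemma trace_sum2:
  assumes S: "subspace S" "\<And>x. x \<in> S \<Longrightarrow> f x \<in> S" and T: "subspace T" "\<And>x. x \<in> T \<Longrightarrow> f x \<in> T"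
    and f: "lin f" and ST: "S \<inter> T \<subseteq> {0}"
  shows "trace (span (S \<union> T)) f = trace S f + trace T f"
proof -
  let ?B = "basis_of S" and ?C = "basis_of T"
  note B = basis_of[OF S(1)] and C = basis_of[OF T(1)]
  have ind: "independent (?B \<union> ?C)" "?B \<inter> ?C = {}"
    using independent_Un[OF B(2) C(2)] B(3) C(3) ST by auto
  have sp: "span (?B \<union> ?C) = span (S \<union> T)"
    unfolding span_Un B(3) C(3) using S(1) T(1) by (simp only: span_eq_iff[THEN iffD2])
  have fS: "f x \<in> span (S \<union> T)" if "x \<in> span (S \<union> T)" for x
    using f _ subspace_span that by (rule lin_span_subset) (use S T in \<open>auto intro: span_base\<close>)
  have "trace (span (S \<union> T)) f = (\<Sum>b\<in>?B \<union> ?C. representation (?B \<union> ?C) (f b) b)"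
    by (rule trace_eq[OF ind(1) sp f fS])
  also have "\<dots> = (\<Sum>b\<in>?B. representation (?B \<union> ?C) (f b) b) + (\<Sum>b\<in>?C. representation (?B \<union> ?C) (f b) b)"
    using B(4) C(4) ind(2) by (rule sum.union_disjoint)
  also have "(\<Sum>b\<in>?B. representation (?B \<union> ?C) (f b) b) = trace S f"
    unfolding trace_def using B S(2) by (intro sum.cong) (auto simp: representation_extend[OF ind(1), of _ ?B])
  also have "(\<Sum>b\<in>?C. representation (?B \<union> ?C) (f b) b) = trace T f"
    unfolding trace_def using C T(2) by (intro sum.cong) (auto simp: representation_extend[OF ind(1), of _ ?C])
  finally show ?thesis .
qed

text \<open>Independence is demanded for every \<open>J\<close> avoiding \<open>i\<close>, so that
  the hypothesis passes to smaller index sets in the induction.\<close>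

lemma trace_direct_sum:
  assumes "finite I" and S: "\<And>i. i \<in> I \<Longrightarrow> subspace (S i)" "\<And>i x. i \<in> I \<Longrightarrow> x \<in> S i \<Longrightarrow> f x \<in> S i"
    and f: "lin f" and ind: "\<And>i J. i \<in> I \<Longrightarrow> J \<subseteq> I \<Longrightarrow> i \<notin> J \<Longrightarrow> S i \<inter> span (\<Union>j\<in>J. S j) \<subseteq> {0}"
  shows "trace (span (\<Union>i\<in>I. S i)) f = (\<Sum>i\<in>I. trace (S i) f)"
  using assms(1) S ind
proof (induction I rule: finite_induct)
  case empty
  have "trace {0} f = trace {0} (\<lambda>x. 0)" by (rule trace_cong) (auto simp: lin_zero[OF f])
  then show ?case by (simp add: trace_zero)
next
  case (insert i I)
  let ?T = "span (\<Union>i\<in>I. S i)"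
  have T: "f x \<in> ?T" if "x \<in> ?T" for x
    using f _ subspace_span that by (rule lin_span_subset) (use insert.prems in \<open>auto intro!: span_base\<close>)
  have "span (\<Union>i\<in>insert i I. S i) = span (S i \<union> ?T)"
    by (simp add: span_Un span_span)
  then have "trace (span (\<Union>i\<in>insert i I. S i)) f = trace (S i) f + trace ?T f"
    using insert.prems insert.hyps T by (simp add: trace_sum2[OF _ _ _ _ f] subset_insertI)
  moreover have "trace ?T f = (\<Sum>i\<in>I. trace (S i) f)"
    using insert.prems by (intro insert.IH) (auto simp: subset_insertI2)
  ultimately show ?case using insert.hyps by simp
qed

lemma span_Union_sumE:
  assumes "finite I" "\<And>i. i \<in> I \<Longrightarrow> subspace (S i)" "x \<in> span (\<Union>i\<in>I. S i)"
  obtains y where "\<And>i. i \<in> I \<Longrightarrow> y i \<in> S i" "x = (\<Sum>i\<in>I. y i)"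
proof -
  have "\<exists>y. (\<forall>i\<in>I. y i \<in> S i) \<and> x = (\<Sum>i\<in>I. y i)"
    using assms
  proof (induction I arbitrary: x rule: finite_induct)
    case empty
    then show ?case by simp
  next
    case (insert i I)
    then have "x \<in> span (S i \<union> (\<Union>i\<in>I. S i))" by simp
    then obtain u v where uv: "u \<in> span (S i)" "v \<in> span (\<Union>i\<in>I. S i)" "x = u + v"
      by (auto simp: span_Un)
    with insert obtain y where y: "\<forall>i\<in>I. y i \<in> S i" "v = (\<Sum>i\<in>I. y i)" by auto
    have "u \<in> S i" using uv(1) insert.prems(1)[of i] span_eq_iff by blast
    with uv y insert.hyps show ?case
      by (intro exI[of _ "y(i := u)"]) (auto intro!: sum.cong)
  qed
  then show ?thesis using that by blast
qed

end

section \<open>Weight spaces of a Cartan subalgebra\<close>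

locale simple_lie_algebra = lie_algebra scale br + alg_closed_space scale Basis
  for scale :: "'k::{field_char_0, alg_closed_field} \<Rightarrow> 'g::ab_group_add \<Rightarrow> 'g" (infixr "*s" 75)
    and br :: "'g \<Rightarrow> 'g \<Rightarrow> 'g" and Basis :: "'g set" +
  fixes H :: "'g set"
  assumes simple: "simple" and cartan: "cartan_subalgebra H"
begin

lemma lin_br: "lin (br x)"
  by (rule linI) (simp_all add: br_add_right br_scale_right)

lemma br_0_right [simp]: "br x 0 = 0"
  and br_0_left [simp]: "br 0 x = 0"
  using br_scale_right[of x 0 0] br_scale_left[of 0 0 x] by simp_all

lemma br_minus_right: "br x (- y) = - br x y"
  and br_minus_left: "br (- x) y = - br x y"
  using br_scale_right[of x "-1" y] br_scale_left[of "-1" x y] by simp_all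

lemma br_diff_right: "br x (y - z) = br x y - br x z"
  and br_diff_left: "br (x - y) z = br x z - br y z"
  using br_add_right[of x y "- z"] br_add_left[of x "- y" z] by (simp_all add: br_minus_right br_minus_left)

lemma br_anti: "br x y = - br y x"
proof -
  have "br (x + y) (x + y) = br x x + br x y + (br y x + br y y)"
    unfolding br_add_left br_add_right by (simp add: algebra_simps)
  then have "br x y + br y x = 0" by (simp add: br_self)
  then show ?thesis by (simp add: br_self eq_neg_iff_add_eq_0)
qed

lemma br_derivation: "br x (br y z) = br (br x y) z + br y (br x z)"
  using jacobi[of x y z] br_anti[of z x] br_anti[of z "br x y"]
  by (simp add: br_minus_right algebra_simps)

lemma br_br: "br (br x y) z = br x (br y z) - br y (br x z)"
  using br_derivation[of x y z] by simp

lemma lin_br_left: "lin (\<lambda>x. br x y)"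
  by (rule linI) (simp_all add: br_add_left br_scale_left)

lemma subspace_H: "subspace H"
  and br_H: "x \<in> H \<Longrightarrow> y \<in> H \<Longrightarrow> br x y \<in> H"
  and nilpotent_H: "\<exists>n. lower_central H n = {0}"
  and normalizer_H: "(\<And>h. h \<in> H \<Longrightarrow> br x h \<in> H) \<Longrightarrow> x \<in> H"
  using cartan by (auto simp: cartan_subalgebra_def lie_subalgebra_def nilpotent_def normalizer_def)

text \<open>Generalized eigenvectors are used because diagonalizability of \<open>br h\<close> is
  only reached at \<open>wspace_eigen\<close>. The weight is an arbitrary function at first; its
  linearity is derived from traces.\<close>

definition wspace :: "('g \<Rightarrow> 'k) \<Rightarrow> 'g set" where
  "wspace \<alpha> = {x. \<forall>h\<in>H. x \<in> geneig (br h) (\<alpha> h)}"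

lemma gwD: "x \<in> wspace \<alpha> \<Longrightarrow> h \<in> H \<Longrightarrow> x \<in> geneig (br h) (\<alpha> h)"
  by (simp add: wspace_def)

lemma subspace_wspace: "subspace (wspace \<alpha>)"
proof -
  have "wspace \<alpha> = (\<Inter>h\<in>H. geneig (br h) (\<alpha> h))" by (auto simp: wspace_def)
  then show ?thesis by (simp add: subspace_Int subspace_geneig lin_br)
qed

lemma geneig_br:
  assumes "x \<in> geneig (br h) a" "y \<in> geneig (br h) b"
  shows "br x y \<in> geneig (br h) (a + b)"
proof -
  note S = subspace_geneig[OF lin_br]
  have "\<forall>y\<in>geneig (br h) b. br x y \<in> geneig (br h) (a + b)"
    using lin_br assms(1)
  proof (induction rule: geneig_induct)
    case zero
    show ?case by (simp add: subspace_0[OF S])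
  next
    case (step x)
    show ?case
    proof
      fix y assume "y \<in> geneig (br h) b"
      with lin_br show "br x y \<in> geneig (br h) (a + b)"
      proof (induction rule: geneig_induct)
        case zero
        show ?case by (simp add: subspace_0[OF S])
      next
        case step': (step y)
        have "br h (br x y) - (a + b) *s br x y = br (br h x - a *s x) y + br x (br h y - b *s y)"
          unfolding br_derivation[of h x y]
          by (simp add: br_diff_left br_diff_right br_scale_left br_scale_right algebra_simps)
        then have "br h (br x y) - (a + b) *s br x y \<in> geneig (br h) (a + b)"
          using step.IH step' subspace_add[OF S] by simp
        then show ?case by (rule geneig_shiftI)
      qed
    qed
  qed
  with assms(2) show ?thesis by blast
qed

lemma wspace_br: "x \<in> wspace \<alpha> \<Longrightarrow> y \<in> wspace \<mu> \<Longrightarrow> br x y \<in> wspace (\<alpha> + \<mu>)"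
  by (auto simp: wspace_def intro: geneig_br)

lemma H_subset_wspace_0: "H \<subseteq> wspace 0"
proof
  fix x assume x: "x \<in> H"
  obtain n where n: "lower_central H n = {0}" using nilpotent_H by blast
  have "(br h ^^ k) x \<in> lower_central H k" if "h \<in> H" for h k
    using that x by (induction k) (auto intro!: span_base)
  then have "(br h ^^ n) x = 0" if "h \<in> H" for h using that n by blast
  then show "x \<in> wspace 0" by (auto simp: wspace_def geneig_def)
qed

lemma br_wspace: "h \<in> H \<Longrightarrow> x \<in> wspace \<alpha> \<Longrightarrow> br h x \<in> wspace \<alpha>"
  using wspace_br[of h 0 x \<alpha>] H_subset_wspace_0 by auto

text \<open>\<open>wspace \<alpha>\<close> depends only on the values of \<open>\<alpha>\<close> on
  \<open>H\<close>. Normalizing weights to vanish elsewhere ensures that two distinct ones differ at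
  some element of \<open>H\<close>.\<close>

abbreviation H_supported :: "('g \<Rightarrow> 'k) set" where
  "H_supported \<equiv> {\<alpha>. \<forall>x. x \<notin> H \<longrightarrow> \<alpha> x = 0}"

text \<open>If each \<open>br h\<close> has a single generalized eigenvalue on \<open>V\<close>,
  then \<open>V\<close> lies in one weight space. Otherwise some \<open>br h\<close> splits
  \<open>V\<close> into proper stable pieces, and induction on the dimension applies.\<close>

lemma span_wspace_stable:
  assumes "subspace V" "\<And>h x. h \<in> H \<Longrightarrow> x \<in> V \<Longrightarrow> br h x \<in> V"
  shows "V \<subseteq> span (\<Union>\<alpha>\<in> H_supported. wspace \<alpha> \<inter> V)"
  using assms
proof (induction "dim V" arbitrary: V rule: less_induct)
  case less
  show ?case
  proof (cases "\<forall>h\<in>H. \<exists>c. V \<subseteq> geneig (br h) c")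
    case True
    then obtain l where l: "\<forall>h\<in>H. V \<subseteq> geneig (br h) (l h)" by metis
    let ?l = "\<lambda>h. if h \<in> H then l h else 0"
    have "V \<subseteq> wspace ?l" using l by (auto simp: wspace_def)
    moreover have "?l \<in> H_supported" by simp
    ultimately have "V \<subseteq> (\<Union>\<alpha>\<in> H_supported. wspace \<alpha> \<inter> V)" by blast
    then show ?thesis using span_superset by blast
  next
    case False
    then obtain h where h: "h \<in> H" "\<And>c. \<not> V \<subseteq> geneig (br h) c" by blast
    have "geneig (br h) c \<inter> V \<subseteq> span (\<Union>\<alpha>\<in> H_supported. wspace \<alpha> \<inter> V)" for c
    proof -
      let ?V = "geneig (br h) c \<inter> V"
      have sub: "subspace ?V" using less.prems(1) subspace_geneig[OF lin_br] by (simp add: subspace_inter)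
      \<comment> \<open>\<open>H\<close> lies in the generalized eigenspace of \<open>br h\<close>
        for eigenvalue 0, so \<open>br k\<close> preserves the eigenvalue \<open>c\<close> even
        before \<open>H\<close> is known to be abelian.\<close>
      have "br k x \<in> ?V" if "k \<in> H" "x \<in> ?V" for k x
        using geneig_br[of k h 0 x c] H_subset_wspace_0 gwD[of k 0 h] h(1) that less.prems(2) by auto
      moreover have "dim ?V < dim V"
      proof -
        have "?V \<subset> V" using h(2)[of c] by blast
        then show ?thesis using dim_psubset[of ?V V] sub less.prems(1) by (metis span_eq_iff)
      qed
      ultimately have "?V \<subseteq> span (\<Union>\<alpha>\<in> H_supported. wspace \<alpha> \<inter> ?V)" using less.hyps[of ?V] sub by blast
      also have "\<dots> \<subseteq> span (\<Union>\<alpha>\<in> H_supported. wspace \<alpha> \<inter> V)" by (rule span_mono) blast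
      finally show ?thesis .
    qed
    then have "span (\<Union>c. geneig (br h) c \<inter> V) \<subseteq> span (\<Union>\<alpha>\<in> H_supported. wspace \<alpha> \<inter> V)"
      by (intro span_minimal) auto
    then show ?thesis using span_geneig[OF lin_br less.prems(1), of h] less.prems(2)[OF h(1)] by blast
  qed
qed

text \<open>A power of \<open>br h - \<mu> h\<close> removes the \<mu>-component and preserves the
  other weight spaces. The induction hypothesis then places \<open>x \<alpha>\<close> in two
  generalized eigenspaces of \<open>br h\<close> with different eigenvalues.\<close>

lemma wspace_sum_zero:
  assumes "finite F" "F \<subseteq> H_supported" "\<And>\<alpha>. \<alpha> \<in> F \<Longrightarrow> x \<alpha> \<in> wspace \<alpha>" "(\<Sum>\<alpha>\<in>F. x \<alpha>) = 0" "\<alpha> \<in> F"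
  shows "x \<alpha> = 0"
  using assms
proof (induction F arbitrary: x \<alpha> rule: finite_induct)
  case empty
  then show ?case by simp
next
  case (insert \<mu> F)
  have F: "x \<alpha> = 0" if \<alpha>: "\<alpha> \<in> F" for \<alpha>
  proof -
    have "\<alpha> \<noteq> \<mu>" using \<alpha> insert.hyps by blast
    then obtain h where h: "\<alpha> h \<noteq> \<mu> h" by blast
    then have "h \<in> H" using insert.prems(1) \<alpha> by force
    let ?g = "\<lambda>x. br h x - \<mu> h *s x"
    have "x \<mu> \<in> geneig (br h) (\<mu> h)" using insert.prems(2)[of \<mu>] \<open>h \<in> H\<close> by (simp add: wspace_def)
    then obtain n where n: "(?g ^^ n) (x \<mu>) = 0" by (auto simp: geneig_def)
    have lin: "lin (?g ^^ n)" by (intro lin_funpow lin_diff_scale lin_br)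
    have "(?g ^^ k) (x \<nu>) \<in> wspace \<nu>" if "\<nu> \<in> F" for \<nu> k
    proof (induction k)
      case (Suc k)
      then show ?case using \<open>h \<in> H\<close> subspace_wspace by (simp add: br_wspace subspace_diff subspace_scale)
    qed (use that insert.prems(2) in auto)
    moreover have "(\<Sum>\<nu>\<in>F. (?g ^^ n) (x \<nu>)) = 0"
      using insert.prems(3) insert.hyps n lin_sum[OF lin, of x "insert \<mu> F"] by (simp add: lin_zero[OF lin])
    ultimately have "(?g ^^ n) (x \<alpha>) = 0"
      using insert.IH[of "\<lambda>\<nu>. (?g ^^ n) (x \<nu>)"] insert.prems(1) \<alpha> by auto
    then have "x \<alpha> \<in> geneig (br h) (\<mu> h)" by (auto simp: geneig_def)
    moreover have "x \<alpha> \<in> geneig (br h) (\<alpha> h)"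
      using insert.prems(2)[of \<alpha>] \<alpha> \<open>h \<in> H\<close> by (simp add: wspace_def)
    ultimately show ?thesis using geneig_disjoint[OF lin_br h] by blast
  qed
  moreover have "x \<mu> = 0" using insert.prems(3) insert.hyps F by simp
  ultimately show ?case using insert.prems(4) by blast
qed

lemma wspace_independent:
  assumes "finite F" "F \<subseteq> H_supported" "\<mu> \<in> H_supported" "\<mu> \<notin> F" and x: "x \<in> wspace \<mu>" "x \<in> span (\<Union>\<alpha>\<in>F. wspace \<alpha>)"
  shows "x = 0"
proof -
  obtain y where y: "\<And>\<alpha>. \<alpha> \<in> F \<Longrightarrow> y \<alpha> \<in> wspace \<alpha>" "x = (\<Sum>\<alpha>\<in>F. y \<alpha>)"
    using span_Union_sumE[OF assms(1) subspace_wspace x(2)] by blast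
  let ?y = "y(\<mu> := - x)"
  have "(\<Sum>\<alpha>\<in>F. ?y \<alpha>) = (\<Sum>\<alpha>\<in>F. y \<alpha>)" using assms(4) by (intro sum.cong) auto
  then have "(\<Sum>\<alpha>\<in>insert \<mu> F. ?y \<alpha>) = 0" using assms(1,4) y(2) by simp
  then have "?y \<mu> = 0"
    using assms y(1) x(1) by (intro wspace_sum_zero[of "insert \<mu> F" ?y]) (auto simp: subspace_neg[OF subspace_wspace])
  then show ?thesis by simp
qed

definition \<Lambda> :: "('g \<Rightarrow> 'k) set" where
  "\<Lambda> = {\<alpha> \<in> H_supported. wspace \<alpha> \<noteq> {0}}"

lemma \<Lambda>_W: "\<Lambda> \<subseteq> H_supported" by (auto simp: \<Lambda>_def)

lemma \<Lambda>_nonzeroE: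
  assumes "\<alpha> \<in> \<Lambda>" obtains x where "x \<in> wspace \<alpha>" "x \<noteq> 0"
  using assms subspace_0[OF subspace_wspace] by (auto simp: \<Lambda>_def)

lemma finite_\<Lambda>: "finite \<Lambda>"
proof -
  have *: "card F \<le> dim (span (\<Union>\<alpha>\<in>F. wspace \<alpha>))" if "finite F" "F \<subseteq> \<Lambda>" for F
    using that
  proof (induction F rule: finite_induct)
    case (insert \<mu> F)
    let ?S = "\<lambda>F. \<Union>\<alpha>\<in>F. wspace \<alpha>"
    obtain x where x: "x \<in> wspace \<mu>" "x \<noteq> 0" using insert.prems \<Lambda>_nonzeroE by blast
    have "x \<notin> span (?S F)" using wspace_independent[OF insert.hyps(1) _ _ insert.hyps(2) x(1)] insert.prems x \<Lambda>_W by blast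
    moreover have "x \<in> span (?S (insert \<mu> F))" using x by (intro span_base) auto
    moreover have "span (?S F) \<subseteq> span (?S (insert \<mu> F))" by (rule span_mono) auto
    ultimately have "span (?S F) \<subset> span (?S (insert \<mu> F))" by blast
    then have "dim (?S F) < dim (?S (insert \<mu> F))" by (rule dim_psubset)
    then show ?case using insert.IH insert.prems insert.hyps
      by (simp only: dim_span card_insert_disjoint) simp
  qed simp
  have "\<And>F. F \<subseteq> \<Lambda> \<Longrightarrow> finite F \<Longrightarrow> card F \<le> dimension"
    by (rule le_trans[OF * dim_subset_UNIV])
  then show ?thesis by (rule finite_if_finite_subsets_card_bdd[THEN conjunct1])
qed

lemma span_wspace: "span (\<Union>\<alpha>\<in>\<Lambda>. wspace \<alpha>) = UNIV"
proof -
  have "(\<Union>\<alpha>\<in> H_supported. wspace \<alpha> \<inter> UNIV) \<subseteq> span (\<Union>\<alpha>\<in>\<Lambda>. wspace \<alpha>)"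
  proof
    fix x assume "x \<in> (\<Union>\<alpha>\<in> H_supported. wspace \<alpha> \<inter> UNIV)"
    then obtain \<alpha> where \<alpha>: "\<alpha> \<in> H_supported" "x \<in> wspace \<alpha>" by blast
    show "x \<in> span (\<Union>\<alpha>\<in>\<Lambda>. wspace \<alpha>)"
    proof (cases "x = 0")
      case False
      with \<alpha> have "\<alpha> \<in> \<Lambda>" by (auto simp: \<Lambda>_def)
      with \<alpha> show ?thesis by (blast intro: span_base)
    qed (simp add: span_zero)
  qed
  then have "span (\<Union>\<alpha>\<in> H_supported. wspace \<alpha> \<inter> UNIV) \<subseteq> span (\<Union>\<alpha>\<in>\<Lambda>. wspace \<alpha>)" by (intro span_minimal) auto
  then show ?thesis using span_wspace_stable[OF subspace_UNIV] by auto
qed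

lemma wspace_disjoint: "C \<subseteq> \<Lambda> \<Longrightarrow> \<mu> \<in> \<Lambda> \<Longrightarrow> \<mu> \<notin> C \<Longrightarrow> wspace \<mu> \<inter> span (\<Union>\<alpha>\<in>C. wspace \<alpha>) \<subseteq> {0}"
  using wspace_independent[of C \<mu>] finite_subset[OF _ finite_\<Lambda>, of C] \<Lambda>_W by blast

lemma trace_span_wspace:
  assumes "C \<subseteq> \<Lambda>" "lin f" "\<And>\<alpha> x. \<alpha> \<in> C \<Longrightarrow> x \<in> wspace \<alpha> \<Longrightarrow> f x \<in> wspace \<alpha>"
  shows "trace (span (\<Union>\<alpha>\<in>C. wspace \<alpha>)) f = (\<Sum>\<alpha>\<in>C. trace (wspace \<alpha>) f)"
proof (rule trace_direct_sum)
  show "finite C" using assms(1) finite_\<Lambda> by (rule finite_subset)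
  show "wspace \<alpha> \<inter> span (\<Union>\<beta>\<in>J. wspace \<beta>) \<subseteq> {0}" if "\<alpha> \<in> C" "J \<subseteq> C" "\<alpha> \<notin> J" for \<alpha> J
    using that assms(1) by (intro wspace_disjoint) auto
qed (use assms subspace_wspace in auto)

lemma trace_UNIV_wspace:
  assumes "lin f" "\<And>\<alpha> x. \<alpha> \<in> \<Lambda> \<Longrightarrow> x \<in> wspace \<alpha> \<Longrightarrow> f x \<in> wspace \<alpha>"
  shows "trace UNIV f = (\<Sum>\<alpha>\<in>\<Lambda>. trace (wspace \<alpha>) f)"
  using trace_span_wspace[OF subset_refl assms] by (simp add: span_wspace)

lemma trace_bracket:
  assumes "subspace M" "\<And>z. z \<in> M \<Longrightarrow> br x z \<in> M" "\<And>z. z \<in> M \<Longrightarrow> br y z \<in> M"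
  shows "trace M (br (br x y)) = 0"
proof -
  have "trace M (br (br x y)) = trace M (\<lambda>z. br x (br y z)) - trace M (\<lambda>z. br y (br x z))"
    using assms by (simp add: br_br trace_diff cong: trace_cong)
  also have "trace M (\<lambda>z. br x (br y z)) = trace M (\<lambda>z. br y (br x z))"
    using assms by (intro trace_swap lin_br)
  finally show ?thesis by simp
qed

lemma trace_stable:
  assumes V: "subspace V" "\<And>h x. h \<in> H \<Longrightarrow> x \<in> V \<Longrightarrow> br h x \<in> V" "V \<subseteq> wspace \<alpha>" and "h \<in> H"
  shows "trace V (br h) = of_nat (dim V) * \<alpha> h"
  using assms by (intro trace_geneig lin_br) (auto simp: wspace_def)

lemma trace_wspace: "h \<in> H \<Longrightarrow> trace (wspace \<alpha>) (br h) = of_nat (dim (wspace \<alpha>)) * \<alpha> h"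
  by (rule trace_stable) (auto simp: subspace_wspace br_wspace)

text \<open>The number \<open>\<alpha> h\<close> is the trace of \<open>br h\<close> on
  \<open>V\<close> divided by the dimension, and traces are linear in \<open>h\<close> and vanish on
  brackets.\<close>

lemma weight_linear:
  assumes V: "subspace V" "\<And>h x. h \<in> H \<Longrightarrow> x \<in> V \<Longrightarrow> br h x \<in> V" "V \<subseteq> wspace \<alpha>" and "V \<noteq> {0}"
    and h: "h \<in> H" "k \<in> H"
  shows "\<alpha> (h + k) = \<alpha> h + \<alpha> k" "\<alpha> (c *s h) = c * \<alpha> h" "\<alpha> (br h k) = 0"
proof -
  have t: "trace V (br h) = of_nat (dim V) * \<alpha> h" if "h \<in> H" for h
    using V that by (intro trace_stable)
  have d: "of_nat (dim V) \<noteq> (0 :: 'k)" using assms(4) subspace_0[OF V(1)] by auto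
  have "of_nat (dim V) * \<alpha> (h + k) = of_nat (dim V) * (\<alpha> h + \<alpha> k)"
  proof -
    have "trace V (br (h + k)) = trace V (br h) + trace V (br k)"
      using trace_add[OF V(1) V(2)[OF h(1)] V(2)[OF h(2)]] by (simp add: br_add_left[abs_def])
    then show ?thesis
      using t[OF h(1)] t[OF h(2)] t[OF subspace_add[OF subspace_H h]] by (simp add: algebra_simps)
  qed
  with d show "\<alpha> (h + k) = \<alpha> h + \<alpha> k" by simp
  have "of_nat (dim V) * \<alpha> (c *s h) = of_nat (dim V) * (c * \<alpha> h)"
  proof -
    have "trace V (br (c *s h)) = c * trace V (br h)"
      using trace_scale[OF V(1) V(2)[OF h(1)], where c = c] by (simp add: br_scale_left[abs_def])
    then show ?thesis
      using t[OF h(1)] t[OF subspace_scale[OF subspace_H h(1)], of c] by (simp add: algebra_simps)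
  qed
  with d show "\<alpha> (c *s h) = c * \<alpha> h" by simp
  have "of_nat (dim V) * \<alpha> (br h k) = 0"
    using t[OF br_H[OF h]] trace_bracket[OF V(1) V(2)[OF h(1)] V(2)[OF h(2)]] by simp
  with d show "\<alpha> (br h k) = 0" by simp
qed

lemma \<Lambda>_linear:
  assumes "\<alpha> \<in> \<Lambda>" "h \<in> H" "k \<in> H"
  shows "\<alpha> (h + k) = \<alpha> h + \<alpha> k" "\<alpha> (c *s h) = c * \<alpha> h" "\<alpha> (br h k) = 0"
  using weight_linear[OF subspace_wspace br_wspace subset_refl _ assms(2,3)] assms(1)
  by (auto simp: \<Lambda>_def)

lemma lower_central_subset_H: "lower_central H n \<subseteq> H"
proof (induction n)
  case (Suc n)
  then have "{br x y |x y. x \<in> H \<and> y \<in> lower_central H n} \<subseteq> H" using br_H by blast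
  then show ?case unfolding lower_central.simps by (rule span_minimal[OF _ subspace_H])
qed simp

text \<open>A variant of Engel's theorem: a minimal \<open>H\<close>-stable subspace \<open>U\<close> strictly above \<open>W0\<close> is
  shown to be killed modulo \<open>W0\<close>, by descending induction along the lower central series of \<open>H\<close>.\<close>

lemma engel:
  assumes V: "subspace V" "\<And>h x. h \<in> H \<Longrightarrow> x \<in> V \<Longrightarrow> br h x \<in> V" "V \<subseteq> wspace \<alpha>"
    and W0: "subspace W0" "\<And>h x. h \<in> H \<Longrightarrow> x \<in> W0 \<Longrightarrow> br h x \<in> W0" "W0 \<subset> V"
  shows "\<exists>v \<in> V - W0. \<forall>h\<in>H. br h v - \<alpha> h *s v \<in> W0"
proof -
  let ?P = "\<lambda>U. subspace U \<and> (\<forall>h\<in>H. \<forall>x\<in>U. br h x \<in> U) \<and> W0 \<subset> U \<and> U \<subseteq> V"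
  have "?P V" using V W0 by blast
  then obtain U where U: "?P U" and min: "\<And>U'. ?P U' \<Longrightarrow> dim U \<le> dim U'"
    using ex_has_least_nat[of ?P V dim] by blast
  have "V \<noteq> {0}" using W0 subspace_0 by blast
  then have lam0: "\<alpha> 0 = 0" and lam: "\<And>h k. h \<in> H \<Longrightarrow> k \<in> H \<Longrightarrow> \<alpha> (br h k) = 0"
    using weight_linear(2)[of V \<alpha> 0 0 0] weight_linear(3)[of V \<alpha>] V subspace_0[OF subspace_H] by auto
  have kill: "\<forall>h\<in>lower_central H k. \<forall>u\<in>U. br h u - \<alpha> h *s u \<in> W0"
    if IH: "\<forall>h\<in>lower_central H (Suc k). \<forall>u\<in>U. br h u - \<alpha> h *s u \<in> W0" for k
  proof (intro ballI)
    fix h u assume h: "h \<in> lower_central H k" and u: "u \<in> U"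
    then have hH: "h \<in> H" using lower_central_subset_H by blast
    let ?T = "\<lambda>x. br h x - \<alpha> h *s x"
    have T: "lin ?T" by (intro lin_diff_scale lin_br)
    have TW: "?T x \<in> W0" if "x \<in> W0" for x
      using that W0 hH by (simp add: subspace_diff subspace_scale)
    have TU: "?T x \<in> U" if "x \<in> U" for x
      using that U hH by (simp add: subspace_diff subspace_scale)
    let ?K = "{x\<in>U. ?T x \<in> W0}"
    have "subspace ?K"
      using U W0(1) lin_add[OF T] lin_scale[OF T] lin_zero[OF T]
      by (intro subspaceI) (auto simp: subspace_0 subspace_add subspace_scale)
    moreover have "br h' x \<in> ?K" if h': "h' \<in> H" and x: "x \<in> ?K" for h' x
    proof -
      \<comment> \<open>The bracket lies one term deeper in the lower central series, so by
        induction it acts on \<open>U\<close> modulo \<open>W0\<close> as the scalar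
        \<open>\<alpha> (br h h')\<close>, which is 0.\<close>
      have "br h h' \<in> lower_central H (Suc k)"
      proof -
        have "br h' h \<in> lower_central H (Suc k)" using h h' by (auto intro!: span_base)
        then have "- br h' h \<in> lower_central H (Suc k)" by (simp add: span_neg)
        then show ?thesis by (simp add: br_anti[of h h'])
      qed
      then have "br (br h h') x - \<alpha> (br h h') *s x \<in> W0" using IH x by blast
      then have "br (br h h') x \<in> W0" using lam[OF hH h'] by simp
      moreover have "br h' (?T x) \<in> W0" using W0(2) h' x by blast
      moreover have "?T (br h' x) = br h' (?T x) + br (br h h') x"
        by (simp add: br_derivation[of h h' x] br_diff_right br_scale_right)
      ultimately show ?thesis using U h' x subspace_add[OF W0(1)] by auto
    qed
    \<comment> \<open>\<open>?T\<close> is nilpotent on \<open>U\<close>; the last of its powers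
      that keeps \<open>v\<close> outside \<open>W0\<close> provides an element of \<open>?K\<close>
      outside \<open>W0\<close>.\<close>
    moreover have "W0 \<subset> ?K"
    proof -
      obtain v where v: "v \<in> U" "v \<notin> W0" using U by blast
      then have "v \<in> geneig (br h) (\<alpha> h)" using U V(3) hH by (auto simp: wspace_def)
      then obtain n where "(?T ^^ n) v = 0" by (auto simp: geneig_def)
      then have "\<exists>n. (?T ^^ n) v \<in> W0" using subspace_0[OF W0(1)] by metis
      then obtain m where m: "(?T ^^ m) v \<in> W0" "\<And>k. k < m \<Longrightarrow> (?T ^^ k) v \<notin> W0"
        using exists_least_iff[of "\<lambda>n. (?T ^^ n) v \<in> W0"] by blast
      have "m \<noteq> 0" using m(1) v by (metis funpow_0)
      then obtain j where j: "m = Suc j" by (cases m) auto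
      have "(?T ^^ i) v \<in> U" for i using v TU by (induction i) auto
      then have "(?T ^^ j) v \<in> ?K" "(?T ^^ j) v \<notin> W0" using m j by auto
      moreover have "W0 \<subseteq> ?K" using U TW by blast
      ultimately show ?thesis by blast
    qed
    ultimately have "?P ?K" using U by blast
    then have "dim U \<le> dim ?K" by (rule min)
    then have "?K = U" using U \<open>subspace ?K\<close> by (intro subspace_dim_equal) auto
    with u show "?T u \<in> W0" by blast
  qed
  obtain n where n: "lower_central H n = {0}" using nilpotent_H by blast
  have "\<forall>h\<in>lower_central H (n - k). \<forall>u\<in>U. br h u - \<alpha> h *s u \<in> W0" if "k \<le> n" for k
    using that
  proof (induction k)
    case 0
    show ?case using lam0 n subspace_0[OF W0(1)] by simp
  next
    case (Suc k)
    then have "Suc (n - Suc k) = n - k" by simp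
    with Suc.IH Suc.prems have "\<forall>h\<in>lower_central H (Suc (n - Suc k)). \<forall>u\<in>U. br h u - \<alpha> h *s u \<in> W0"
      by (simp only:) simp
    then show ?case by (rule kill)
  qed
  from this[of n] have "\<forall>h\<in>H. \<forall>u\<in>U. br h u - \<alpha> h *s u \<in> W0" by simp
  with U show ?thesis by blast
qed

text \<open>If \<open>wspace 0\<close> were larger than \<open>H\<close>, the Engel argument
  relative to \<open>H\<close> would give a vector outside \<open>H\<close> that normalizes
  \<open>H\<close>.\<close>

lemma wspace_0: "wspace 0 = H"
proof (rule ccontr)
  assume "wspace 0 \<noteq> H"
  then have "H \<subset> wspace 0" using H_subset_wspace_0 by blast
  from engel[OF subspace_wspace br_wspace subset_refl subspace_H br_H this]
  obtain v where "v \<in> wspace 0 - H" "\<forall>h\<in>H. br h v - 0 h *s v \<in> H" by blast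
  then have v: "v \<notin> H" "\<forall>h\<in>H. br h v \<in> H" by simp_all
  have "br v h \<in> H" if "h \<in> H" for h
    using v(2) that br_anti[of v h] subspace_neg[OF subspace_H] by auto
  with v(1) normalizer_H show False by blast
qed

text \<open>The left side is the trace of \<open>br (br x y)\<close> on the sum of the weight spaces
  in \<open>C\<close>, which \<open>x\<close> and \<open>y\<close> preserve. Later \<open>C\<close>
  is a full string of weights, an unbroken segment of one, or an upward half-string.\<close>

lemma sum_weights:
  assumes "C \<subseteq> \<Lambda>" and xy: "br x y \<in> H"
    and x: "\<And>\<gamma> z. \<gamma> \<in> C \<Longrightarrow> z \<in> wspace \<gamma> \<Longrightarrow> br x z \<in> span (\<Union>\<alpha>\<in>C. wspace \<alpha>)"
    and y: "\<And>\<gamma> z. \<gamma> \<in> C \<Longrightarrow> z \<in> wspace \<gamma> \<Longrightarrow> br y z \<in> span (\<Union>\<alpha>\<in>C. wspace \<alpha>)"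
  shows "(\<Sum>\<gamma>\<in>C. of_nat (dim (wspace \<gamma>)) * \<gamma> (br x y)) = 0"
proof -
  let ?M = "span (\<Union>\<alpha>\<in>C. wspace \<alpha>)"
  have "br x z \<in> ?M" if "z \<in> ?M" for z
    by (rule lin_span_subset[OF lin_br _ subspace_span that]) (use x in blast)
  moreover have "br y z \<in> ?M" if "z \<in> ?M" for z
    by (rule lin_span_subset[OF lin_br _ subspace_span that]) (use y in blast)
  ultimately have "trace ?M (br (br x y)) = 0" by (intro trace_bracket) auto
  moreover have "trace ?M (br (br x y)) = (\<Sum>\<gamma>\<in>C. trace (wspace \<gamma>) (br (br x y)))"
    using assms(1) xy by (intro trace_span_wspace lin_br) (auto simp: br_wspace)
  ultimately show ?thesis using xy by (simp add: trace_wspace)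
qed

section \<open>The Killing form\<close>

definition killing :: "'g \<Rightarrow> 'g \<Rightarrow> 'k" where
  "killing x y = trace UNIV (\<lambda>z. br x (br y z))"

lemma lin_br_br: "lin (\<lambda>z. br x (br y z))"
  by (rule lin_comp) (rule lin_br)+

lemma killing_sym: "killing x y = killing y x"
  unfolding killing_def by (rule trace_swap) (auto intro: lin_br)

lemma killing_add_left: "killing (x + y) z = killing x z + killing y z"
  unfolding killing_def br_add_left by (rule trace_add) auto

lemma killing_scale_left: "killing (c *s x) z = c * killing x z"
  unfolding killing_def br_scale_left by (rule trace_scale) auto

lemma killing_add_right: "killing x (y + z) = killing x y + killing x z"
  using killing_add_left[of y z x] by (simp add: killing_sym)

lemma killing_scale_right: "killing x (c *s y) = c * killing x y"
  using killing_scale_left[of c y x] by (simp add: killing_sym)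

lemma killing_minus_left: "killing (- x) y = - killing x y"
  using killing_scale_left[of "-1" x y] by simp

lemma killing_minus_right: "killing x (- y) = - killing x y"
  using killing_scale_right[of x "-1" y] by simp

lemma killing_0_left [simp]: "killing 0 y = 0"
  and killing_0_right [simp]: "killing x 0 = 0"
  using killing_scale_left[of 0 0 y] killing_scale_right[of x 0 0] by simp_all

lemma killing_diff_left: "killing (x - y) z = killing x z - killing y z"
  using killing_add_left[of x "- y" z] by (simp add: killing_minus_left)

lemma killing_diff_right: "killing x (y - z) = killing x y - killing x z"
  using killing_add_right[of x y "- z"] by (simp add: killing_minus_right)

lemma killing_invariant: "killing (br x y) z = killing x (br y z)"
proof -
  have "killing (br x y) z = trace UNIV (\<lambda>u. br x (br y (br z u))) - trace UNIV (\<lambda>u. br y (br x (br z u)))"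
    unfolding killing_def br_br by (rule trace_diff) auto
  also have "trace UNIV (\<lambda>u. br y (br x (br z u))) = trace UNIV (\<lambda>u. br x (br z (br y u)))"
    using trace_swap[OF subspace_UNIV subspace_UNIV lin_br_br[of x z] lin_br[of y]] by simp
  also have "trace UNIV (\<lambda>u. br x (br y (br z u))) - trace UNIV (\<lambda>u. br x (br z (br y u)))
      = killing x (br y z)"
    unfolding killing_def br_br br_diff_right by (rule trace_diff[symmetric]) auto
  finally show ?thesis .
qed

lemma geneig_commute:
  assumes "lin f" "lin g" "\<And>x. f (g x) = g (f x)" "x \<in> geneig g c"
  shows "f x \<in> geneig g c"
  using assms(2,4)
proof (induction rule: geneig_induct)
  case zero
  show ?case using subspace_geneig[OF assms(2)] by (simp add: lin_zero[OF assms(1)] subspace_0)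
next
  case (step x)
  then have "g (f x) - c *s f x \<in> geneig g c"
    by (simp add: lin_diff[OF assms(1)] lin_scale[OF assms(1)] assms(3))
  then show ?case by (rule geneig_shiftI)
qed

text \<open>Rests on the factorization of \<open>f^2 - c^2\<close> as
  \<open>(f + c) (f - c)\<close>.\<close>

lemma geneig_square:
  assumes f: "lin f" and "x \<in> geneig f c"
  shows "x \<in> geneig (\<lambda>x. f (f x)) (c ^ 2)"
  using assms
proof (induction rule: geneig_induct)
  case zero
  show ?case using subspace_geneig[OF lin_comp[OF f f]] by (simp add: subspace_0)
next
  case (step x)
  let ?y = "f x - c *s x" and ?G = "geneig (\<lambda>x. f (f x)) (c ^ 2)"
  have ff: "lin (\<lambda>x. f (f x))" using f f by (rule lin_comp)
  have "f ?y \<in> ?G" using geneig_commute[OF f ff _ step.IH] by simp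
  then have "f ?y + c *s ?y \<in> ?G"
    using step.IH subspace_geneig[OF ff] by (metis subspace_add subspace_scale)
  also have "f ?y + c *s ?y = f (f x) - c ^ 2 *s x"
    by (simp add: lin_diff[OF f] lin_scale[OF f] algebra_simps power2_eq_square)
  finally show ?case by (rule geneig_shiftI)
qed

lemma killing_H_square:
  assumes "h \<in> H"
  shows "killing h h = (\<Sum>\<gamma>\<in>\<Lambda>. of_nat (dim (wspace \<gamma>)) * (\<gamma> h) ^ 2)"
proof -
  have "killing h h = (\<Sum>\<gamma>\<in>\<Lambda>. trace (wspace \<gamma>) (\<lambda>z. br h (br h z)))"
    unfolding killing_def using assms by (intro trace_UNIV_wspace lin_br_br) (simp add: br_wspace)
  also have "\<dots> = (\<Sum>\<gamma>\<in>\<Lambda>. of_nat (dim (wspace \<gamma>)) * (\<gamma> h) ^ 2)"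
    using assms by (intro sum.cong refl trace_geneig lin_br_br subspace_wspace)
      (auto simp: br_wspace intro!: geneig_square lin_br dest: gwD)
  finally show ?thesis .
qed

text \<open>Polarization of \<open>killing_H_square\<close>, using additivity of the
  weights.\<close>

lemma killing_H:
  assumes "h \<in> H" "k \<in> H"
  shows "killing h k = (\<Sum>\<gamma>\<in>\<Lambda>. of_nat (dim (wspace \<gamma>)) * \<gamma> h * \<gamma> k)"
proof -
  have "h + k \<in> H" using assms subspace_H by (simp add: subspace_add)
  then have "killing (h + k) (h + k) = (\<Sum>\<gamma>\<in>\<Lambda>. of_nat (dim (wspace \<gamma>)) * (\<gamma> h + \<gamma> k) ^ 2)"
    using assms by (simp add: killing_H_square \<Lambda>_linear)
  also have "\<dots> = (\<Sum>\<gamma>\<in>\<Lambda>. of_nat (dim (wspace \<gamma>)) * (\<gamma> h) ^ 2) + (\<Sum>\<gamma>\<in>\<Lambda>. of_nat (dim (wspace \<gamma>)) * (\<gamma> k) ^ 2)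
      + 2 * (\<Sum>\<gamma>\<in>\<Lambda>. of_nat (dim (wspace \<gamma>)) * \<gamma> h * \<gamma> k)"
    unfolding sum_distrib_left sum.distrib[symmetric]
    by (intro sum.cong refl) (simp add: power2_eq_square algebra_simps)
  finally have "killing (h + k) (h + k) = killing h h + killing k k
      + 2 * (\<Sum>\<gamma>\<in>\<Lambda>. of_nat (dim (wspace \<gamma>)) * \<gamma> h * \<gamma> k)"
    using assms by (simp only: killing_H_square)
  moreover have "killing (h + k) (h + k) = killing h h + killing k k + 2 * killing h k"
    using killing_sym[of h k] by (simp add: killing_add_left killing_add_right)
  ultimately show ?thesis by simp
qed

section \<open>Cartan's criterion and nondegeneracy of the Killing form\<close>

lemma perfect: "span {br x y |x y. True} = UNIV"
proof -
  let ?I = "span {br x y |x y. True}"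
  have "lie_ideal ?I" unfolding lie_ideal_def by (auto intro: span_base)
  moreover have "?I \<noteq> {0}"
  proof -
    obtain x y where "br x y \<noteq> 0" using simple by (auto simp: simple_def)
    moreover have "br x y \<in> ?I" by (auto intro: span_base)
    ultimately show ?thesis by blast
  qed
  ultimately show ?thesis using simple by (auto simp: simple_def)
qed

lemma wspace_in_span:
  assumes "x \<in> wspace \<gamma>" "\<gamma> \<in> H_supported" "\<gamma> \<in> \<Lambda> \<Longrightarrow> \<gamma> \<in> C"
  shows "x \<in> span (\<Union>\<alpha>\<in>C. wspace \<alpha>)"
proof (cases "x = 0")
  case False
  with assms have "\<gamma> \<in> C" by (auto simp: \<Lambda>_def)
  with assms(1) show ?thesis by (blast intro: span_base)
qed (simp add: span_zero)

lemma \<Lambda>_outside: "\<alpha> \<in> \<Lambda> \<Longrightarrow> x \<notin> H \<Longrightarrow> \<alpha> x = 0"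
  using \<Lambda>_W by blast

lemma wspace_br_minus: "x \<in> wspace \<alpha> \<Longrightarrow> y \<in> wspace (- \<alpha>) \<Longrightarrow> br x y \<in> H"
  using wspace_br[of x \<alpha> y "- \<alpha>"] by (simp add: wspace_0)

text \<open>The algebra is spanned by brackets of weight vectors. Those of opposite weights lie in
  \<open>H\<close>, the others in nonzero weight spaces, and independence of weight spaces discards
  the latter for an element of \<open>H\<close>.\<close>

lemma H_span_brackets: "H \<subseteq> span (\<Union>\<alpha>\<in>\<Lambda>. {br x y |x y. x \<in> wspace \<alpha> \<and> y \<in> wspace (- \<alpha>)})"
proof
  let ?A = "\<Union>\<alpha>\<in>\<Lambda>. {br x y |x y. x \<in> wspace \<alpha> \<and> y \<in> wspace (- \<alpha>)}"
  let ?B = "\<Union>\<alpha>\<in>\<Lambda> - {0}. wspace \<alpha>"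
  have 1: "br x y \<in> span (?A \<union> ?B)" if x: "\<alpha> \<in> \<Lambda>" "x \<in> wspace \<alpha>" and y: "\<beta> \<in> \<Lambda>" "y \<in> wspace \<beta>" for x y \<alpha> \<beta>
  proof (cases "\<alpha> + \<beta> = 0")
    case True
    then have "\<beta> = - \<alpha>" by (simp add: eq_neg_iff_add_eq_0 add.commute)
    with x y show ?thesis by (intro span_base) blast
  next
    case False
    then have "br x y \<in> span ?B"
      using wspace_br[OF x(2) y(2)] x(1) y(1) by (intro wspace_in_span[of _ "\<alpha> + \<beta>"]) (auto simp: \<Lambda>_outside)
    then show ?thesis using span_mono[of ?B "?A \<union> ?B"] by blast
  qed
  have 2: "br x y \<in> span (?A \<union> ?B)" if x: "\<alpha> \<in> \<Lambda>" "x \<in> wspace \<alpha>" for x y \<alpha>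
    by (rule lin_span_subset[OF lin_br[of x] _ subspace_span, of "\<Union>\<alpha>\<in>\<Lambda>. wspace \<alpha>"])
      (use 1[OF x] in \<open>auto simp: span_wspace\<close>)
  have "br x y \<in> span (?A \<union> ?B)" for x y
    by (rule lin_span_subset[OF lin_br_left[of y] _ subspace_span, of "\<Union>\<alpha>\<in>\<Lambda>. wspace \<alpha>"])
      (use 2 in \<open>auto simp: span_wspace\<close>)
  then have "span {br x y |x y. True} \<subseteq> span (?A \<union> ?B)" by (intro span_minimal) auto
  then have UN: "x \<in> span (?A \<union> ?B)" for x using perfect by blast
  have A: "span ?A \<subseteq> H" using wspace_br_minus by (intro span_minimal subspace_H) blast
  fix h assume h: "h \<in> H"
  obtain a b where ab: "h = a + b" "a \<in> span ?A" "b \<in> span ?B" using UN[of h] unfolding span_Un by blast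
  then have "b = h - a" by simp
  then have "b \<in> wspace 0" using A ab(2) h subspace_H by (auto simp: wspace_0 subspace_diff)
  then have "b = 0"
    using ab(3) finite_\<Lambda> \<Lambda>_W by (intro wspace_independent[of "\<Lambda> - {0}" 0 b]) auto
  with ab show "h \<in> span ?A" by simp
qed

lemma dim_wspace_pos: "\<alpha> \<in> \<Lambda> \<Longrightarrow> dim (wspace \<alpha>) > 0"
  using subspace_0[OF subspace_wspace] by (auto simp: \<Lambda>_def intro!: gr0I)

abbreviation shift :: "('g \<Rightarrow> 'k) \<Rightarrow> int \<Rightarrow> ('g \<Rightarrow> 'k) \<Rightarrow> 'g \<Rightarrow> 'k" where
  "shift \<beta> k \<alpha> \<equiv> \<beta> + scale_fun (of_int k) \<alpha>"

lemma shift_eqs: "shift \<beta> 0 \<alpha> = \<beta>" "\<alpha> + shift \<beta> k \<alpha> = shift \<beta> (k + 1) \<alpha>"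
    "- \<alpha> + shift \<beta> k \<alpha> = shift \<beta> (k - 1) \<alpha>"
  by (auto simp: fun_eq_iff algebra_simps)

text \<open>Zero trace on the whole \<alpha>-string through \<open>\<beta>\<close> reads
  \<open>N * \<beta> ?h + K * \<alpha> ?h = 0\<close> with integers \<open>N\<close> and
  \<open>K\<close>; \<open>N\<close> is a sum of dimensions that includes the one of
  \<open>\<beta>\<close>, hence positive.\<close>

lemma string_proportional:
  assumes \<alpha>: "\<alpha> \<in> \<Lambda>" and x: "x \<in> wspace \<alpha>" and y: "y \<in> wspace (- \<alpha>)" and \<beta>: "\<beta> \<in> \<Lambda>"
  shows "\<exists>r :: rat. \<beta> (br x y) = of_rat r * \<alpha> (br x y)"
proof -
  let ?C = "{\<gamma>\<in>\<Lambda>. \<exists>k. \<gamma> = shift \<beta> k \<alpha>}" and ?h = "br x y"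
  have fin: "finite ?C" using finite_\<Lambda> by simp
  have "\<forall>\<gamma>\<in>?C. \<exists>k. \<gamma> = shift \<beta> k \<alpha>" by blast
  then obtain k where k: "\<And>\<gamma>. \<gamma> \<in> ?C \<Longrightarrow> \<gamma> = shift \<beta> (k \<gamma>) \<alpha>" unfolding bchoice_iff by blast
  have W: "shift \<beta> k \<alpha> \<in> H_supported" for k using \<alpha> \<beta> by (auto simp: \<Lambda>_outside)
  have "(\<Sum>\<gamma>\<in>?C. of_nat (dim (wspace \<gamma>)) * \<gamma> ?h) = 0"
  proof (rule sum_weights)
    show "br x y \<in> H" using x y by (rule wspace_br_minus)
    show "br x z \<in> span (\<Union>\<gamma>\<in>?C. wspace \<gamma>)" if "\<gamma> \<in> ?C" "z \<in> wspace \<gamma>" for \<gamma> z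
    proof -
      from that(1) obtain k where "\<gamma> = shift \<beta> k \<alpha>" by blast
      then have "br x z \<in> wspace (shift \<beta> (k + 1) \<alpha>)" using wspace_br[OF x that(2)] shift_eqs(2) by metis
      then show ?thesis by (rule wspace_in_span[OF _ W]) blast
    qed
    show "br y z \<in> span (\<Union>\<gamma>\<in>?C. wspace \<gamma>)" if "\<gamma> \<in> ?C" "z \<in> wspace \<gamma>" for \<gamma> z
    proof -
      from that(1) obtain k where "\<gamma> = shift \<beta> k \<alpha>" by blast
      then have "br y z \<in> wspace (shift \<beta> (k - 1) \<alpha>)" using wspace_br[OF y that(2)] shift_eqs(3) by metis
      then show ?thesis by (rule wspace_in_span[OF _ W]) blast
    qed
  qed auto
  also have "(\<Sum>\<gamma>\<in>?C. of_nat (dim (wspace \<gamma>)) * \<gamma> ?h)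
      = (\<Sum>\<gamma>\<in>?C. of_nat (dim (wspace \<gamma>)) * \<beta> ?h + of_nat (dim (wspace \<gamma>)) * of_int (k \<gamma>) * \<alpha> ?h)"
  proof (rule sum.cong)
    fix \<gamma> assume "\<gamma> \<in> ?C"
    from fun_cong[OF k[OF this], of ?h] have "\<gamma> ?h = \<beta> ?h + of_int (k \<gamma>) * \<alpha> ?h"
      by (simp only: plus_fun_apply)
    then show "of_nat (dim (wspace \<gamma>)) * \<gamma> ?h
        = of_nat (dim (wspace \<gamma>)) * \<beta> ?h + of_nat (dim (wspace \<gamma>)) * of_int (k \<gamma>) * \<alpha> ?h"
      by (simp add: algebra_simps)
  qed simp
  also have "\<dots> = of_nat (\<Sum>\<gamma>\<in>?C. dim (wspace \<gamma>)) * \<beta> ?h + of_int (\<Sum>\<gamma>\<in>?C. int (dim (wspace \<gamma>)) * k \<gamma>) * \<alpha> ?h"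
    by (simp add: sum.distrib sum_distrib_right)
  finally have eq: "of_nat (\<Sum>\<gamma>\<in>?C. dim (wspace \<gamma>)) * \<beta> ?h + of_int (\<Sum>\<gamma>\<in>?C. int (dim (wspace \<gamma>)) * k \<gamma>) * \<alpha> ?h = 0"
    (is "of_nat ?N * _ + of_int ?K * _ = 0") .
  have "\<beta> \<in> ?C" using \<beta> shift_eqs(1)[of \<beta> \<alpha>, symmetric] by blast
  then have "?N \<ge> dim (wspace \<beta>)" using fin by (intro member_le_sum) auto
  then have N: "?N > 0" using dim_wspace_pos[OF \<beta>] by linarith
  have "\<beta> ?h = of_rat (- of_int ?K / of_nat ?N) * \<alpha> ?h"
    using eq N by (simp add: of_rat_divide of_rat_minus field_simps eq_neg_iff_add_eq_0 del: of_nat_sum of_int_sum)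
  then show ?thesis by blast
qed

lemma lie_ideal_radical: "lie_ideal {x. \<forall>y. killing x y = 0}"
  unfolding lie_ideal_def
proof (intro conjI allI ballI)
  show "subspace {x. \<forall>y. killing x y = 0}"
    by (rule subspaceI) (auto simp: killing_add_left killing_scale_left)
  show "br x y \<in> {x. \<forall>y. killing x y = 0}" if "y \<in> {x. \<forall>y. killing x y = 0}" for x y
    using that br_anti[of x y] by (auto simp: killing_invariant killing_minus_left)
qed

text \<open>Cartan's criterion, with the vanishing of the Killing form forcing all weights to vanish on
  the brackets that span \<open>H\<close>.\<close>

lemma killing_nonzero: "\<exists>x y. killing x y \<noteq> 0"
proof (rule ccontr)
  assume "\<not> ?thesis"
  then have 0: "killing x y = 0" for x y by blast
  have br0: "\<beta> (br x y) = 0" if \<alpha>: "\<alpha> \<in> \<Lambda>" and x: "x \<in> wspace \<alpha>" and y: "y \<in> wspace (- \<alpha>)" and \<beta>: "\<beta> \<in> \<Lambda>" for \<alpha> \<beta> x y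
  proof -
    let ?h = "br x y"
    have h: "?h \<in> H" using x y by (rule wspace_br_minus)
    have "\<forall>\<beta>\<in>\<Lambda>. \<exists>r :: rat. \<beta> ?h = of_rat r * \<alpha> ?h" using string_proportional[OF \<alpha> x y] by blast
    then obtain r :: "_ \<Rightarrow> rat" where r: "\<And>\<beta>. \<beta> \<in> \<Lambda> \<Longrightarrow> \<beta> ?h = of_rat (r \<beta>) * \<alpha> ?h" by metis
    have "\<alpha> ?h = 0"
    proof (rule ccontr)
      assume nz: "\<alpha> ?h \<noteq> 0"
      \<comment> \<open>A sum of squares may vanish in the ground field. Writing each weight as a
        rational multiple of \<open>\<alpha> ?h\<close> moves the sum to \<open>rat\<close>, where
        it forces \<open>r \<alpha> = 0\<close> and so \<open>\<alpha> ?h = 0\<close>.\<close>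
      have "0 = (\<Sum>\<gamma>\<in>\<Lambda>. of_nat (dim (wspace \<gamma>)) * (\<gamma> ?h) ^ 2)" using 0 killing_H_square[OF h] by simp
      also have "\<dots> = (\<Sum>\<gamma>\<in>\<Lambda>. of_nat (dim (wspace \<gamma>)) * (of_rat (r \<gamma>) * \<alpha> ?h) ^ 2)"
        using r by (intro sum.cong) auto
      also have "\<dots> = of_rat (\<Sum>\<gamma>\<in>\<Lambda>. of_nat (dim (wspace \<gamma>)) * (r \<gamma>) ^ 2) * (\<alpha> ?h) ^ 2"
        by (simp add: of_rat_sum of_rat_mult of_rat_power sum_distrib_right power_mult_distrib mult.assoc)
      finally have "of_rat (\<Sum>\<gamma>\<in>\<Lambda>. of_nat (dim (wspace \<gamma>)) * (r \<gamma>) ^ 2) = (0 :: 'k)" using nz by simp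
      then have "(\<Sum>\<gamma>\<in>\<Lambda>. of_nat (dim (wspace \<gamma>)) * (r \<gamma>) ^ 2) = 0" by simp
      then have "of_nat (dim (wspace \<alpha>)) * (r \<alpha>) ^ 2 = 0"
        using \<alpha> finite_\<Lambda> by (subst (asm) sum_nonneg_eq_0_iff) auto
      moreover have "of_nat (dim (wspace \<alpha>)) \<noteq> (0 :: rat)" using dim_wspace_pos[OF \<alpha>] by (simp del: dim_eq_0)
      ultimately have "r \<alpha> = 0" by (metis mult_eq_0_iff power_eq_0_iff)
      with r[OF \<alpha>] nz show False by simp
    qed
    with r[OF \<beta>] show ?thesis by simp
  qed
  have "\<beta> = 0" if \<beta>: "\<beta> \<in> \<Lambda>" for \<beta>
  proof -
    let ?K = "{h\<in>H. \<beta> h = 0}"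
    have b0: "\<beta> 0 = 0" using \<Lambda>_linear(2)[OF \<beta>, of 0 0 0] subspace_0[OF subspace_H] by simp
    have "subspace ?K"
      using \<Lambda>_linear(1,2)[OF \<beta>] subspace_H b0
      by (intro subspaceI) (auto simp: subspace_0 subspace_add subspace_scale)
    then have "span (\<Union>\<alpha>\<in>\<Lambda>. {br x y |x y. x \<in> wspace \<alpha> \<and> y \<in> wspace (- \<alpha>)}) \<subseteq> ?K"
      using br0[OF _ _ _ \<beta>] wspace_br_minus by (intro span_minimal) auto
    then have "\<beta> h = 0" if "h \<in> H" for h using H_span_brackets that by blast
    moreover have "\<beta> h = 0" if "h \<notin> H" for h using \<beta> \<Lambda>_W that by auto
    ultimately show ?thesis by (auto simp: fun_eq_iff)
  qed
  \<comment> \<open>With 0 as the only weight the whole algebra is \<open>H\<close>, and an algebra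
    that is both nilpotent and perfect is zero.\<close>
  then have "(\<Union>\<alpha>\<in>\<Lambda>. wspace \<alpha>) \<subseteq> H" using wspace_0 by auto
  then have "span (\<Union>\<alpha>\<in>\<Lambda>. wspace \<alpha>) \<subseteq> H" by (intro span_minimal subspace_H)
  then have H: "H = UNIV" using span_wspace by auto
  have "lower_central H n = UNIV" for n
    by (induction n) (use perfect H in auto)
  then have "(UNIV :: 'g set) = {0}" using nilpotent_H by metis
  then have "killing x y = 0 \<and> br x y = 0" for x y by (metis UNIV_I singletonD 0)
  then show False using simple by (auto simp: simple_def)
qed

lemma killing_nondegenerate:
  assumes "\<And>y. killing x y = 0" shows "x = 0"
proof -
  have "{x. \<forall>y. killing x y = 0} \<noteq> UNIV" using killing_nonzero by blast
  then have "{x. \<forall>y. killing x y = 0} = {0}" using lie_ideal_radical simple by (auto simp: simple_def)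
  with assms show ?thesis by blast
qed

lemma killing_br_swap: "killing (br h x) y = - killing x (br h y)"
  using killing_invariant[of x h y] br_anti[of h x] by (simp add: killing_minus_left)

text \<open>For eigenvectors invariance gives
  \<open>(\<alpha> h + \<beta> h) * killing x y = 0\<close>; the nested induction carries this over
  to generalized eigenvectors.\<close>

lemma killing_orthogonal:
  assumes x: "x \<in> wspace \<alpha>" and y: "y \<in> wspace \<beta>" and W: "\<alpha> \<in> H_supported" "\<beta> \<in> H_supported" and "\<alpha> + \<beta> \<noteq> 0"
  shows "killing x y = 0"
proof -
  obtain h where h: "\<alpha> h + \<beta> h \<noteq> 0" using assms(5) by (auto simp: fun_eq_iff)
  then have "h \<in> H" using W by force
  then have x: "x \<in> geneig (br h) (\<alpha> h)" and y: "y \<in> geneig (br h) (\<beta> h)" using x y gwD by auto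
  have "\<forall>y\<in>geneig (br h) (\<beta> h). killing x y = 0"
    using lin_br x
  proof (induction rule: geneig_induct)
    case (step x)
    show ?case
    proof
      fix y assume "y \<in> geneig (br h) (\<beta> h)"
      with lin_br show "killing x y = 0"
      proof (induction rule: geneig_induct)
        case step': (step y)
        have "killing (br h x - \<alpha> h *s x) y = 0" using step.IH step'(1) by blast
        then have "- killing x (br h y) - \<alpha> h * killing x y = 0"
          by (simp add: killing_diff_left killing_scale_left killing_br_swap)
        moreover have "killing x (br h y) = \<beta> h * killing x y"
          using step'.IH by (simp add: killing_diff_right killing_scale_right)
        ultimately have "(\<alpha> h + \<beta> h) * killing x y = 0" by algebra
        with h show ?case by simp
      qed simp
    qed
  qed simp
  with y show ?thesis by blast
qed

text \<open>Nondegeneracy supplies a partner of \<open>x\<close>, and orthogonality leaves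
  \<open>- \<alpha>\<close> as the only weight it can have.\<close>

lemma killing_dual:
  assumes "x \<in> wspace \<alpha>" "\<alpha> \<in> H_supported" "x \<noteq> 0"
  shows "\<exists>y\<in>wspace (- \<alpha>). killing x y \<noteq> 0"
proof (rule ccontr)
  assume "\<not> ?thesis"
  then have no: "killing x y = 0" if "y \<in> wspace (- \<alpha>)" for y using that by blast
  have "killing x y = 0" if "\<beta> \<in> \<Lambda>" "y \<in> wspace \<beta>" for y \<beta>
  proof (cases "\<beta> = - \<alpha>")
    case False
    then have "\<alpha> + \<beta> \<noteq> 0" by (simp add: eq_neg_iff_add_eq_0 add.commute)
    then show ?thesis using that \<Lambda>_W by (intro killing_orthogonal[OF assms(1) that(2) assms(2)]) auto
  qed (use no that in simp)
  then have "(\<Union>\<beta>\<in>\<Lambda>. wspace \<beta>) \<subseteq> {y. killing x y = 0}" by blast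
  moreover have "subspace {y. killing x y = 0}"
    by (rule subspaceI) (auto simp: killing_add_right killing_scale_right)
  ultimately have "span (\<Union>\<beta>\<in>\<Lambda>. wspace \<beta>) \<subseteq> {y. killing x y = 0}" by (rule span_minimal)
  then have "x = 0" using span_wspace by (intro killing_nondegenerate) auto
  with assms show False by simp
qed

lemma \<Lambda>_minus: "\<alpha> \<in> \<Lambda> \<Longrightarrow> - \<alpha> \<in> \<Lambda>"
proof -
  assume a: "\<alpha> \<in> \<Lambda>"
  then obtain x where "x \<in> wspace \<alpha>" "x \<noteq> 0" by (rule \<Lambda>_nonzeroE)
  then obtain y where "y \<in> wspace (- \<alpha>)" "killing x y \<noteq> 0" using killing_dual a \<Lambda>_W by blast
  then have "wspace (- \<alpha>) \<noteq> {0}" by auto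
  then show ?thesis using a by (auto simp: \<Lambda>_def)
qed

lemma H_eq_0:
  assumes h: "h \<in> H" and 0: "\<And>\<gamma>. \<gamma> \<in> \<Lambda> \<Longrightarrow> \<gamma> h = 0"
  shows "h = 0"
proof (rule ccontr)
  assume "h \<noteq> 0"
  then obtain k where k: "k \<in> H" "killing h k \<noteq> 0" using killing_dual[of h 0] h by (auto simp: wspace_0)
  have "killing h k = 0" unfolding killing_H[OF h k(1)] using 0 by (intro sum.neutral) simp
  with k(2) show False by simp
qed

lemma H_killing_eq_0:
  assumes h: "h \<in> H" and "\<And>k. k \<in> H \<Longrightarrow> killing h k = 0"
  shows "h = 0"
  using killing_dual[of h 0] assms by (auto simp: wspace_0)

text \<open>Every weight vanishes on brackets of elements of \<open>H\<close>, and by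
  \<open>H_eq_0\<close> the weights separate the points of \<open>H\<close>.\<close>

lemma H_abelian: "h \<in> H \<Longrightarrow> k \<in> H \<Longrightarrow> br h k = 0"
  by (rule H_eq_0) (auto simp: br_H \<Lambda>_linear)

lemma weight_vector:
  assumes "\<alpha> \<in> \<Lambda>"
  shows "\<exists>e\<in>wspace \<alpha>. e \<noteq> 0 \<and> (\<forall>h\<in>H. br h e = \<alpha> h *s e)"
proof -
  have "{0} \<subset> wspace \<alpha>" using assms subspace_0[OF subspace_wspace] by (auto simp: \<Lambda>_def)
  from engel[OF subspace_wspace br_wspace subset_refl subspace_single_0 _ this]
  show ?thesis by auto
qed

lemma killing_bracket_H:
  assumes "\<forall>h\<in>H. br h e = \<alpha> h *s e" "h \<in> H"
  shows "killing (br e y) h = \<alpha> h * killing e y"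
proof -
  have "killing (br e y) h = killing e (br y h)" by (rule killing_invariant)
  also have "\<dots> = - killing e (br h y)" using br_anti[of y h] by (simp add: killing_minus_right)
  also have "\<dots> = killing (br h e) y" by (simp add: killing_br_swap)
  finally show ?thesis using assms by (simp add: killing_scale_left)
qed

section \<open>Roots and the dimension of their root spaces\<close>

definition \<Phi> :: "('g \<Rightarrow> 'k) set" where
  "\<Phi> = \<Lambda> - {0}"

lemma \<Phi>_minus: "\<alpha> \<in> \<Phi> \<Longrightarrow> - \<alpha> \<in> \<Phi>"
  using \<Lambda>_minus by (auto simp: \<Phi>_def)

lemma \<Phi>_\<Lambda>: "\<alpha> \<in> \<Phi> \<Longrightarrow> \<alpha> \<in> \<Lambda>" "\<alpha> \<in> \<Phi> \<Longrightarrow> \<alpha> \<in> H_supported" "\<alpha> \<in> \<Phi> \<Longrightarrow> \<alpha> \<noteq> 0"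
  by (auto simp: \<Phi>_def \<Lambda>_def)

text \<open>Scaling \<open>y\<close> to \<open>killing e y = 1\<close> makes \<open>br e y\<close>
  represent \<open>\<alpha>\<close> under the Killing form. If \<open>\<alpha>\<close> vanished on
  it, so would every weight by \<open>string_proportional\<close>; then \<open>br e y\<close> would
  be 0 and with it \<open>\<alpha>\<close>.\<close>

lemma root_triple:
  assumes "\<alpha> \<in> \<Phi>"
  obtains e y where "e \<in> wspace \<alpha>" "y \<in> wspace (- \<alpha>)" "e \<noteq> 0" "\<forall>h\<in>H. br h e = \<alpha> h *s e"
    "br e y \<in> H" "\<forall>h\<in>H. killing (br e y) h = \<alpha> h" "\<alpha> (br e y) \<noteq> 0"
proof -
  note \<alpha> = \<Phi>_\<Lambda>[OF assms]
  obtain e where e: "e \<in> wspace \<alpha>" "e \<noteq> 0" "\<forall>h\<in>H. br h e = \<alpha> h *s e"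
    using weight_vector[OF \<alpha>(1)] by blast
  obtain z where z: "z \<in> wspace (- \<alpha>)" "killing e z \<noteq> 0" using killing_dual[OF e(1) \<alpha>(2) e(2)] by blast
  let ?y = "inverse (killing e z) *s z"
  let ?t = "br e ?y"
  have y: "?y \<in> wspace (- \<alpha>)" using z subspace_wspace by (simp add: subspace_scale)
  have t: "?t \<in> H" using e(1) y by (rule wspace_br_minus)
  have k: "\<forall>h\<in>H. killing ?t h = \<alpha> h"
    using killing_bracket_H[OF e(3)] z(2) by (simp add: killing_scale_right)
  have "\<alpha> ?t \<noteq> 0"
  proof
    assume 0: "\<alpha> ?t = 0"
    have "\<beta> ?t = 0" if "\<beta> \<in> \<Lambda>" for \<beta>
      using string_proportional[OF \<alpha>(1) e(1) y that] 0 by auto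
    then have "?t = 0" using t by (intro H_eq_0)
    then have "\<alpha> h = 0" if "h \<in> H" for h using k that by (metis killing_0_left)
    then have "\<alpha> = 0" using \<alpha>(2) by (auto simp: fun_eq_iff)
    with \<alpha>(3) show False by simp
  qed
  with e y t k that show ?thesis by blast
qed

text \<open>The trace of \<open>br e y\<close> vanishes on the stable subspace spanned by \<open>e\<close>, \<open>H\<close> and the
  root spaces of negative multiples of \<open>\<alpha>\<close>; this counts dimensions.\<close>

lemma root_space_neg:
  assumes "\<alpha> \<in> \<Phi>"
  shows "dim (wspace (- \<alpha>)) = 1" and "k \<ge> 2 \<Longrightarrow> scale_fun (of_int (- int k)) \<alpha> \<notin> \<Lambda>"
proof -
  note \<alpha> = \<Phi>_\<Lambda>[OF assms]
  obtain e y where e: "e \<in> wspace \<alpha>" "e \<noteq> 0" "\<forall>h\<in>H. br h e = \<alpha> h *s e" and y: "y \<in> wspace (- \<alpha>)"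
    and t: "br e y \<in> H" and at: "\<alpha> (br e y) \<noteq> 0" by (rule root_triple[OF assms])
  let ?t = "br e y"
  \<comment> \<open>The index \<open>k = 0\<close> stands for \<open>H\<close> itself. On the
    positive side only the line of \<open>e\<close> is taken, as \<open>wspace \<alpha>\<close> is
    not yet known to be one-dimensional.\<close>
  let ?m = "\<lambda>k :: nat. scale_fun (of_int (- int k)) \<alpha>"
  let ?C = "{\<gamma>\<in>\<Lambda>. \<exists>k. \<gamma> = ?m k}"
  let ?S = "span (\<Union>\<gamma>\<in>?C. wspace \<gamma>)"
  let ?M = "span (span {e} \<union> ?S)"
  have fin: "finite ?C" using finite_\<Lambda> by simp
  have m_inj: "?m k \<noteq> ?m j" if "k \<noteq> j" for k j
  proof
    assume "?m k = ?m j"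
    then have "of_int (- int k) * \<alpha> ?t = of_int (- int j) * \<alpha> ?t" by (rule fun_cong)
    with at that show False by simp
  qed
  have "\<alpha> \<notin> ?C"
  proof
    assume "\<alpha> \<in> ?C"
    then obtain k where "\<alpha> = ?m k" by blast
    then have "\<alpha> ?t = of_int (- int k) * \<alpha> ?t" by (rule fun_cong)
    moreover have "of_nat (Suc k) * \<alpha> ?t = \<alpha> ?t - of_int (- int k) * \<alpha> ?t"
      by (simp add: algebra_simps)
    ultimately have "of_nat (Suc k) * \<alpha> ?t = 0" by simp
    with at show False using of_nat_neq_0[of k, where 'a = 'k] by (metis mult_eq_0_iff)
  qed
  then have disj: "span {e} \<inter> ?S \<subseteq> {0}"
    using wspace_disjoint[of ?C \<alpha>] \<alpha>(1) e(1) span_minimal[of "{e}" "wspace \<alpha>"] subspace_wspace by blast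
  have mW: "?m k \<in> H_supported" for k using \<alpha>(2) by auto
  have in_S: "z \<in> ?S" if "z \<in> wspace (?m k)" for z k
    using that mW by (rule wspace_in_span) auto
  have S_M: "?S \<subseteq> ?M" and e_M: "e \<in> ?M" by (auto intro: span_base)
  have m0: "?m 0 = 0" and mm: "\<alpha> + ?m (Suc k) = ?m k" "- \<alpha> + ?m k = ?m (Suc k)" for k
    by (auto simp: fun_eq_iff algebra_simps)
  have M: "?M = span ({e} \<union> (\<Union>\<gamma>\<in>?C. wspace \<gamma>))" by (simp only: span_Un span_span)
  have "br e z \<in> ?M" if "z \<in> ?M" for z
  proof (rule lin_span_subset[OF lin_br _ subspace_span, of "{e} \<union> (\<Union>\<gamma>\<in>?C. wspace \<gamma>)"])
    show "z \<in> span ({e} \<union> (\<Union>\<gamma>\<in>?C. wspace \<gamma>))" using that unfolding M .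
    fix z assume "z \<in> {e} \<union> (\<Union>\<gamma>\<in>?C. wspace \<gamma>)"
    then consider "z = e" | k where "z \<in> wspace (?m k)" by blast
    then show "br e z \<in> ?M"
    proof cases
      case 1
      then show ?thesis by (simp add: br_self span_zero)
    next
      case 2
      show ?thesis
      proof (cases k)
        case 0
        then have "z \<in> H" using 2 m0 wspace_0 by simp
        then have "br e z = - \<alpha> z *s e" using e(3) br_anti[of e z] by simp
        then show ?thesis using e_M by (simp add: span_neg span_scale)
      next
        case (Suc j)
        then have "br e z \<in> wspace (?m j)" using wspace_br[OF e(1)] 2 mm(1) by metis
        then show ?thesis using in_S S_M by blast
      qed
    qed
  qed
  moreover have "br y z \<in> ?M" if "z \<in> ?M" for z
  proof (rule lin_span_subset[OF lin_br _ subspace_span, of "{e} \<union> (\<Union>\<gamma>\<in>?C. wspace \<gamma>)"])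
    show "z \<in> span ({e} \<union> (\<Union>\<gamma>\<in>?C. wspace \<gamma>))" using that unfolding M .
    fix z assume "z \<in> {e} \<union> (\<Union>\<gamma>\<in>?C. wspace \<gamma>)"
    then consider "z = e" | k where "z \<in> wspace (?m k)" by blast
    then show "br y z \<in> ?M"
    proof cases
      case 1
      have "?t \<in> ?S" using t wspace_0 m0 by (intro in_S[of _ 0]) simp
      then show ?thesis using 1 S_M br_anti[of y e] by (auto simp: span_neg)
    next
      case 2
      have "br y z \<in> wspace (?m (Suc k))" using wspace_br[OF y 2] mm(2) by metis
      then show ?thesis using in_S S_M by blast
    qed
  qed
  ultimately have "trace ?M (br ?t) = 0" by (intro trace_bracket) auto
  have te: "br ?t z = \<alpha> ?t *s z" if "z \<in> span {e}" for z
    using that e(3) t by (auto simp: span_singleton br_scale_right mult.commute)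
  have "trace (span {e}) (br ?t) = trace (span {e}) (\<lambda>z. \<alpha> ?t *s z)"
    using te by (intro trace_cong) auto
  also have "\<dots> = \<alpha> ?t" using e(2) by (simp add: trace_scalar)
  finally have tr_e: "trace (span {e}) (br ?t) = \<alpha> ?t" .
  have "\<forall>\<gamma>\<in>?C. \<exists>k. \<gamma> = ?m k" by blast
  then obtain k where k: "\<And>\<gamma>. \<gamma> \<in> ?C \<Longrightarrow> \<gamma> = ?m (k \<gamma>)" unfolding bchoice_iff by blast
  have S_t: "br ?t z \<in> ?S" if "z \<in> ?S" for z
    by (rule lin_span_subset[OF lin_br _ subspace_span that]) (use t in \<open>auto intro!: span_base simp: br_wspace\<close>)
  have "trace ?S (br ?t) = (\<Sum>\<gamma>\<in>?C. trace (wspace \<gamma>) (br ?t))"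
    using t by (intro trace_span_wspace lin_br) (auto simp: br_wspace)
  also have "\<dots> = (\<Sum>\<gamma>\<in>?C. of_nat (dim (wspace \<gamma>)) * \<gamma> ?t)" using t by (simp add: trace_wspace)
  also have "\<dots> = (\<Sum>\<gamma>\<in>?C. - of_nat (dim (wspace \<gamma>) * k \<gamma>) * \<alpha> ?t)"
  proof (rule sum.cong)
    fix \<gamma> assume "\<gamma> \<in> ?C"
    from fun_cong[OF k[OF this], of ?t] have "\<gamma> ?t = of_int (- int (k \<gamma>)) * \<alpha> ?t" .
    then show "of_nat (dim (wspace \<gamma>)) * \<gamma> ?t = - of_nat (dim (wspace \<gamma>) * k \<gamma>) * \<alpha> ?t" by simp
  qed simp
  also have "\<dots> = - of_nat (\<Sum>\<gamma>\<in>?C. dim (wspace \<gamma>) * k \<gamma>) * \<alpha> ?t"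
    unfolding of_nat_sum sum_negf[symmetric] sum_distrib_right by simp
  finally have tr_S: "trace ?S (br ?t) = - of_nat (\<Sum>\<gamma>\<in>?C. dim (wspace \<gamma>) * k \<gamma>) * \<alpha> ?t" .
  have "trace ?M (br ?t) = trace (span {e}) (br ?t) + trace ?S (br ?t)"
    using te S_t disj by (intro trace_sum2 lin_br) (auto simp: span_scale)
  with \<open>trace ?M (br ?t) = 0\<close> tr_e tr_S
  have "(1 - of_nat (\<Sum>\<gamma>\<in>?C. dim (wspace \<gamma>) * k \<gamma>)) * \<alpha> ?t = 0" by (simp add: algebra_simps)
  with at have "of_nat (\<Sum>\<gamma>\<in>?C. dim (wspace \<gamma>) * k \<gamma>) = (of_nat 1 :: 'k)" by simp
  \<comment> \<open>The term of \<open>- \<alpha>\<close> already contributes at least 1, so it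
    equals 1 and no multiple with \<open>k \<ge> 2\<close> can occur.\<close>
  then have sum1: "(\<Sum>\<gamma>\<in>?C. dim (wspace \<gamma>) * k \<gamma>) = 1" by (simp only: of_nat_eq_iff)
  have m1: "?m 1 = - \<alpha>" by (auto simp: fun_eq_iff)
  have mC: "- \<alpha> \<in> ?C"
    using \<Lambda>_minus[OF \<alpha>(1)] m1[symmetric] by blast
  have "k (- \<alpha>) = 1"
  proof (rule ccontr)
    assume "k (- \<alpha>) \<noteq> 1"
    then have "?m (k (- \<alpha>)) \<noteq> ?m 1" by (rule m_inj)
    with k[OF mC] show False unfolding m1 by simp
  qed
  with sum1 have sum2: "dim (wspace (- \<alpha>)) + (\<Sum>\<gamma>\<in>?C - {- \<alpha>}. dim (wspace \<gamma>) * k \<gamma>) = 1"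
    using sum.remove[OF fin mC, of "\<lambda>\<gamma>. dim (wspace \<gamma>) * k \<gamma>"] by simp
  with dim_wspace_pos[OF \<Lambda>_minus[OF \<alpha>(1)]] show "dim (wspace (- \<alpha>)) = 1" by linarith
  with sum2 have rest: "(\<Sum>\<gamma>\<in>?C - {- \<alpha>}. dim (wspace \<gamma>) * k \<gamma>) = 0" by linarith
  show "?m j \<notin> \<Lambda>" if "j \<ge> 2" for j
  proof
    assume j: "?m j \<in> \<Lambda>"
    then have mj: "?m j \<in> ?C" by blast
    have "?m j \<noteq> ?m 1" by (rule m_inj) (use that in simp)
    then have "?m j \<in> ?C - {- \<alpha>}" using mj unfolding m1 by blast
    moreover have "k (?m j) = j"
    proof (rule ccontr)
      assume "k (?m j) \<noteq> j"
      then have "?m (k (?m j)) \<noteq> ?m j" by (rule m_inj)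
      then show False using k[OF mj, symmetric] by (rule notE)
    qed
    moreover have "\<forall>\<gamma>\<in>?C - {- \<alpha>}. dim (wspace \<gamma>) * k \<gamma> = 0"
      using rest fin by (subst (asm) sum_eq_0_iff) auto
    ultimately have "dim (wspace (?m j)) * j = 0" by (metis (no_types, lifting))
    with dim_wspace_pos[OF j] that show False by (simp del: dim_eq_0)
  qed
qed

section \<open>Root strings\<close>

lemma dim_wspace: "\<alpha> \<in> \<Phi> \<Longrightarrow> dim (wspace \<alpha>) = 1"
  using root_space_neg(1)[OF \<Phi>_minus, of \<alpha>] by simp

lemma multiple_root:
  assumes \<alpha>: "\<alpha> \<in> \<Phi>" and k: "scale_fun (of_int k) \<alpha> \<in> \<Lambda>"
  shows "k = 0 \<or> k = 1 \<or> k = -1"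
proof -
  have "\<not> k \<le> - 2"
  proof
    assume "k \<le> - 2"
    then have "nat (- k) \<ge> 2" "- int (nat (- k)) = k" by auto
    with root_space_neg(2)[OF \<alpha>, of "nat (- k)"] k show False by simp
  qed
  moreover have "\<not> k \<ge> 2"
  proof
    assume "k \<ge> 2"
    then have "nat k \<ge> 2" "int (nat k) = k" by auto
    moreover have "scale_fun (of_int (- k)) (- \<alpha>) = scale_fun (of_int k) \<alpha>" by auto
    ultimately show False using root_space_neg(2)[OF \<Phi>_minus[OF \<alpha>], of "nat k"] k by simp
  qed
  ultimately show ?thesis by linarith
qed

lemma wspace_span:
  assumes "\<alpha> \<in> \<Phi>" "e \<in> wspace \<alpha>" "e \<noteq> 0"
  shows "wspace \<alpha> = span {e}"
proof (rule subspace_dim_equal[symmetric])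
  show "span {e} \<subseteq> wspace \<alpha>" using assms by (intro span_minimal subspace_wspace) simp
  show "dim (wspace \<alpha>) \<le> dim (span {e})" using assms by (simp add: dim_wspace)
qed (simp_all add: subspace_wspace)

text \<open>On a one-dimensional root space every vector is a multiple of a true eigenvector; for
  weight 0 the claim is commutativity of \<open>H\<close>.\<close>

lemma wspace_eigen:
  assumes \<alpha>: "\<alpha> \<in> \<Lambda>" and x: "x \<in> wspace \<alpha>" and h: "h \<in> H"
  shows "br h x = \<alpha> h *s x"
proof (cases "\<alpha> = 0")
  case True
  with x h show ?thesis using wspace_0 H_abelian by simp
next
  case False
  with \<alpha> have "\<alpha> \<in> \<Phi>" by (simp add: \<Phi>_def)
  obtain e where e: "e \<in> wspace \<alpha>" "e \<noteq> 0" "\<forall>h\<in>H. br h e = \<alpha> h *s e" using weight_vector[OF \<alpha>] by blast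
  then have "x \<in> span {e}" using x wspace_span[OF \<open>\<alpha> \<in> \<Phi>\<close>] by blast
  then show ?thesis using e(3) h by (auto simp: span_singleton br_scale_right mult.commute)
qed

text \<open>The element usually written t_\<alpha>, not the coroot: no rescaling takes place, so
  \<open>\<beta> (dual_elem \<alpha>)\<close> is the inner product of \<open>\<beta>\<close> and
  \<open>\<alpha>\<close>.\<close>

definition dual_elem :: "('g \<Rightarrow> 'k) \<Rightarrow> 'g" where
  "dual_elem \<alpha> = (THE t. t \<in> H \<and> (\<forall>h\<in>H. killing t h = \<alpha> h))"

lemma dual_elem_eq:
  assumes "u \<in> H" "\<And>h. h \<in> H \<Longrightarrow> killing u h = \<alpha> h"
  shows "dual_elem \<alpha> = u"
  unfolding dual_elem_def
proof (rule the_equality)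
  fix v assume v: "v \<in> H \<and> (\<forall>h\<in>H. killing v h = \<alpha> h)"
  then have "v - u = 0"
    using assms subspace_diff[OF subspace_H] by (intro H_killing_eq_0) (auto simp: killing_diff_left)
  then show "v = u" by simp
qed (use assms in auto)

lemma dual_elem_H: "\<alpha> \<in> \<Phi> \<Longrightarrow> dual_elem \<alpha> \<in> H"
  and killing_dual_elem: "\<alpha> \<in> \<Phi> \<Longrightarrow> h \<in> H \<Longrightarrow> killing (dual_elem \<alpha>) h = \<alpha> h"
  and root_dual_elem_nonzero: "\<alpha> \<in> \<Phi> \<Longrightarrow> \<alpha> (dual_elem \<alpha>) \<noteq> 0"
  using root_triple dual_elem_eq by metis+

lemma dual_elem_nonzero: "\<alpha> \<in> \<Phi> \<Longrightarrow> dual_elem \<alpha> \<noteq> 0"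
  using root_dual_elem_nonzero[of \<alpha>] killing_dual_elem[of \<alpha> "dual_elem \<alpha>"] dual_elem_H[of \<alpha>] by auto

lemma dual_elem_sym: "\<alpha> \<in> \<Phi> \<Longrightarrow> \<beta> \<in> \<Phi> \<Longrightarrow> \<alpha> (dual_elem \<beta>) = \<beta> (dual_elem \<alpha>)"
  using killing_dual_elem[of \<alpha> "dual_elem \<beta>"] killing_dual_elem[of \<beta> "dual_elem \<alpha>"] killing_sym dual_elem_H by metis

lemma br_root_pair:
  assumes \<alpha>: "\<alpha> \<in> \<Phi>" and e: "e \<in> wspace \<alpha>" and y: "y \<in> wspace (- \<alpha>)"
  shows "br e y = killing e y *s dual_elem \<alpha>"
proof -
  have H: "br e y \<in> H" using e y by (rule wspace_br_minus)
  have "br e y - killing e y *s dual_elem \<alpha> = 0"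
  proof (rule H_killing_eq_0)
    show "br e y - killing e y *s dual_elem \<alpha> \<in> H"
      using H dual_elem_H[OF \<alpha>] subspace_H by (simp add: subspace_diff subspace_scale)
    fix k assume "k \<in> H"
    then show "killing (br e y - killing e y *s dual_elem \<alpha>) k = 0"
      using killing_bracket_H[of e \<alpha> k y] wspace_eigen[OF \<Phi>_\<Lambda>(1)[OF \<alpha>] e] killing_dual_elem[OF \<alpha>]
      by (simp add: killing_diff_left killing_scale_left)
  qed
  then show ?thesis by simp
qed

lemma root_pair:
  assumes \<alpha>: "\<alpha> \<in> \<Phi>"
  obtains e y where "e \<in> wspace \<alpha>" "y \<in> wspace (- \<alpha>)" "e \<noteq> 0" "y \<noteq> 0" "br e y = dual_elem \<alpha>" "killing e y = 1"
proof -
  obtain e y where e: "e \<in> wspace \<alpha>" "y \<in> wspace (- \<alpha>)" "e \<noteq> 0" "br e y \<in> H" "\<forall>h\<in>H. killing (br e y) h = \<alpha> h"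
    using root_triple[OF \<alpha>] by metis
  then have t: "dual_elem \<alpha> = br e y" by (intro dual_elem_eq) auto
  then have "killing e y *s dual_elem \<alpha> = 1 *s dual_elem \<alpha>" using br_root_pair[OF \<alpha> e(1,2)] by simp
  then have "killing e y = 1" using dual_elem_nonzero[OF \<alpha>] by (simp only: scale_cancel_right) simp
  then show ?thesis using e t that by (metis killing_0_right zero_neq_one)
qed

lemma sum_\<Lambda>_\<Phi>: "(\<And>\<gamma>. \<gamma> \<in> \<Lambda> \<Longrightarrow> \<gamma> = 0 \<Longrightarrow> f \<gamma> = 0) \<Longrightarrow> (\<Sum>\<gamma>\<in>\<Lambda>. f \<gamma>) = (\<Sum>\<gamma>\<in>\<Phi>. f \<gamma>)"
  by (rule sum.mono_neutral_right) (auto simp: \<Phi>_def finite_\<Lambda>)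

lemma finite_\<Phi>: "finite \<Phi>"
  using finite_\<Lambda> by (simp add: \<Phi>_def)

lemma killing_H_roots: "h \<in> H \<Longrightarrow> k \<in> H \<Longrightarrow> killing h k = (\<Sum>\<gamma>\<in>\<Phi>. \<gamma> h * \<gamma> k)"
  unfolding killing_H by (subst sum_\<Lambda>_\<Phi>) (auto simp: dim_wspace intro: sum.cong)

lemma H_eq_span_dual_elem: "H = span (dual_elem ` \<Phi>)"
proof
  show "span (dual_elem ` \<Phi>) \<subseteq> H" using dual_elem_H by (intro span_minimal subspace_H) auto
  have "br x y \<in> span (dual_elem ` \<Phi>)" if "\<alpha> \<in> \<Lambda>" "x \<in> wspace \<alpha>" "y \<in> wspace (- \<alpha>)" for \<alpha> x y
  proof (cases "\<alpha> = 0")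
    case True
    then have "br x y = 0" using that wspace_0 H_abelian by simp
    then show ?thesis by (simp add: span_zero)
  next
    case False
    then have "\<alpha> \<in> \<Phi>" using that by (simp add: \<Phi>_def)
    then have "dual_elem \<alpha> \<in> span (dual_elem ` \<Phi>)" by (intro span_base) blast
    then show ?thesis using br_root_pair[OF \<open>\<alpha> \<in> \<Phi>\<close> that(2,3)] by (simp add: span_scale)
  qed
  then have "span (\<Union>\<alpha>\<in>\<Lambda>. {br x y |x y. x \<in> wspace \<alpha> \<and> y \<in> wspace (- \<alpha>)}) \<subseteq> span (dual_elem ` \<Phi>)"
    by (intro span_minimal) auto
  then show "H \<subseteq> span (dual_elem ` \<Phi>)" using H_span_brackets by blast
qed

lemma shift_inj: "\<alpha> \<in> \<Phi> \<Longrightarrow> shift \<beta> k \<alpha> = shift \<beta> j \<alpha> \<longleftrightarrow> k = j"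
proof
  assume \<alpha>: "\<alpha> \<in> \<Phi>" and eq: "shift \<beta> k \<alpha> = shift \<beta> j \<alpha>"
  from fun_cong[OF eq, of "dual_elem \<alpha>"] show "k = j" using root_dual_elem_nonzero[OF \<alpha>] by simp
qed simp

text \<open>Finiteness of \<open>\<Lambda>\<close> ends the string; the factor \<open>s\<close> lets
  one statement serve both directions.\<close>

lemma string_end:
  assumes \<alpha>: "\<alpha> \<in> \<Phi>" and \<beta>: "\<beta> \<in> \<Lambda>" and s: "s \<noteq> (0 :: int)"
  obtains p :: nat where "\<And>j. j \<le> p \<Longrightarrow> shift \<beta> (s * int j) \<alpha> \<in> \<Lambda>" "shift \<beta> (s * int (Suc p)) \<alpha> \<notin> \<Lambda>"
proof -
  let ?f = "\<lambda>j :: nat. shift \<beta> (s * int j) \<alpha>"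
  have "inj ?f" using s by (intro injI) (simp only: shift_inj[OF \<alpha>], simp)
  then have "\<exists>n. ?f n \<notin> \<Lambda>"
    using finite_\<Lambda> finite_imageD[of ?f UNIV] finite_subset[of "range ?f" \<Lambda>] by blast
  then obtain n where n: "?f n \<notin> \<Lambda>" "\<And>j. j < n \<Longrightarrow> ?f j \<in> \<Lambda>"
    using exists_least_iff[of "\<lambda>n. ?f n \<notin> \<Lambda>"] by blast
  have "?f 0 = \<beta>" using shift_eqs(1)[of \<beta> \<alpha>] by simp
  with n(1) \<beta> have "n \<noteq> 0" by metis
  then obtain p where "n = Suc p" by (cases n) auto
  with n that show ?thesis by (metis less_Suc_eq_le)
qed

lemma sum_int_interval: "2 * (\<Sum>k\<in>{- int p..int q}. k) = (int q - int p) * (int p + int q + 1)"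
proof -
  have "(\<Sum>k\<in>{- int p..int q}. k) = (\<Sum>k\<in>{- int p..int q}. int q - int p - k)"
    by (rule sum.reindex_bij_witness[of _ "\<lambda>k. int q - int p - k" "\<lambda>k. int q - int p - k"]) auto
  then have "2 * (\<Sum>k\<in>{- int p..int q}. k) = (\<Sum>k\<in>{- int p..int q}. k + (int q - int p - k))"
    unfolding sum.distrib by simp
  also have "\<dots> = (int q - int p) * (int p + int q + 1)" by (simp add: algebra_simps)
  finally show ?thesis .
qed

text \<open>The unbroken segment from -p to q of the string is stable and consists of
  one-dimensional spaces, so zero trace gives the value p - q. Multiples of \<open>\<alpha>\<close>
  are set apart because their string may meet 0, whose weight space \<open>H\<close> need not be a
  line.\<close>

lemma cartan_integer:
  assumes \<alpha>: "\<alpha> \<in> \<Phi>" and \<beta>: "\<beta> \<in> \<Phi>"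
  shows "\<exists>m :: int. 2 * \<beta> (dual_elem \<alpha>) = of_int m * \<alpha> (dual_elem \<alpha>)"
proof (cases "\<exists>k. \<beta> = scale_fun (of_int k) \<alpha>")
  case True
  then obtain k where "\<beta> = scale_fun (of_int k) \<alpha>" by blast
  from fun_cong[OF this, of "dual_elem \<alpha>"] have "2 * \<beta> (dual_elem \<alpha>) = of_int (2 * k) * \<alpha> (dual_elem \<alpha>)" by simp
  then show ?thesis by blast
next
  case False
  have \<beta>\<Lambda>: "\<beta> \<in> \<Lambda>" using \<Phi>_\<Lambda>[OF \<beta>] by simp
  obtain e y where e: "e \<in> wspace \<alpha>" and y: "y \<in> wspace (- \<alpha>)" and t: "br e y = dual_elem \<alpha>"
    using root_pair[OF \<alpha>] by metis
  obtain q where q: "\<And>j. j \<le> q \<Longrightarrow> shift \<beta> (1 * int j) \<alpha> \<in> \<Lambda>" "shift \<beta> (1 * int (Suc q)) \<alpha> \<notin> \<Lambda>"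
    by (rule string_end[OF \<alpha> \<beta>\<Lambda>, of 1]) auto
  obtain p where p: "\<And>j. j \<le> p \<Longrightarrow> shift \<beta> (- 1 * int j) \<alpha> \<in> \<Lambda>" "shift \<beta> (- 1 * int (Suc p)) \<alpha> \<notin> \<Lambda>"
    by (rule string_end[OF \<alpha> \<beta>\<Lambda>, of "- 1"]) auto
  let ?f = "\<lambda>k. shift \<beta> k \<alpha>" and ?I = "{- int p..int q}"
  have \<Lambda>: "?f k \<in> \<Lambda>" if "k \<in> ?I" for k
  proof (cases "k \<ge> 0")
    case True
    then show ?thesis using q(1)[of "nat k"] that by simp
  next
    case False
    then show ?thesis using p(1)[of "nat (- k)"] that by simp
  qed
  have fW: "?f k \<in> H_supported" for k using \<Phi>_\<Lambda>[OF \<alpha>] \<beta>\<Lambda> by (auto simp: \<Lambda>_outside)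
  have "?f k \<noteq> 0" for k
  proof
    assume 0: "?f k = 0"
    have "\<beta> = scale_fun (of_int (- k)) \<alpha>"
    proof
      fix h
      from fun_cong[OF 0, of h] show "\<beta> h = of_int (- k) * \<alpha> h" by (simp add: eq_neg_iff_add_eq_0)
    qed
    with False show False by blast
  qed
  then have \<Phi>: "?f k \<in> \<Phi>" if "k \<in> ?I" for k using \<Lambda>[OF that] by (simp add: \<Phi>_def)
  have "(\<Sum>\<gamma>\<in>?f ` ?I. of_nat (dim (wspace \<gamma>)) * \<gamma> (br e y)) = 0"
  proof (rule sum_weights)
    show "?f ` ?I \<subseteq> \<Lambda>" using \<Lambda> by blast
    show "br e y \<in> H" using e y by (rule wspace_br_minus)
    fix \<gamma> z assume \<gamma>: "\<gamma> \<in> ?f ` ?I" and z: "z \<in> wspace \<gamma>"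
    then obtain k where k: "k \<in> ?I" "\<gamma> = ?f k" by blast
    have "br e z \<in> wspace (?f (k + 1))" using wspace_br[OF e z] shift_eqs(2) k(2) by metis
    then show "br e z \<in> span (\<Union>\<gamma>\<in>?f ` ?I. wspace \<gamma>)"
    proof (rule wspace_in_span[OF _ fW])
      assume a: "?f (k + 1) \<in> \<Lambda>"
      have "k + 1 \<noteq> int (Suc q)"
      proof
        assume "k + 1 = int (Suc q)"
        with a have "?f (int (Suc q)) \<in> \<Lambda>" by (simp only:)
        with q(2) show False unfolding mult_1 by (rule notE)
      qed
      then have "k + 1 \<in> ?I" using k(1) by auto
      then show "?f (k + 1) \<in> ?f ` ?I" by blast
    qed
    have "br y z \<in> wspace (?f (k - 1))" using wspace_br[OF y z] shift_eqs(3) k(2) by metis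
    then show "br y z \<in> span (\<Union>\<gamma>\<in>?f ` ?I. wspace \<gamma>)"
    proof (rule wspace_in_span[OF _ fW])
      assume a: "?f (k - 1) \<in> \<Lambda>"
      have "k - 1 \<noteq> - int (Suc p)"
      proof
        assume "k - 1 = - int (Suc p)"
        with a have "?f (- int (Suc p)) \<in> \<Lambda>" by (simp only:)
        with p(2) show False unfolding mult_minus_left mult_1 by (rule notE)
      qed
      then have "k - 1 \<in> ?I" using k(1) by auto
      then show "?f (k - 1) \<in> ?f ` ?I" by blast
    qed
  qed
  also have "(\<Sum>\<gamma>\<in>?f ` ?I. of_nat (dim (wspace \<gamma>)) * \<gamma> (br e y)) = (\<Sum>k\<in>?I. \<beta> (dual_elem \<alpha>) + of_int k * \<alpha> (dual_elem \<alpha>))"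
    using \<Phi> shift_inj[OF \<alpha>]
    by (subst sum.reindex) (auto simp: inj_on_def dim_wspace t intro!: sum.cong)
  also have "\<dots> = of_int (int p + int q + 1) * \<beta> (dual_elem \<alpha>) + of_int (\<Sum>k\<in>?I. k) * \<alpha> (dual_elem \<alpha>)"
    by (simp add: sum.distrib sum_distrib_right)
  finally have "0 = 2 * (of_int (int p + int q + 1) * \<beta> (dual_elem \<alpha>) + of_int (\<Sum>k\<in>?I. k) * \<alpha> (dual_elem \<alpha>))" by simp
  also have "\<dots> = of_int (int p + int q + 1) * (2 * \<beta> (dual_elem \<alpha>)) + of_int (2 * (\<Sum>k\<in>?I. k)) * \<alpha> (dual_elem \<alpha>)"
    by (simp add: algebra_simps)
  also have "\<dots> = of_int (int p + int q + 1) * (2 * \<beta> (dual_elem \<alpha>) - of_int (int p - int q) * \<alpha> (dual_elem \<alpha>))"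
    unfolding sum_int_interval by (simp add: algebra_simps)
  finally have "of_int (int p + int q + 1) * (2 * \<beta> (dual_elem \<alpha>) - of_int (int p - int q) * \<alpha> (dual_elem \<alpha>)) = 0" by simp
  moreover have "of_int (int p + int q + 1) \<noteq> (0 :: 'k)" by (simp only: of_int_eq_0_iff)
  ultimately have "2 * \<beta> (dual_elem \<alpha>) = of_int (int p - int q) * \<alpha> (dual_elem \<alpha>)" by simp
  then show ?thesis by blast
qed

text \<open>If \<open>br y e\<close> were 0, the string from \<open>\<beta>\<close> upwards would be
  stable under both root vectors. Its trace is a multiple of
  \<open>card ?C * m + 2 * (\<Sum>k)\<close>, which is positive for \<open>m > 0\<close>.\<close>

lemma br_root_nonzero:
  assumes \<alpha>: "\<alpha> \<in> \<Phi>" and \<beta>: "\<beta> \<in> \<Phi>" and m: "2 * \<beta> (dual_elem \<alpha>) = of_int m * \<alpha> (dual_elem \<alpha>)" "m > 0"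
    and y: "y \<in> wspace (- \<alpha>)" "y \<noteq> 0" and e: "e \<in> wspace \<beta>" "e \<noteq> 0"
  shows "br y e \<noteq> 0"
proof
  assume 0: "br y e = 0"
  have \<beta>\<Lambda>: "\<beta> \<in> \<Lambda>" using \<Phi>_\<Lambda>[OF \<beta>] by simp
  obtain x v where x: "x \<in> wspace \<alpha>" and v: "v \<in> wspace (- \<alpha>)" and t: "br x v = dual_elem \<alpha>"
    using root_pair[OF \<alpha>] by metis
  have "v \<in> span {y}" using wspace_span[OF \<Phi>_minus[OF \<alpha>] y] v by simp
  then have ve: "br v e = 0" using 0 by (auto simp: span_singleton br_scale_left)
  let ?C = "{\<gamma>\<in>\<Lambda>. \<exists>k::nat. \<gamma> = shift \<beta> (int k) \<alpha>}"
  have fW: "shift \<beta> k \<alpha> \<in> H_supported" for k using \<Phi>_\<Lambda>[OF \<alpha>] \<beta>\<Lambda> by (auto simp: \<Lambda>_outside)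
  have fin: "finite ?C" using finite_\<Lambda> by simp
  \<comment> \<open>The weight 0 must be kept out so that every space counted is a line: it would
    mean \<open>\<beta> = - k \<alpha>\<close>, hence \<open>m = - 2 * k\<close>, contrary to
    \<open>m > 0\<close>.\<close>
  have \<gamma>0: "\<gamma> \<noteq> 0" if "\<gamma> \<in> ?C" for \<gamma>
  proof
    assume "\<gamma> = 0"
    with that obtain k :: nat where k: "shift \<beta> (int k) \<alpha> = 0" by auto
    have eq: "\<beta> = scale_fun (of_int (- int k)) \<alpha>"
    proof
      fix h
      from fun_cong[OF k, of h] show "\<beta> h = of_int (- int k) * \<alpha> h" by (simp add: eq_neg_iff_add_eq_0)
    qed
    have "of_int (- 2 * int k) * \<alpha> (dual_elem \<alpha>) = 2 * (of_int (- int k) * \<alpha> (dual_elem \<alpha>))" by simp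
    also have "\<dots> = of_int m * \<alpha> (dual_elem \<alpha>)"
      using m(1) fun_cong[OF eq, of "dual_elem \<alpha>"] by (simp only:)
    finally have "of_int (- 2 * int k) * \<alpha> (dual_elem \<alpha>) = of_int m * \<alpha> (dual_elem \<alpha>)" .
    then have "of_int (- 2 * int k) = (of_int m :: 'k)" using root_dual_elem_nonzero[OF \<alpha>] by (metis mult_right_cancel)
    then have "- 2 * int k = m" by (simp only: of_int_eq_iff)
    with m(2) show False by simp
  qed
  have "(\<Sum>\<gamma>\<in>?C. of_nat (dim (wspace \<gamma>)) * \<gamma> (br x v)) = 0"
  proof (rule sum_weights)
    show "br x v \<in> H" using x v by (rule wspace_br_minus)
    fix \<gamma> z assume \<gamma>: "\<gamma> \<in> ?C" and z: "z \<in> wspace \<gamma>"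
    then obtain k :: nat where k: "\<gamma> = shift \<beta> (int k) \<alpha>" by blast
    have "int (Suc k) = int k + 1" by simp
    then have "br x z \<in> wspace (shift \<beta> (int (Suc k)) \<alpha>)"
      using wspace_br[OF x z] unfolding k shift_eqs(2) by (simp only:)
    then show "br x z \<in> span (\<Union>\<gamma>\<in>?C. wspace \<gamma>)" by (rule wspace_in_span[OF _ fW]) blast
    \<comment> \<open>Only the bottom of the half-string could be left downwards, and there the
      assumed vanishing applies.\<close>
    show "br v z \<in> span (\<Union>\<gamma>\<in>?C. wspace \<gamma>)"
    proof (cases k)
      case 0
      then have "z \<in> wspace \<beta>" using k z shift_eqs(1)[of \<beta> \<alpha>] by simp
      then have "z \<in> span {e}" using wspace_span[OF \<beta> e] by simp
      then have "br v z = 0" using ve by (auto simp: span_singleton br_scale_right)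
      then show ?thesis by (simp add: span_zero)
    next
      case (Suc j)
      then have "int j = int k - 1" by simp
      then have "br v z \<in> wspace (shift \<beta> (int j) \<alpha>)"
        using wspace_br[OF v z] unfolding k shift_eqs(3) by (simp only:)
      then show ?thesis by (rule wspace_in_span[OF _ fW]) blast
    qed
  qed auto
  moreover have "\<forall>\<gamma>\<in>?C. \<exists>k::nat. \<gamma> = shift \<beta> (int k) \<alpha>" by blast
  then obtain k :: "_ \<Rightarrow> nat" where k: "\<And>\<gamma>. \<gamma> \<in> ?C \<Longrightarrow> \<gamma> = shift \<beta> (int (k \<gamma>)) \<alpha>"
    unfolding bchoice_iff by blast
  have "(\<Sum>\<gamma>\<in>?C. of_nat (dim (wspace \<gamma>)) * \<gamma> (br x v)) = (\<Sum>\<gamma>\<in>?C. \<beta> (dual_elem \<alpha>) + of_int (int (k \<gamma>)) * \<alpha> (dual_elem \<alpha>))"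
  proof (rule sum.cong)
    fix \<gamma> assume \<gamma>: "\<gamma> \<in> ?C"
    then have "dim (wspace \<gamma>) = 1" using \<gamma>0[OF \<gamma>] by (intro dim_wspace) (simp add: \<Phi>_def)
    with fun_cong[OF k[OF \<gamma>], of "dual_elem \<alpha>"]
    show "of_nat (dim (wspace \<gamma>)) * \<gamma> (br x v) = \<beta> (dual_elem \<alpha>) + of_int (int (k \<gamma>)) * \<alpha> (dual_elem \<alpha>)"
      unfolding t by (simp only: plus_fun_apply) simp
  qed simp
  moreover have "\<dots> = of_int (int (card ?C)) * \<beta> (dual_elem \<alpha>) + of_int (\<Sum>\<gamma>\<in>?C. int (k \<gamma>)) * \<alpha> (dual_elem \<alpha>)"
    by (simp add: sum.distrib sum_distrib_right)
  ultimately have "0 = 2 * (of_int (int (card ?C)) * \<beta> (dual_elem \<alpha>) + of_int (\<Sum>\<gamma>\<in>?C. int (k \<gamma>)) * \<alpha> (dual_elem \<alpha>))"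
    by simp
  also have "\<dots> = of_int (int (card ?C)) * (2 * \<beta> (dual_elem \<alpha>)) + of_int (2 * (\<Sum>\<gamma>\<in>?C. int (k \<gamma>))) * \<alpha> (dual_elem \<alpha>)"
    by (simp add: algebra_simps)
  also have "\<dots> = of_int (int (card ?C) * m + 2 * (\<Sum>\<gamma>\<in>?C. int (k \<gamma>))) * \<alpha> (dual_elem \<alpha>)"
    unfolding m(1) by (simp add: algebra_simps)
  finally have "of_int (int (card ?C) * m + 2 * (\<Sum>\<gamma>\<in>?C. int (k \<gamma>))) * \<alpha> (dual_elem \<alpha>) = 0"
    by (rule sym)
  then have "of_int (int (card ?C) * m + 2 * (\<Sum>\<gamma>\<in>?C. int (k \<gamma>))) = (0 :: 'k)"
    using root_dual_elem_nonzero[OF \<alpha>] by (simp only: mult_eq_0_iff simp_thms)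
  then have "int (card ?C) * m + 2 * (\<Sum>\<gamma>\<in>?C. int (k \<gamma>)) = 0" by (simp only: of_int_eq_0_iff)
  moreover have "(\<Sum>\<gamma>\<in>?C. int (k \<gamma>)) \<ge> 0" by (rule sum_nonneg) simp
  moreover have "\<beta> = shift \<beta> (int 0) \<alpha>" using shift_eqs(1)[of \<beta> \<alpha>] by simp
  then have "\<beta> \<in> ?C" using \<beta>\<Lambda> by blast
  then have "card ?C > 0" using fin card_gt_0_iff by blast
  then have "int (card ?C) * m > 0" using m(2) by simp
  ultimately show False by linarith
qed

text \<open>With \<open>c\<close> the value in question, the Killing form as a sum over roots gives
  \<open>c = (\<Sum>\<gamma>. (m \<gamma> * c / 2)^2)\<close> with integers
  \<open>m \<gamma>\<close>, hence \<open>4 = c * (\<Sum>\<gamma>. (m \<gamma>)^2)\<close>.\<close>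

lemma root_norm_rational:
  assumes \<alpha>: "\<alpha> \<in> \<Phi>"
  shows "\<exists>r :: rat. \<alpha> (dual_elem \<alpha>) = of_rat r"
proof -
  let ?c = "\<alpha> (dual_elem \<alpha>)"
  have "\<forall>\<gamma>\<in>\<Phi>. \<exists>m :: int. 2 * \<gamma> (dual_elem \<alpha>) = of_int m * ?c" using cartan_integer[OF \<alpha>] by blast
  then obtain m :: "_ \<Rightarrow> int" where m: "\<And>\<gamma>. \<gamma> \<in> \<Phi> \<Longrightarrow> 2 * \<gamma> (dual_elem \<alpha>) = of_int (m \<gamma>) * ?c"
    unfolding bchoice_iff by blast
  have "?c = (\<Sum>\<gamma>\<in>\<Phi>. \<gamma> (dual_elem \<alpha>) * \<gamma> (dual_elem \<alpha>))"
    using killing_dual_elem[OF \<alpha> dual_elem_H[OF \<alpha>]] killing_H_roots[OF dual_elem_H[OF \<alpha>] dual_elem_H[OF \<alpha>]] by simp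
  then have "4 * ?c = (\<Sum>\<gamma>\<in>\<Phi>. (2 * \<gamma> (dual_elem \<alpha>)) * (2 * \<gamma> (dual_elem \<alpha>)))"
    by (simp add: sum_distrib_left algebra_simps)
  also have "\<dots> = (\<Sum>\<gamma>\<in>\<Phi>. (of_int (m \<gamma>) * ?c) * (of_int (m \<gamma>) * ?c))"
    by (intro sum.cong) (simp_all only: m)
  also have "\<dots> = of_int (\<Sum>\<gamma>\<in>\<Phi>. m \<gamma> * m \<gamma>) * ?c * ?c"
    unfolding of_int_sum sum_distrib_right by (simp add: mult_ac)
  finally have "4 = of_int (\<Sum>\<gamma>\<in>\<Phi>. m \<gamma> * m \<gamma>) * ?c" using root_dual_elem_nonzero[OF \<alpha>] by simp
  then have "?c = of_rat (4 / of_int (\<Sum>\<gamma>\<in>\<Phi>. m \<gamma> * m \<gamma>))"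
    unfolding of_rat_divide of_rat_of_int_eq
    by (metis mult_zero_left nonzero_mult_div_cancel_left of_rat_numeral_eq zero_neq_numeral)
  then show ?thesis by blast
qed

lemma root_rational:
  assumes \<alpha>: "\<alpha> \<in> \<Phi>" and \<beta>: "\<beta> \<in> \<Phi>"
  shows "\<exists>r :: rat. \<beta> (dual_elem \<alpha>) = of_rat r"
proof -
  obtain r where r: "\<alpha> (dual_elem \<alpha>) = of_rat r" using root_norm_rational[OF \<alpha>] by blast
  obtain m :: int where "2 * \<beta> (dual_elem \<alpha>) = of_int m * \<alpha> (dual_elem \<alpha>)" using cartan_integer[OF \<alpha> \<beta>] by blast
  then have "\<beta> (dual_elem \<alpha>) = of_int m * of_rat r / 2" using r
    by (simp add: eq_divide_eq mult.commute)
  then have "\<beta> (dual_elem \<alpha>) = of_rat (of_int m * r / 2)"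
    by (simp add: of_rat_divide of_rat_mult)
  then show ?thesis by blast
qed

end

section \<open>Stars of obtuse roots\<close>

text \<open>The arithmetic of \<open>bad_neighbour\<close>. With |\<mu>|^2 = |a|^2 = M, |b|^2 = K
  and |\<mu> - a|^2 = w M, the pairs \<open>p, q\<close> and \<open>r, s\<close> and
  \<open>y, z\<close> are the Cartan numbers of b against \<mu>, against a (sign reversed) and
  against \<mu> - a. Products at most 3 come from Cauchy-Schwarz, \<open>p + r \<ge> w\<close> from
  an obtuse angle.\<close>

lemma star_cases:
  fixes p q r s w y z :: int and M K :: rat
  assumes w: "w = 2 \<or> w = 3" and yz: "w * y = p + r" "z = q + s"
    and M: "M > 0" and K: "K > 0" and pq: "of_int p * M = of_int q * K" and rs: "of_int r * M = of_int s * K"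
    and b: "p * q \<le> 3" "r * s \<le> 3" "y * z \<le> 3" and r: "r \<ge> 0" and s: "s \<ge> 0" and le: "p + r \<ge> w"
  shows "w = 2 \<and> p = 1 \<and> r = 1 \<and> q = 1 \<and> s = 1 \<or> p = w \<and> q = 1 \<and> r = 0 \<and> s = 0 \<or> p = 0 \<and> q = 0 \<and> r = w \<and> s = 1"
proof -
  have wyz: "of_int (w * y) * M = of_int z * K"
    using pq rs unfolding yz by (simp add: algebra_simps)
  have y: "y > 0" using yz(1) le w by (smt (verit) mult_nonneg_nonpos)
  then have wy: "w * y \<ge> 2" using w by auto
  then have "(of_int (w * y) :: rat) > 0" by (simp only: of_int_0_less_iff)
  then have "of_int (w * y) * M > 0" using M by (rule mult_pos_pos)
  with wyz have "of_int z * K > 0" by simp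
  then have z: "z > 0" using K by (simp add: zero_less_mult_iff)
  have "of_int (p * z) * M = of_int z * (of_int p * M)" by simp
  also have "\<dots> = of_int q * (of_int z * K)" unfolding pq by simp
  also have "\<dots> = of_int (q * (w * y)) * M" unfolding wyz[symmetric] by simp
  finally have "of_int (p * z) = (of_int (q * (w * y)) :: rat)" using M by simp
  then have pz: "p * z = q * (w * y)" by (simp only: of_int_eq_iff)
  have y3: "y = 1 \<or> y = 2 \<or> y = 3"
  proof -
    have "y * 1 \<le> y * z" using y z by (intro mult_left_mono) auto
    with b(3) y show ?thesis by linarith
  qed
  have z3: "z = 1 \<or> z = 2 \<or> z = 3"
  proof -
    have "1 * z \<le> y * z" using y z by (intro mult_right_mono) auto
    with b(3) z show ?thesis by linarith
  qed
  \<comment> \<open>The remaining unbounded unknown is \<open>q\<close>: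
    \<open>p * z = q * (w * y)\<close> gives \<open>q^2 * w * y = (p * q) * z \<le> 9\<close>, so
    that \<open>\<bar>q\<bar> \<le> 2\<close> and a finite check is left.\<close>
  have "q * q * 2 \<le> q * q * (w * y)" using wy by (intro mult_left_mono) auto
  also have "\<dots> = (p * q) * z" using pz by (simp add: mult_ac)
  also have "\<dots> \<le> 3 * 3"
  proof (cases "p * q \<ge> 0")
    case True
    then show ?thesis using b(1) z z3 by (intro mult_mono) auto
  next
    case False
    then have "(p * q) * z \<le> 0" using z by (simp add: mult_nonpos_nonneg)
    then show ?thesis by simp
  qed
  finally have qq: "q * q \<le> 4" by simp
  have "\<bar>q\<bar> \<le> 2"
  proof (rule ccontr)
    assume "\<not> ?thesis"
    then have "3 * 3 \<le> \<bar>q\<bar> * \<bar>q\<bar>" by (intro mult_mono) auto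
    with qq show False by (simp add: abs_mult_self_eq)
  qed
  then have q5: "q = - 2 \<or> q = - 1 \<or> q = 0 \<or> q = 1 \<or> q = 2" by linarith
  have s: "s = z - q" "r = w * y - p" using yz by auto
  show ?thesis
    using w y3 z3 q5 pz b r \<open>s \<ge> 0\<close> unfolding s
    by (elim disjE; simp; presburger)
qed

text \<open>The geometric content, freed from Lie algebras: \<open>A\<close> holds the simple roots
  a, in rational coordinates. Every assumption is either symmetric under exchanging x with \<mu> - x
  or paired with its mirror image, which is what \<open>flip\<close> exploits.\<close>

locale star =
  fixes ip :: "'v::ab_group_add \<Rightarrow> 'v \<Rightarrow> rat" and \<mu> :: 'v and A :: "'v set"
  assumes ip_add: "ip (x + y) z = ip x z + ip y z" and ip_sym: "ip x y = ip y x"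
    and pos: "x \<in> insert \<mu> (A \<union> (-) \<mu> ` A) \<Longrightarrow> ip x x > 0"
    and int: "x \<in> insert \<mu> (A \<union> (-) \<mu> ` A) \<Longrightarrow> y \<in> insert \<mu> (A \<union> (-) \<mu> ` A) \<Longrightarrow>
      \<exists>m :: int. 2 * ip x y = of_int m * ip y y"
    and cs_center: "a \<in> A \<Longrightarrow> (ip \<mu> a)\<^sup>2 < ip \<mu> \<mu> * ip a a"
      "a \<in> A \<Longrightarrow> (ip \<mu> (\<mu> - a))\<^sup>2 < ip \<mu> \<mu> * ip (\<mu> - a) (\<mu> - a)"
    and cs_mixed: "a \<in> A \<Longrightarrow> b \<in> A \<Longrightarrow> (ip a (\<mu> - b))\<^sup>2 < ip a a * ip (\<mu> - b) (\<mu> - b)"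
    and cs: "a \<in> A \<Longrightarrow> b \<in> A \<Longrightarrow> a \<noteq> b \<Longrightarrow> (ip a b)\<^sup>2 < ip a a * ip b b"
      "a \<in> A \<Longrightarrow> b \<in> A \<Longrightarrow> a \<noteq> b \<Longrightarrow> (ip (\<mu> - a) (\<mu> - b))\<^sup>2 < ip (\<mu> - a) (\<mu> - a) * ip (\<mu> - b) (\<mu> - b)"
    and obtuse: "a \<in> A \<Longrightarrow> b \<in> A \<Longrightarrow> a \<noteq> b \<Longrightarrow> ip a b \<le> 0"
      "a \<in> A \<Longrightarrow> b \<in> A \<Longrightarrow> a \<noteq> b \<Longrightarrow> ip (\<mu> - a) (\<mu> - b) \<le> 0"
    and tri: "a \<in> A \<Longrightarrow> b \<in> A \<Longrightarrow> c \<in> A \<Longrightarrow> a \<noteq> b \<Longrightarrow> a \<noteq> c \<Longrightarrow> b \<noteq> c \<Longrightarrow>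
        ip (a + b + c - \<mu>) (a + b + c - \<mu>) > 0"
      "a \<in> A \<Longrightarrow> b \<in> A \<Longrightarrow> c \<in> A \<Longrightarrow> a \<noteq> b \<Longrightarrow> a \<noteq> c \<Longrightarrow> b \<noteq> c \<Longrightarrow>
        ip (\<mu> - a + (\<mu> - b) + (\<mu> - c) - \<mu>) (\<mu> - a + (\<mu> - b) + (\<mu> - c) - \<mu>) > 0"
begin

lemma ip_diff: "ip (x - y) z = ip x z - ip y z"
  using ip_add[of "x - y" y z] by simp

lemma ip_add_right: "ip x (y + z) = ip x y + ip x z"
  using ip_add[of y z x] by (simp add: ip_sym)

lemma ip_diff_right: "ip x (y - z) = ip x y - ip x z"
  using ip_diff[of y z x] by (simp add: ip_sym)

lemmas ip_expand = ip_add ip_diff ip_add_right ip_diff_right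

text \<open>The product of the two Cartan numbers is \<open>4 * i^2 / (X * Y)\<close>, which is
  below 4 and an integer.\<close>

lemma cartan_product:
  assumes "2 * i = of_int m * X" "2 * i = of_int n * Y" "i\<^sup>2 < X * Y" "X > 0" "Y > (0 :: rat)"
  shows "m * n \<le> (3 :: int)"
proof -
  have "of_int (m * n) * (X * Y) = (of_int m * X) * (of_int n * Y)" by simp
  also have "\<dots> = 4 * i\<^sup>2" unfolding assms(1,2)[symmetric] by (simp add: power2_eq_square)
  also have "\<dots> < 4 * (X * Y)" using assms(3) by simp
  finally have "of_int (m * n) < (4 :: rat)" using assms(4,5) by (simp add: mult_less_cancel_right)
  then have "m * n < 4" by linarith
  then show ?thesis by simp
qed

text \<open>Since \<mu> is the sum of a and \<mu> - a, the hypothesis makes their inner product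
  negative. Both Cartan numbers are then negative with product at most 3, so the one relative to the
  longer vector \<mu> - a is -1.\<close>

lemma bad_shape:
  assumes a: "a \<in> A" and bad: "ip a a + ip (\<mu> - a) (\<mu> - a) > 2 * ip \<mu> \<mu>"
    and le: "ip a a \<le> ip (\<mu> - a) (\<mu> - a)"
  obtains w :: int where "w = 2 \<or> w = 3" "ip a a = ip \<mu> \<mu>" "ip (\<mu> - a) (\<mu> - a) = of_int w * ip \<mu> \<mu>"
proof -
  let ?g = "\<mu> - a"
  have S: "\<mu> \<in> insert \<mu> (A \<union> (-) \<mu> ` A)" "a \<in> insert \<mu> (A \<union> (-) \<mu> ` A)" "?g \<in> insert \<mu> (A \<union> (-) \<mu> ` A)"
    using a by auto
  have P: "ip \<mu> \<mu> > 0" "ip a a > 0" "ip ?g ?g > 0" using pos S by blast+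
  obtain m where m: "2 * ip a ?g = of_int m * ip ?g ?g" using int S by blast
  obtain n where n: "2 * ip a ?g = of_int n * ip a a" using int[OF S(3) S(2)] by (auto simp: ip_sym)
  have eq: "2 * ip a ?g = ip \<mu> \<mu> - ip a a - ip ?g ?g"
    by (simp add: ip_expand ip_sym)
  have mn: "n * m \<le> 3" using cartan_product[OF n m cs_mixed[OF a a]] P by simp
  have "2 * ip a ?g < 0" using eq bad P by linarith
  then have "of_int m * ip ?g ?g < 0" "of_int n * ip a a < 0" using m n by linarith+
  then have m0: "m < 0" and n0: "n < 0" using P by (auto simp: mult_less_0_iff)
  have "of_int n * ip a a \<ge> of_int n * ip ?g ?g" using n0 le by (simp add: mult_left_mono_neg)
  then have "of_int m * ip ?g ?g \<ge> of_int n * ip ?g ?g" using m n by simp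
  then have nm: "n \<le> m" using P by simp
  have m1: "m = -1"
  proof (rule ccontr)
    assume "m \<noteq> -1"
    then have "2 * 2 \<le> (- n) * (- m)" using m0 n0 nm by (intro mult_mono) auto
    with mn show False by simp
  qed
  have n3: "n = -1 \<or> n = -2 \<or> n = -3" using mn n0 unfolding m1 by linarith
  \<comment> \<open>\<open>m = -1\<close> says \<open>2 * ip a ?g = - ip ?g ?g\<close>; inserted in
    \<open>eq\<close> it leaves |a|^2 = |\<mu>|^2.\<close>
  have Aa: "ip a a = ip \<mu> \<mu>" using m eq unfolding m1 by simp
  have G: "ip ?g ?g = of_int (- n) * ip \<mu> \<mu>" using m n Aa unfolding m1 by simp
  have "n \<noteq> -1" using bad Aa G by auto
  then show ?thesis using that[of "- n"] n3 Aa G by auto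
qed

text \<open>Cartan numbers of \<open>b\<close> against \<mu>, \<open>a\<close> and \<mu> - a are
  integers linked by additivity, so only finitely many patterns survive. One further pattern has
  \<open>b\<close> orthogonal to \<mu> and is excluded by integrality against \<mu> - b.\<close>

lemma bad_neighbour:
  assumes a: "a \<in> A" and w: "w = 2 \<or> w = (3 :: int)" and aa: "ip a a = ip \<mu> \<mu>"
    and gg: "ip (\<mu> - a) (\<mu> - a) = of_int w * ip \<mu> \<mu>" and b: "b \<in> A" "a \<noteq> b"
  shows "w = 2 \<and> ip b b = ip \<mu> \<mu> \<and> 2 * ip \<mu> b = ip \<mu> \<mu> \<and> 2 * ip a b = - ip \<mu> \<mu>
    \<or> 2 * ip \<mu> b = of_int w * ip \<mu> \<mu> \<and> ip b b = of_int w * ip \<mu> \<mu>"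
proof -
  let ?g = "\<mu> - a" and ?M = "ip \<mu> \<mu>" and ?K = "ip b b"
  have S: "\<mu> \<in> insert \<mu> (A \<union> (-) \<mu> ` A)" "a \<in> insert \<mu> (A \<union> (-) \<mu> ` A)" "?g \<in> insert \<mu> (A \<union> (-) \<mu> ` A)"
    "b \<in> insert \<mu> (A \<union> (-) \<mu> ` A)" "\<mu> - b \<in> insert \<mu> (A \<union> (-) \<mu> ` A)"
    using a b by auto
  have P: "?M > 0" "?K > 0" using pos S by blast+
  obtain q where q: "2 * ip \<mu> b = of_int q * ?K" using int S by blast
  obtain p where p: "2 * ip \<mu> b = of_int p * ?M" using int[OF S(4) S(1)] by (auto simp: ip_sym)
  obtain s' where s': "2 * ip a b = of_int s' * ?K" using int S by blast
  obtain r' where r': "2 * ip a b = of_int r' * ?M" using int[OF S(4) S(2)] aa by (auto simp: ip_sym)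
  obtain z where z: "2 * ip ?g b = of_int z * ?K" using int S by blast
  obtain y where y: "2 * ip ?g b = of_int y * (of_int w * ?M)" using int[OF S(4) S(3)] gg by (auto simp: ip_sym)
  define r s where "r = - r'" and "s = - s'"
  have rs: "- 2 * ip a b = of_int r * ?M" "- 2 * ip a b = of_int s * ?K" using r' s' by (simp_all add: r_def s_def)
  have ab: "ip a b \<le> 0" using obtuse(1) a b by blast
  have gb: "2 * ip ?g b = 2 * ip \<mu> b - 2 * ip a b" by (simp add: ip_expand)
  have "of_int z * ?K = of_int (q + s) * ?K" using z gb q rs by (simp add: algebra_simps)
  then have zqs: "z = q + s" using P by (simp only: mult_cancel_right of_int_eq_iff) simp
  have "of_int (w * y) * ?M = of_int (p + r) * ?M" using y gb p rs by (simp add: algebra_simps)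
  then have wy: "w * y = p + r" using P by (simp only: mult_cancel_right of_int_eq_iff) simp
  have r0: "r \<ge> 0"
  proof -
    have "of_int r * ?M \<ge> 0" using rs ab by linarith
    then show ?thesis using P by (simp add: zero_le_mult_iff)
  qed
  have s0: "s \<ge> 0"
  proof -
    have "of_int s * ?K \<ge> 0" using rs ab by linarith
    then show ?thesis using P by (simp add: zero_le_mult_iff)
  qed
  \<comment> \<open>As |a|^2 = |\<mu>|^2, one has \<open>ip ?g ?g = 2 * ?M - 2 * ip \<mu> a\<close>;
    the obtuse angle between \<mu> - a and \<mu> - b then bounds
    \<open>2 * ip \<mu> b - 2 * ip a b\<close> below by \<open>w * ?M\<close>.\<close>
  have pr: "p + r \<ge> w"
  proof -
    have "ip ?g (\<mu> - b) \<le> 0" using obtuse(2) a b by blast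
    moreover have "2 * ip ?g (\<mu> - b) = 2 * ?M - 2 * ip \<mu> a - 2 * ip \<mu> b + 2 * ip a b"
      by (simp add: ip_expand ip_sym)
    moreover have "ip ?g ?g = ?M + ip a a - 2 * ip \<mu> a" by (simp add: ip_expand ip_sym)
    ultimately have "of_int w * ?M \<le> of_int (p + r) * ?M"
      using aa gg p rs by (simp add: algebra_simps)
    then show ?thesis using P by (simp only: mult_le_cancel_right) simp
  qed
  have pq3: "p * q \<le> 3" using cartan_product[OF p q cs_center(1)[OF b(1)]] P by simp
  have "r' * s' \<le> 3" using cartan_product[OF r' s'] cs(1)[OF a b] P by (simp add: aa)
  then have rs3: "r * s \<le> 3" by (simp add: r_def s_def)
  have yz3: "y * z \<le> 3"
  proof (rule cartan_product[OF y z])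
    show "(ip ?g b)\<^sup>2 < of_int w * ?M * ?K" using cs_mixed[OF b(1) a] gg by (simp add: ip_sym mult.commute)
    show "of_int w * ?M > 0" using w P by auto
  qed (rule P)
  have pM: "of_int p * ?M = of_int q * ?K" "of_int r * ?M = of_int s * ?K" using p q rs by simp_all
  from star_cases[OF w wy zqs P pM pq3 rs3 yz3 r0 s0 pr]
  consider "w = 2" "p = 1" "r = 1" "q = 1" | "p = w" "q = 1" | "p = 0" "r = w" "s = 1" by blast
  then show ?thesis
  proof cases
    case 1
    then show ?thesis using p rs pM by simp
  next
    case 2
    then show ?thesis using p q by simp
  next
    case 3
    then have K: "?K = of_int w * ?M" using pM by simp
    have x: "ip \<mu> b = 0" using p 3 by simp
    \<comment> \<open>Here |\<mu> - b|^2 = (1 + w) |\<mu>|^2, so the Cartan number of \<mu> against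
      \<mu> - b would be 2 / (1 + w), no integer for w = 2 or 3.\<close>
    obtain n where n: "2 * ip \<mu> (\<mu> - b) = of_int n * ip (\<mu> - b) (\<mu> - b)" using int S by blast
    then have "2 * ?M = of_int (n * (1 + w)) * ?M" using x K by (simp add: ip_expand ip_sym algebra_simps)
    then have "of_int 2 = (of_int (n * (1 + w)) :: rat)" using P by (simp del: of_int_mult)
    then have n: "2 = n * (1 + w)" by (simp only: of_int_eq_iff)
    have "2 \<noteq> n * 3" "2 \<noteq> n * 4" by presburger+
    with n w have False by auto
    then show ?thesis ..
  qed
qed

text \<open>Pigeonhole: each of \<open>b\<close>, \<open>c\<close>, \<open>d\<close> is of one of
  the two kinds of \<open>bad_neighbour\<close>, and no kind can occur twice.\<close>

lemma bad_contradiction: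
  assumes a: "a \<in> A" and bad: "ip a a + ip (\<mu> - a) (\<mu> - a) > 2 * ip \<mu> \<mu>"
    and le: "ip a a \<le> ip (\<mu> - a) (\<mu> - a)"
    and b: "b \<in> A" "c \<in> A" "d \<in> A" "a \<noteq> b" "a \<noteq> c" "a \<noteq> d" "b \<noteq> c" "b \<noteq> d" "c \<noteq> d"
  shows False
proof -
  let ?M = "ip \<mu> \<mu>"
  obtain w :: int where w: "w = 2 \<or> w = 3" and aa: "ip a a = ?M" and gg: "ip (\<mu> - a) (\<mu> - a) = of_int w * ?M"
    using bad_shape[OF a bad le] by blast
  have M: "?M > 0" using pos by blast
  define X where "X b \<longleftrightarrow> w = 2 \<and> ip b b = ?M \<and> 2 * ip \<mu> b = ?M \<and> 2 * ip a b = - ?M" for b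
  define Y where "Y b \<longleftrightarrow> 2 * ip \<mu> b = of_int w * ?M \<and> ip b b = of_int w * ?M" for b
  have XY: "X b \<or> Y b" if "b \<in> A" "a \<noteq> b" for b
    using bad_neighbour[OF a w aa gg that] unfolding X_def Y_def by blast
  have XX: False if "X b" "X c" "b \<in> A" "c \<in> A" "a \<noteq> b" "a \<noteq> c" "b \<noteq> c" for b c
  proof -
    have bc: "ip b c \<le> 0" using obtuse(1) that by blast
    have "ip (\<mu> - a) (\<mu> - a) = ?M + ip a a - 2 * ip \<mu> a" by (simp add: ip_expand ip_sym)
    then have ma: "ip \<mu> a = 0" using gg aa that(1) by (simp add: X_def)
    have "ip (a + b + c - \<mu>) (a + b + c - \<mu>) = ip a a + ip b b + ip c c + ?M
        + 2 * ip a b + 2 * ip a c + 2 * ip b c - 2 * ip \<mu> a - 2 * ip \<mu> b - 2 * ip \<mu> c"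
      by (simp add: ip_expand ip_sym)
    \<comment> \<open>The four squared lengths give 4 |\<mu>|^2. Since \<open>a\<close> is
      orthogonal to \<mu>, this is cancelled by the four mixed terms involving \<open>a\<close> with
      \<open>b\<close>, \<open>c\<close> and \<mu> with \<open>b\<close>, \<open>c\<close>, each
      equal to - |\<mu>|^2.\<close>
    also have "\<dots> = 2 * ip b c" using that(1,2) aa ma by (simp add: X_def)
    finally show False using tri(1)[OF a that(3,4,5,6,7)] bc by simp
  qed
  have YY: False if "Y b" "Y c" "b \<in> A" "c \<in> A" "b \<noteq> c" for b c
  proof -
    have bc: "ip b c \<le> 0" using obtuse(1) that by blast
    have G: "ip (\<mu> - b) (\<mu> - b) = ?M" "ip (\<mu> - c) (\<mu> - c) = ?M"
      using that(1,2) by (simp_all add: ip_expand ip_sym Y_def)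
    have "ip (\<mu> - b) (\<mu> - c) = ?M - of_int w * ?M + ip b c"
      using that(1,2) by (simp add: ip_expand ip_sym Y_def)
    moreover have "of_int w * ?M \<ge> 2 * ?M" using w M by auto
    ultimately have "ip (\<mu> - b) (\<mu> - c) \<le> - ?M" using bc by linarith
    then have "?M\<^sup>2 \<le> (ip (\<mu> - b) (\<mu> - c))\<^sup>2" using M by (intro abs_le_square_iff[THEN iffD1]) auto
    moreover have "(ip (\<mu> - b) (\<mu> - c))\<^sup>2 < ?M * ?M" using cs(2)[OF that(3,4,5)] G by simp
    ultimately show False by (simp add: power2_eq_square)
  qed
  have "X b \<or> Y b" "X c \<or> Y c" "X d \<or> Y d" using XY b by auto
  then show False using XX YY b by blast
qed

text \<open>Allows the case of a longer than \<mu> - a to be read as the opposite case for the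
  reflected star.\<close>

lemma flip: "star ip \<mu> ((-) \<mu> ` A)"
proof -
  have "(-) \<mu> ` (-) \<mu> ` A = A" by (simp add: image_image)
  then have S: "insert \<mu> ((-) \<mu> ` A \<union> (-) \<mu> ` (-) \<mu> ` A) = insert \<mu> (A \<union> (-) \<mu> ` A)" by auto
  show ?thesis
  proof (unfold_locales, unfold S)
    show "ip (x + y) z = ip x z + ip y z" for x y z by (rule ip_add)
    show "ip x y = ip y x" for x y by (rule ip_sym)
    show "0 < ip x x" if "x \<in> insert \<mu> (A \<union> (-) \<mu> ` A)" for x using pos that .
    show "\<exists>m :: int. 2 * ip x y = of_int m * ip y y"
      if "x \<in> insert \<mu> (A \<union> (-) \<mu> ` A)" "y \<in> insert \<mu> (A \<union> (-) \<mu> ` A)" for x y using int that .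
    show "(ip \<mu> a)\<^sup>2 < ip \<mu> \<mu> * ip a a" if "a \<in> (-) \<mu> ` A" for a
      using that cs_center(2) by blast
    show "(ip \<mu> (\<mu> - a))\<^sup>2 < ip \<mu> \<mu> * ip (\<mu> - a) (\<mu> - a)" if "a \<in> (-) \<mu> ` A" for a
      using that cs_center(1) by auto
    show "(ip a (\<mu> - b))\<^sup>2 < ip a a * ip (\<mu> - b) (\<mu> - b)"
      if "a \<in> (-) \<mu> ` A" "b \<in> (-) \<mu> ` A" for a b
    proof -
      obtain x y where "x \<in> A" "y \<in> A" "a = \<mu> - x" "b = \<mu> - y" using \<open>a \<in> _\<close> \<open>b \<in> _\<close> by blast
      with cs_mixed[of y x] show ?thesis by (simp add: ip_sym[of "\<mu> - x" y] mult.commute)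
    qed
    show "(ip a b)\<^sup>2 < ip a a * ip b b" if "a \<in> (-) \<mu> ` A" "b \<in> (-) \<mu> ` A" "a \<noteq> b" for a b
    proof -
      obtain x y where "x \<in> A" "y \<in> A" "a = \<mu> - x" "b = \<mu> - y" using \<open>a \<in> _\<close> \<open>b \<in> _\<close> by blast
      with cs(2)[of x y] \<open>a \<noteq> b\<close> show ?thesis by auto
    qed
    show "(ip (\<mu> - a) (\<mu> - b))\<^sup>2 < ip (\<mu> - a) (\<mu> - a) * ip (\<mu> - b) (\<mu> - b)"
      if "a \<in> (-) \<mu> ` A" "b \<in> (-) \<mu> ` A" "a \<noteq> b" for a b
      using that cs(1) by auto
    show "ip a b \<le> 0" if "a \<in> (-) \<mu> ` A" "b \<in> (-) \<mu> ` A" "a \<noteq> b" for a b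
    proof -
      obtain x y where "x \<in> A" "y \<in> A" "a = \<mu> - x" "b = \<mu> - y" using \<open>a \<in> _\<close> \<open>b \<in> _\<close> by blast
      with obtuse(2)[of x y] \<open>a \<noteq> b\<close> show ?thesis by auto
    qed
    show "ip (\<mu> - a) (\<mu> - b) \<le> 0" if "a \<in> (-) \<mu> ` A" "b \<in> (-) \<mu> ` A" "a \<noteq> b" for a b
      using that obtuse(1) by auto
    fix a b c assume abc: "a \<in> (-) \<mu> ` A" "b \<in> (-) \<mu> ` A" "c \<in> (-) \<mu> ` A" "a \<noteq> b" "a \<noteq> c" "b \<noteq> c"
    then obtain x y z where x: "x \<in> A" "y \<in> A" "z \<in> A" "a = \<mu> - x" "b = \<mu> - y" "c = \<mu> - z" by blast
    then have d: "x \<noteq> y" "x \<noteq> z" "y \<noteq> z" using abc by auto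
    show "0 < ip (a + b + c - \<mu>) (a + b + c - \<mu>)" unfolding x by (rule tri(2)[OF x(1-3) d])
    have "\<mu> - (\<mu> - x) = x" for x by simp
    then show "0 < ip (\<mu> - a + (\<mu> - b) + (\<mu> - c) - \<mu>) (\<mu> - a + (\<mu> - b) + (\<mu> - c) - \<mu>)"
      unfolding x using tri(1)[OF x(1-3) d] by (simp only:)
  qed
qed

lemma no_four:
  assumes "a \<in> A" "b \<in> A" "c \<in> A" "d \<in> A" "a \<noteq> b" "a \<noteq> c" "a \<noteq> d" "b \<noteq> c" "b \<noteq> d" "c \<noteq> d"
  shows "ip (\<mu> + \<mu> - a - b - c - d) (\<mu> + \<mu> - a - b - c - d) \<le> 0"
proof -
  interpret f: star ip \<mu> "(-) \<mu> ` A" by (rule flip)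
  let ?M = "ip \<mu> \<mu>"
  have good: "ip a a + ip (\<mu> - a) (\<mu> - a) \<le> 2 * ?M"
    if "a \<in> A" "b \<in> A" "c \<in> A" "d \<in> A" "a \<noteq> b" "a \<noteq> c" "a \<noteq> d" "b \<noteq> c" "b \<noteq> d" "c \<noteq> d" for a b c d
  proof (rule ccontr)
    assume n: "\<not> ?thesis"
    show False
    proof (cases "ip a a \<le> ip (\<mu> - a) (\<mu> - a)")
      case True
      then show False using bad_contradiction[OF that(1) _ True that(2-)] n by simp
    next
      case False
      then show False
        using f.bad_contradiction[of "\<mu> - a" "\<mu> - b" "\<mu> - c" "\<mu> - d"] n that by simp
    qed
  qed
  have g: "2 * ip a a - 2 * ip \<mu> a \<le> ?M"
    if "a \<in> A" "b \<in> A" "c \<in> A" "d \<in> A" "a \<noteq> b" "a \<noteq> c" "a \<noteq> d" "b \<noteq> c" "b \<noteq> d" "c \<noteq> d" for a b c d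
    using good[OF that] by (simp add: ip_expand ip_sym)
  have G: "2 * ip a a - 2 * ip \<mu> a \<le> ?M" "2 * ip b b - 2 * ip \<mu> b \<le> ?M"
    "2 * ip c c - 2 * ip \<mu> c \<le> ?M" "2 * ip d d - 2 * ip \<mu> d \<le> ?M"
    using g[of a b c d] g[of b a c d] g[of c a b d] g[of d a b c] assms by auto
  have o1: "ip x y \<le> 0" "?M - ip \<mu> x - ip \<mu> y + ip x y \<le> 0" if "x \<in> A" "y \<in> A" "x \<noteq> y" for x y
    using obtuse[OF that] by (simp_all add: ip_expand ip_sym)
  have "ip (\<mu> + \<mu> - a - b - c - d) (\<mu> + \<mu> - a - b - c - d) =
     4 * ?M + ip a a + ip b b + ip c c + ip d d - 4 * (ip \<mu> a + ip \<mu> b + ip \<mu> c + ip \<mu> d)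
     + 2 * (ip a b + ip a c + ip a d + ip b c + ip b d + ip c d)"
    by (simp add: ip_expand ip_sym algebra_simps)
  \<comment> \<open>Write M = |\<mu>|^2, S for the sum of the products with \<mu>, P for the sum
    over the six pairs. Half the sum of \<open>G\<close> bounds the four squared lengths by 2 M + S,
    so the expression is at most (6 M - 3 S + P) + P; both summands are <= 0 by the two kinds of
    obtuse angles.\<close>
  also have "\<dots> \<le> 0"
    using G o1[of a b] o1[of a c] o1[of a d] o1[of b c] o1[of b d] o1[of c d] assms by simp
  finally show ?thesis .
qed

end

section \<open>Gradings\<close>

context simple_lie_algebra
begin

section \<open>The rational inner product on functionals\<close>

definition rat_part :: "'k \<Rightarrow> rat" where
  "rat_part x = (SOME r. x = of_rat r)"

lemma rat_part_of_rat [simp]: "rat_part (of_rat r) = r"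
  unfolding rat_part_def by (rule some_equality) auto

text \<open>Values at all dual elements serve as coordinates: redundant, but independent of a basis,
  and \<open>ip\<close> becomes a plain sum over roots. Entries off \<open>\<Phi>\<close> are 0, so
  equality of coordinates only concerns dual elements.\<close>

definition coords :: "('g \<Rightarrow> 'k) \<Rightarrow> ('g \<Rightarrow> 'k) \<Rightarrow> rat" where
  "coords x = (\<lambda>\<gamma>. if \<gamma> \<in> \<Phi> then rat_part (x (dual_elem \<gamma>)) else 0)"

definition ip :: "(('g \<Rightarrow> 'k) \<Rightarrow> rat) \<Rightarrow> (('g \<Rightarrow> 'k) \<Rightarrow> rat) \<Rightarrow> rat" where
  "ip u v = (\<Sum>\<gamma>\<in>\<Phi>. u \<gamma> * v \<gamma>)"

text \<open>The functionals on which \<open>coords\<close> is faithful and additive; a rational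
  vector space rather than a discrete group. It contains the roots and all sums and differences
  whose lengths are examined.\<close>

definition lattice :: "('g \<Rightarrow> 'k) set" where
  "lattice = {x \<in> dual H. \<forall>\<gamma>\<in>\<Phi>. \<exists>r. x (dual_elem \<gamma>) = of_rat r}"

lemma latticeD: "x \<in> lattice \<Longrightarrow> \<gamma> \<in> \<Phi> \<Longrightarrow> x (dual_elem \<gamma>) = of_rat (coords x \<gamma>)"
  by (auto simp: lattice_def coords_def)

lemma dual_diff: "x \<in> dual H \<Longrightarrow> y \<in> dual H \<Longrightarrow> x - y \<in> dual H"
  and dual_add: "x \<in> dual H \<Longrightarrow> y \<in> dual H \<Longrightarrow> x + y \<in> dual H"
  by (auto simp: dual_def algebra_simps)

lemma lattice_add:
  assumes "x \<in> lattice" "y \<in> lattice"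
  shows "x + y \<in> lattice" "coords (x + y) = coords x + coords y"
proof -
  have *: "(x + y) (dual_elem \<gamma>) = of_rat (coords x \<gamma> + coords y \<gamma>)" if "\<gamma> \<in> \<Phi>" for \<gamma>
    using that assms by (simp add: latticeD of_rat_add)
  then show "x + y \<in> lattice" using assms dual_add unfolding lattice_def by blast
  show "coords (x + y) = coords x + coords y"
  proof
    fix \<gamma> show "coords (x + y) \<gamma> = (coords x + coords y) \<gamma>"
    proof (cases "\<gamma> \<in> \<Phi>")
      case True
      then have "coords (x + y) \<gamma> = rat_part ((x + y) (dual_elem \<gamma>))" unfolding coords_def by (rule if_P)
      also have "\<dots> = coords x \<gamma> + coords y \<gamma>" unfolding *[OF True] by (rule rat_part_of_rat)
      finally show ?thesis by simp
    qed (simp add: coords_def)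
  qed
qed

lemma lattice_diff:
  assumes "x \<in> lattice" "y \<in> lattice"
  shows "x - y \<in> lattice" "coords (x - y) = coords x - coords y"
proof -
  have "(x - y) (dual_elem \<gamma>) = of_rat (coords x \<gamma> - coords y \<gamma>)" if "\<gamma> \<in> \<Phi>" for \<gamma>
    using that assms by (simp add: latticeD of_rat_diff)
  then show *: "x - y \<in> lattice" using assms dual_diff unfolding lattice_def by blast
  show "coords (x - y) = coords x - coords y"
    using lattice_add(2)[OF * assms(2)] by simp
qed

lemma \<Phi>_dual: "\<alpha> \<in> \<Phi> \<Longrightarrow> \<alpha> \<in> dual H"
  using \<Lambda>_linear[OF \<Phi>_\<Lambda>(1)] \<Phi>_\<Lambda>(2) by (auto simp: dual_def)

lemma \<Phi>_lattice: "\<alpha> \<in> \<Phi> \<Longrightarrow> \<alpha> \<in> lattice"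
  using root_rational \<Phi>_dual by (auto simp: lattice_def)

lemma ip_add: "ip (u + v) w = ip u w + ip v w"
  and ip_sym: "ip u v = ip v u"
  by (simp_all add: ip_def sum.distrib algebra_simps)

text \<open>The sum over roots is the Killing form of the two dual elements, by
  \<open>killing_H_roots\<close> and symmetry.\<close>

lemma of_rat_ip:
  assumes "\<alpha> \<in> \<Phi>" "\<beta> \<in> \<Phi>"
  shows "of_rat (ip (coords \<alpha>) (coords \<beta>)) = \<alpha> (dual_elem \<beta>)"
proof -
  have "of_rat (ip (coords \<alpha>) (coords \<beta>)) = (\<Sum>\<gamma>\<in>\<Phi>. \<alpha> (dual_elem \<gamma>) * \<beta> (dual_elem \<gamma>))"
    unfolding ip_def of_rat_sum of_rat_mult using assms by (intro sum.cong) (simp_all add: latticeD \<Phi>_lattice)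
  also have "\<dots> = (\<Sum>\<gamma>\<in>\<Phi>. \<gamma> (dual_elem \<alpha>) * \<gamma> (dual_elem \<beta>))"
    using assms by (intro sum.cong) (simp_all add: dual_elem_sym)
  also have "\<dots> = killing (dual_elem \<alpha>) (dual_elem \<beta>)" using assms by (simp add: killing_H_roots dual_elem_H)
  also have "\<dots> = \<alpha> (dual_elem \<beta>)" using assms by (simp add: killing_dual_elem dual_elem_H)
  finally show ?thesis .
qed

text \<open>A sum of rational squares vanishes only if the functional is 0 at every dual element,
  and these span \<open>H\<close>.\<close>

lemma ip_pos:
  assumes x: "x \<in> lattice" "x \<noteq> 0"
  shows "ip (coords x) (coords x) > 0"
proof -
  have "ip (coords x) (coords x) \<noteq> 0"
  proof
    assume "ip (coords x) (coords x) = 0"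
    then have "coords x \<gamma> * coords x \<gamma> = 0" if "\<gamma> \<in> \<Phi>" for \<gamma>
      unfolding ip_def using that finite_\<Phi> by (subst (asm) sum_nonneg_eq_0_iff) auto
    then have 0: "x (dual_elem \<gamma>) = 0" if "\<gamma> \<in> \<Phi>" for \<gamma> using that x(1) by (simp add: latticeD)
    have d: "x \<in> dual H" using x(1) by (simp add: lattice_def)
    have "x (0 *s 0) = 0 * x 0" using d subspace_0[OF subspace_H] unfolding dual_def by blast
    then have "subspace {h\<in>H. x h = 0}"
      using d subspace_H unfolding dual_def
      by (intro subspaceI) (auto simp: subspace_0 subspace_add subspace_scale)
    then have "span (dual_elem ` \<Phi>) \<subseteq> {h\<in>H. x h = 0}" using 0 dual_elem_H by (intro span_minimal) auto
    then have "x h = 0" for h using H_eq_span_dual_elem d by (cases "h \<in> H") (auto simp: dual_def)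
    with x(2) show False by (auto simp: fun_eq_iff)
  qed
  moreover have "ip (coords x) (coords x) \<ge> 0" unfolding ip_def by (rule sum_nonneg) simp
  ultimately show ?thesis by simp
qed

lemma ip_integer:
  assumes "\<alpha> \<in> \<Phi>" "\<beta> \<in> \<Phi>"
  shows "\<exists>m :: int. 2 * ip (coords \<alpha>) (coords \<beta>) = of_int m * ip (coords \<beta>) (coords \<beta>)"
proof -
  obtain m :: int where "2 * \<alpha> (dual_elem \<beta>) = of_int m * \<beta> (dual_elem \<beta>)" using cartan_integer[OF assms(2,1)] by blast
  then have "(of_rat (2 * ip (coords \<alpha>) (coords \<beta>)) :: 'k) = of_rat (of_int m * ip (coords \<beta>) (coords \<beta>))"
    using assms by (simp add: of_rat_mult of_rat_ip)
  then show ?thesis unfolding of_rat_eq_iff by blast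
qed

text \<open>Equality would give \<open>2 * \<alpha> = a * \<beta>\<close> with Cartan numbers
  satisfying \<open>a * b = 4\<close>. One of them is even, so one root is an integral multiple of
  the other, and \<open>multiple_root\<close> leaves only the excluded cases.\<close>

lemma ip_cauchy_schwarz:
  assumes \<alpha>: "\<alpha> \<in> \<Phi>" and \<beta>: "\<beta> \<in> \<Phi>" and "\<alpha> \<noteq> \<beta>" "\<alpha> + \<beta> \<noteq> 0"
  shows "(ip (coords \<alpha>) (coords \<beta>))\<^sup>2 < ip (coords \<alpha>) (coords \<alpha>) * ip (coords \<beta>) (coords \<beta>)"
proof -
  let ?u = "coords \<alpha>" and ?v = "coords \<beta>"
  let ?i = "ip ?u ?v" and ?X = "ip ?u ?u" and ?Y = "ip ?v ?v"
  have P: "?X > 0" "?Y > 0" using ip_pos \<Phi>_lattice \<Phi>_\<Lambda>(3) \<alpha> \<beta> by auto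
  obtain a where a: "2 * ?i = of_int a * ?Y" using ip_integer[OF \<alpha> \<beta>] by blast
  obtain b where b: "2 * ?i = of_int b * ?X" using ip_integer[OF \<beta> \<alpha>] by (auto simp: ip_sym)
  have not_multiple: False if "\<gamma> \<in> \<Phi>" "\<delta> \<in> \<Phi>" "\<gamma> \<noteq> \<delta>" "\<gamma> + \<delta> \<noteq> 0" "\<gamma> = scale_fun (of_int k) \<delta>" for \<gamma> \<delta> k
  proof -
    have "k = 0 \<or> k = 1 \<or> k = -1" using multiple_root[OF that(2)] that(1,5) \<Phi>_\<Lambda>(1) by blast
    then have "\<gamma> = 0 \<or> \<gamma> = \<delta> \<or> \<gamma> = - \<delta>" using that(5) by (auto simp: fun_eq_iff)
    with that \<Phi>_\<Lambda>(3) show False by auto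
  qed
  \<comment> \<open>Twice the component of \<open>\<alpha>\<close> orthogonal to
    \<open>\<beta>\<close>; the factor 2 makes the coefficient the integer \<open>a\<close>.\<close>
  define w where "w = (\<lambda>\<gamma>. 2 * ?u \<gamma> - of_int a * ?v \<gamma>)"
  have ww: "ip w w = 4 * ?X - 4 * of_int a * ?i + of_int a * of_int a * ?Y"
    unfolding ip_def w_def sum_distrib_left sum_subtractf[symmetric] sum.distrib[symmetric]
    by (intro sum.cong) (simp_all add: algebra_simps)
  have aaY: "of_int a * of_int a * ?Y = of_int a * (2 * ?i)" unfolding a by simp
  have ww0: "ip w w \<ge> 0" unfolding ip_def by (rule sum_nonneg) simp
  have "ip w w \<noteq> 0"
  proof
    assume 0: "ip w w = 0"
    have w0: "w \<gamma> = 0" if "\<gamma> \<in> \<Phi>" for \<gamma>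
    proof -
      have "w \<gamma> * w \<gamma> = 0"
        using 0 that finite_\<Phi> unfolding ip_def by (subst (asm) sum_nonneg_eq_0_iff) auto
      then show ?thesis by simp
    qed
    have eq: "2 * \<alpha> (dual_elem \<gamma>) = of_int a * \<beta> (dual_elem \<gamma>)" if "\<gamma> \<in> \<Phi>" for \<gamma>
    proof -
      have "(of_rat (2 * ?u \<gamma>) :: 'k) = of_rat (of_int a * ?v \<gamma>)"
        using w0[OF that] by (simp add: w_def)
      then show ?thesis using that \<alpha> \<beta> by (simp add: of_rat_mult latticeD \<Phi>_lattice)
    qed
    have "0 = 4 * ?X - 2 * of_int a * ?i"
      using 0 unfolding ww aaY by (simp add: algebra_simps)
    then have "4 * ?X = of_int a * (2 * ?i)" by simp
    also have "\<dots> = of_int (a * b) * ?X" unfolding b by simp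
    finally have "4 * ?X = of_int (a * b) * ?X" .
    then have "of_int 4 = (of_int (a * b) :: rat)" using P by (simp del: of_int_mult)
    then have ab: "a * b = 4" by (simp only: of_int_eq_iff)
    then have "even a \<or> even b" by (metis even_mult_iff even_numeral)
    have on_H: "x = y" if "x \<in> \<Phi>" "y \<in> lattice" "\<And>\<gamma>. \<gamma> \<in> \<Phi> \<Longrightarrow> x (dual_elem \<gamma>) = y (dual_elem \<gamma>)" for x y
    proof (rule ccontr)
      assume "x \<noteq> y"
      then have pos: "ip (coords (x - y)) (coords (x - y)) > 0"
        using that \<Phi>_lattice lattice_diff(1) by (intro ip_pos) auto
      have "coords (x - y) = (\<lambda>_. 0)" using that(3) of_rat_0
        by (auto simp: coords_def fun_eq_iff) (metis rat_part_of_rat of_rat_0)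
      with pos show False by (simp add: ip_def)
    qed
    have scale_lattice: "scale_fun (of_int k) x \<in> lattice" if "x \<in> \<Phi>" for k x
    proof -
      have "scale_fun (of_int k) x \<in> dual H"
        using \<Phi>_dual[OF that] by (auto simp: dual_def algebra_simps)
      moreover have "of_int k * x (dual_elem \<gamma>) = of_rat (of_int k * coords x \<gamma>)" if "\<gamma> \<in> \<Phi>" for \<gamma>
        using that \<open>x \<in> \<Phi>\<close> by (simp add: of_rat_mult latticeD \<Phi>_lattice)
      ultimately show ?thesis unfolding lattice_def by blast
    qed
    show False
    proof (cases "even a")
      case True
      then obtain k where k: "a = 2 * k" by blast
      have "\<alpha> = scale_fun (of_int k) \<beta>"
      proof (rule on_H[OF \<alpha> scale_lattice[OF \<beta>]])
        fix \<gamma> assume "\<gamma> \<in> \<Phi>"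
        then have "2 * \<alpha> (dual_elem \<gamma>) = 2 * (of_int k * \<beta> (dual_elem \<gamma>))" using eq k by simp
        then show "\<alpha> (dual_elem \<gamma>) = of_int k * \<beta> (dual_elem \<gamma>)" by simp
      qed
      then show False using not_multiple[OF \<alpha> \<beta> assms(3,4)] by blast
    next
      case False
      with \<open>even a \<or> even b\<close> obtain k where k: "b = 2 * k" by blast
      then have ak: "a * k = 2" using ab by simp
      have "\<beta> = scale_fun (of_int k) \<alpha>"
      proof (rule on_H[OF \<beta> scale_lattice[OF \<alpha>]])
        fix \<gamma> assume "\<gamma> \<in> \<Phi>"
        have "2 * (of_int k * \<alpha> (dual_elem \<gamma>)) = of_int k * (2 * \<alpha> (dual_elem \<gamma>))" by simp
        also have "\<dots> = of_int (a * k) * \<beta> (dual_elem \<gamma>)" unfolding eq[OF \<open>\<gamma> \<in> \<Phi>\<close>] by simp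
        also have "\<dots> = 2 * \<beta> (dual_elem \<gamma>)" unfolding ak by simp
        finally show "\<beta> (dual_elem \<gamma>) = of_int k * \<alpha> (dual_elem \<gamma>)" by simp
      qed
      moreover have "\<beta> \<noteq> \<alpha>" "\<beta> + \<alpha> \<noteq> 0" using assms(3,4) by (simp_all add: add.commute)
      ultimately show False using not_multiple[OF \<beta> \<alpha>] by blast
    qed
  qed
  with ww0 have "0 < ip w w" by simp
  also have "ip w w = 4 * ?X - 2 * of_int a * ?i" unfolding ww aaY by (simp add: algebra_simps)
  finally have "0 < (4 * ?X - 2 * of_int a * ?i) * ?Y" using P by simp
  also have "\<dots> = 4 * (?X * ?Y) - 2 * ?i * (of_int a * ?Y)" by (simp add: algebra_simps)
  also have "\<dots> = 4 * (?X * ?Y - ?i\<^sup>2)" unfolding a[symmetric] by (simp add: power2_eq_square algebra_simps)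
  finally show ?thesis by simp
qed

lemma eigen_wspace: "(\<And>h. h \<in> H \<Longrightarrow> br h x = \<alpha> h *s x) \<Longrightarrow> x \<in> wspace \<alpha>"
  by (auto simp: wspace_def geneig_def intro!: exI[of _ 1])

lemma killing_sum_right: "killing x (\<Sum>a\<in>A. f a) = (\<Sum>a\<in>A. killing x (f a))"
  by (induction A rule: infinite_finite_induct) (simp_all add: killing_add_right)

end

locale graded_simple_lie_algebra = simple_lie_algebra scale br Basis H
  for scale :: "'k::{field_char_0, alg_closed_field} \<Rightarrow> 'g::ab_group_add \<Rightarrow> 'g" (infixr "*s" 75)
    and br :: "'g \<Rightarrow> 'g \<Rightarrow> 'g" and Basis H :: "'g set" +
  fixes G :: "int \<Rightarrow> 'g set"
  assumes grading: "Z_grading G" and H_G0: "H \<subseteq> G 0"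
begin

lemma subspace_G: "subspace (G i)"
  and br_G: "x \<in> G i \<Longrightarrow> y \<in> G j \<Longrightarrow> br x y \<in> G (i + j)"
  and comp_ex1: "\<exists>!f. (\<forall>i. f i \<in> G i) \<and> finite {i. f i \<noteq> 0} \<and> x = Sum_any f"
  using grading by (auto simp: Z_grading_def Sum_any.expand_set)

text \<open>Homogeneous components. \<open>Sum_any\<close> sums over the support, so components of
  different vectors can be added without fixing an index set.\<close>

definition comp :: "'g \<Rightarrow> int \<Rightarrow> 'g" where
  "comp x = (THE f. (\<forall>i. f i \<in> G i) \<and> finite {i. f i \<noteq> 0} \<and> x = Sum_any f)"

lemma comp_G: "comp x i \<in> G i"
  and finite_comp: "finite {i. comp x i \<noteq> 0}"
  and Sum_comp: "Sum_any (comp x) = x"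
  using theI'[OF comp_ex1, of x] by (simp_all add: comp_def)

lemma comp_eq:
  assumes "\<And>i. f i \<in> G i" "finite {i. f i \<noteq> 0}" "x = Sum_any f"
  shows "comp x = f"
  unfolding comp_def using assms by (intro the1_equality comp_ex1) auto

lemma lin_Sum_any:
  assumes "lin T" "finite {i. f i \<noteq> 0}"
  shows "T (Sum_any f) = Sum_any (\<lambda>i. T (f i))"
proof -
  have "{i. T (f i) \<noteq> 0} \<subseteq> {i. f i \<noteq> 0}" using lin_zero[OF assms(1)] by auto
  then show ?thesis
    using assms lin_sum[OF assms(1)] by (subst Sum_any.expand_superset[of "{i. f i \<noteq> 0}"])
      (auto simp: Sum_any.expand_set)
qed

lemma comp_lin:
  assumes "lin T" "\<And>i x. x \<in> G i \<Longrightarrow> T x \<in> G i"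
  shows "comp (T x) i = T (comp x i)"
proof -
  have "comp (T x) = (\<lambda>i. T (comp x i))"
  proof (rule comp_eq)
    show "finite {i. T (comp x i) \<noteq> 0}"
      by (rule finite_subset[OF _ finite_comp[of x]]) (auto simp: lin_zero[OF assms(1)])
    show "T x = Sum_any (\<lambda>i. T (comp x i))"
      using lin_Sum_any[OF assms(1) finite_comp, of x] by (simp add: Sum_comp)
  qed (simp add: assms(2) comp_G)
  then show ?thesis by simp
qed

lemma comp_scale: "comp (c *s x) i = c *s comp x i"
  by (rule comp_lin) (auto intro: linI simp: scale_right_distrib mult.commute subspace_scale[OF subspace_G])

lemma comp_add: "comp (x + y) = (\<lambda>i. comp x i + comp y i)"
proof (rule comp_eq)
  show "finite {i. comp x i + comp y i \<noteq> 0}"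
    by (rule finite_subset[OF _ finite_UnI[OF finite_comp[of x] finite_comp[of y]]]) auto
  show "x + y = Sum_any (\<lambda>i. comp x i + comp y i)"
    using Sum_any.distrib[OF finite_comp finite_comp, of x y] by (simp add: Sum_comp)
qed (simp add: subspace_add[OF subspace_G] comp_G)

lemma comp_homogeneous:
  assumes "x \<in> G i"
  shows "comp x = (\<lambda>j. if j = i then x else 0)"
proof (rule comp_eq)
  show "x = Sum_any (\<lambda>j. if j = i then x else 0)"
    by (subst Sum_any.expand_superset[of "{i}"]) auto
qed (use assms subspace_0[OF subspace_G] in auto)

lemma span_G: "span (\<Union>i. G i) = UNIV"
proof -
  have "x \<in> span (\<Union>i. G i)" for x
  proof -
    have "(\<Sum>i | comp x i \<noteq> 0. comp x i) \<in> span (\<Union>i. G i)"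
      by (intro span_sum span_base) (use comp_G in blast)
    then show ?thesis using Sum_comp[of x] by (simp add: Sum_any.expand_set)
  qed
  then show ?thesis by auto
qed

section \<open>The degree derivation and the element of \<open>H\<close> that induces it\<close>

definition D :: "'g \<Rightarrow> 'g" where
  "D x = Sum_any (\<lambda>i. of_int i *s comp x i)"

lemma lin_D: "lin D"
proof (rule linI)
  have fin: "finite {i. of_int i *s comp x i \<noteq> 0}" for x
    by (rule finite_subset[OF _ finite_comp[of x]]) auto
  show "D (x + y) = D x + D y" for x y
    unfolding D_def comp_add scale_right_distrib by (rule Sum_any.distrib[OF fin fin])
  have l: "lin (\<lambda>x. c *s x)" for c by (rule linI) (simp_all add: scale_right_distrib mult.commute)
  show "D (c *s x) = c *s D x" for c x
    unfolding D_def lin_Sum_any[OF l fin] by (simp add: comp_scale mult.commute)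
qed

lemma D_homogeneous: "x \<in> G i \<Longrightarrow> D x = of_int i *s x"
  unfolding D_def by (subst Sum_any.expand_superset[of "{i}"]) (auto simp: comp_homogeneous)

lemma D_derivation:
  assumes e: "e \<in> G d"
  shows "D (br e z) = of_int d *s br e z + br e (D z)"
proof -
  let ?F = "\<lambda>z. (D (br e z) - of_int d *s br e z) - br e (D z)"
  have "lin (\<lambda>z. D (br e z) - of_int d *s br e z)"
    by (rule linI) (simp_all add: lin_add[OF lin_D] lin_scale[OF lin_D] br_add_right br_scale_right algebra_simps)
  then have F: "lin ?F" by (rule lin_minus_fun) (rule lin_comp[OF lin_D lin_br])
  have "?F z \<in> {0}"
  proof (rule lin_span_subset[OF F _ subspace_single_0, of "\<Union>i. G i"])
    fix x assume "x \<in> (\<Union>i. G i)"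
    then obtain i where x: "x \<in> G i" by blast
    show "?F x \<in> {0}"
      using D_homogeneous[OF br_G[OF e x]] D_homogeneous[OF x]
      by (simp add: br_scale_right algebra_simps)
  qed (simp add: span_G)
  then show ?thesis by (simp add: algebra_simps)
qed

text \<open>\<open>H\<close> lies in degree 0, so each component of a root vector is again an
  eigenvector of the same weight; as the root space is a line, a nonzero component spans it.\<close>

lemma root_homogeneous:
  assumes "\<alpha> \<in> \<Phi>"
  shows "\<exists>i. wspace \<alpha> \<subseteq> G i"
proof -
  obtain x where x: "x \<in> wspace \<alpha>" "x \<noteq> 0" using \<Phi>_\<Lambda>(1)[OF assms] by (rule \<Lambda>_nonzeroE)
  have "comp x i \<in> wspace \<alpha>" for i
  proof (rule eigen_wspace)
    fix h assume h: "h \<in> H"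
    have "br h (comp x i) = comp (br h x) i"
      using br_G[of h 0] H_G0 h by (intro comp_lin[symmetric] lin_br) auto
    also have "\<dots> = \<alpha> h *s comp x i"
      using wspace_eigen[OF \<Phi>_\<Lambda>(1)[OF assms] x(1) h] by (simp add: comp_scale)
    finally show "br h (comp x i) = \<alpha> h *s comp x i" .
  qed
  moreover have "\<exists>i. comp x i \<noteq> 0"
  proof (rule ccontr)
    assume "\<nexists>i. comp x i \<noteq> 0"
    then have "comp x = (\<lambda>_. 0)" by auto
    then show False using Sum_comp[of x] x(2) by simp
  qed
  ultimately obtain i where "comp x i \<in> wspace \<alpha>" "comp x i \<noteq> 0" by blast
  then have "wspace \<alpha> = span {comp x i}" using wspace_span[OF assms] by blast
  moreover have "span {comp x i} \<subseteq> G i" using comp_G subspace_G by (intro span_minimal) auto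
  ultimately show ?thesis by blast
qed

text \<open>The derivation \<open>D\<close> given by the grading is inner: its inner product with \<open>br (dual_elem \<alpha>)\<close> under
  the trace form determines an element \<open>h\<close> of \<open>H\<close> on which every root takes its degree as value.\<close>

lemma grading_element:
  "\<exists>h. \<forall>\<alpha>\<in>\<Phi>. \<forall>i. wspace \<alpha> \<subseteq> G i \<longrightarrow> \<alpha> h = of_int i"
proof -
  have "\<forall>\<alpha>\<in>\<Phi>. \<exists>i. wspace \<alpha> \<subseteq> G i" using root_homogeneous by blast
  then obtain d where d: "\<And>\<alpha>. \<alpha> \<in> \<Phi> \<Longrightarrow> wspace \<alpha> \<subseteq> G (d \<alpha>)" unfolding bchoice_iff by blast
  \<comment> \<open>Chosen so that its Killing product with \<open>dual_elem \<alpha>\<close> is the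
    trace of \<open>D\<close> composed with \<open>br (dual_elem \<alpha>)\<close>, a sum over root
    spaces of degree times weight.\<close>
  let ?h = "\<Sum>\<gamma>\<in>\<Phi>. of_int (d \<gamma>) *s dual_elem \<gamma>"
  have hH: "?h \<in> H" using dual_elem_H subspace_H by (intro subspace_sum) (auto intro: subspace_scale)
  have "\<alpha> ?h = of_int i" if \<alpha>: "\<alpha> \<in> \<Phi>" and i: "wspace \<alpha> \<subseteq> G i" for \<alpha> i
  proof -
    obtain e y where e: "e \<in> wspace \<alpha>" and y: "y \<in> wspace (- \<alpha>)" and ty: "br e y = dual_elem \<alpha>" "killing e y = 1"
      using root_pair[OF \<alpha>] by metis
    \<comment> \<open>Evaluated twice: writing \<open>dual_elem \<alpha>\<close> as
      \<open>br e y\<close> and moving \<open>D\<close> past \<open>e\<close> gives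
      \<open>i\<close>; summing over weight spaces gives \<open>\<alpha> ?h\<close>.\<close>
    let ?T = "trace UNIV (\<lambda>z. D (br (dual_elem \<alpha>) z))"
    have eG: "e \<in> G i" using e i by blast
    have "?T = trace UNIV (\<lambda>z. D (br e (br y z))) - trace UNIV (\<lambda>z. D (br y (br e z)))"
      unfolding ty(1)[symmetric] br_br lin_diff[OF lin_D] by (rule trace_diff) auto
    also have "trace UNIV (\<lambda>z. D (br y (br e z))) = trace UNIV (\<lambda>z. br e (D (br y z)))"
      by (rule trace_swap[OF subspace_UNIV subspace_UNIV lin_br lin_comp[OF lin_br lin_D]]) auto
    also have "trace UNIV (\<lambda>z. D (br e (br y z))) = of_int i * killing e y + trace UNIV (\<lambda>z. br e (D (br y z)))"
    proof -
      have "trace UNIV (\<lambda>z. of_int i *s br e (br y z) + br e (D (br y z)))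
          = trace UNIV (\<lambda>z. of_int i *s br e (br y z)) + trace UNIV (\<lambda>z. br e (D (br y z)))"
        by (rule trace_add) auto
      moreover have "trace UNIV (\<lambda>z. of_int i *s br e (br y z)) = of_int i * killing e y"
        unfolding killing_def by (rule trace_scale) auto
      ultimately show ?thesis unfolding D_derivation[OF eG] by simp
    qed
    finally have T: "?T = of_int i" using ty(2) by simp
    have D_wspace: "D (br (dual_elem \<alpha>) z) = (if \<gamma> = 0 then 0 else (of_int (d \<gamma>) * \<gamma> (dual_elem \<alpha>)) *s z)"
      if "\<gamma> \<in> \<Lambda>" "z \<in> wspace \<gamma>" for \<gamma> z
    proof (cases "\<gamma> = 0")
      case True
      then show ?thesis using wspace_eigen[OF that dual_elem_H[OF \<alpha>]] by (simp add: lin_zero[OF lin_D])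
    next
      case False
      then have "z \<in> G (d \<gamma>)" using d that by (auto simp: \<Phi>_def)
      then show ?thesis using wspace_eigen[OF that dual_elem_H[OF \<alpha>]] False
        by (simp add: lin_scale[OF lin_D] D_homogeneous mult.commute)
    qed
    have "?T = (\<Sum>\<gamma>\<in>\<Lambda>. trace (wspace \<gamma>) (\<lambda>z. D (br (dual_elem \<alpha>) z)))"
      using lin_comp[OF lin_br lin_D] D_wspace
      by (intro trace_UNIV_wspace) (auto simp: subspace_0[OF subspace_wspace] subspace_scale[OF subspace_wspace])
    also have "\<dots> = (\<Sum>\<gamma>\<in>\<Lambda>. if \<gamma> = 0 then 0 else of_nat (dim (wspace \<gamma>)) * (of_int (d \<gamma>) * \<gamma> (dual_elem \<alpha>)))"
    proof (rule sum.cong)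
      fix \<gamma> assume \<gamma>: "\<gamma> \<in> \<Lambda>"
      have "trace (wspace \<gamma>) (\<lambda>z. D (br (dual_elem \<alpha>) z))
          = trace (wspace \<gamma>) (\<lambda>z. (if \<gamma> = 0 then 0 else of_int (d \<gamma>) * \<gamma> (dual_elem \<alpha>)) *s z)"
        using D_wspace[OF \<gamma>] by (intro trace_cong subspace_wspace) auto
      then show "trace (wspace \<gamma>) (\<lambda>z. D (br (dual_elem \<alpha>) z))
          = (if \<gamma> = 0 then 0 else of_nat (dim (wspace \<gamma>)) * (of_int (d \<gamma>) * \<gamma> (dual_elem \<alpha>)))"
        unfolding trace_scalar[OF subspace_wspace] by simp
    qed simp
    also have "\<dots> = (\<Sum>\<gamma>\<in>\<Phi>. of_int (d \<gamma>) * \<gamma> (dual_elem \<alpha>))"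
      by (subst sum_\<Lambda>_\<Phi>) (auto simp: dim_wspace \<Phi>_\<Lambda> intro!: sum.cong)
    also have "\<dots> = (\<Sum>\<gamma>\<in>\<Phi>. of_int (d \<gamma>) * killing (dual_elem \<alpha>) (dual_elem \<gamma>))"
      using \<alpha> by (intro sum.cong) (simp_all add: killing_dual_elem dual_elem_H dual_elem_sym)
    also have "\<dots> = killing (dual_elem \<alpha>) ?h"
      by (simp add: killing_sum_right killing_scale_right)
    also have "\<dots> = \<alpha> ?h" by (rule killing_dual_elem[OF \<alpha> hH])
    finally show ?thesis using T by simp
  qed
  then show ?thesis by blast
qed

text \<open>Because root spaces are lines, one eigenvector in \<open>G i\<close> puts the whole root
  space there.\<close>

lemma roots_\<Phi>:
  assumes "\<beta> \<in> roots H (G i)"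
  shows "\<beta> \<in> \<Phi>" "wspace \<beta> \<subseteq> G i"
proof -
  obtain x where x: "\<beta> \<in> dual H" "\<beta> \<noteq> 0" "x \<in> G i" "x \<noteq> 0" "\<forall>h\<in>H. br h x = \<beta> h *s x"
    using assms by (auto simp: roots_def)
  have xb: "x \<in> wspace \<beta>" using x(5) by (intro eigen_wspace) blast
  have "\<beta> \<in> H_supported" using x(1) by (simp add: dual_def)
  then show \<beta>: "\<beta> \<in> \<Phi>" using xb x(2,4) by (auto simp: \<Phi>_def \<Lambda>_def)
  show "wspace \<beta> \<subseteq> G i"
    unfolding wspace_span[OF \<beta> xb x(4)] using x(3) by (intro span_minimal subspace_G) simp
qed

lemma \<Phi>_roots:
  assumes \<beta>: "\<beta> \<in> \<Phi>" and G: "wspace \<beta> \<subseteq> G i"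
  shows "\<beta> \<in> roots H (G i)"
proof -
  obtain x where x: "x \<in> wspace \<beta>" "x \<noteq> 0" using \<Phi>_\<Lambda>(1)[OF \<beta>] by (rule \<Lambda>_nonzeroE)
  then have "\<forall>h\<in>H. br h x = \<beta> h *s x" using wspace_eigen[OF \<Phi>_\<Lambda>(1)[OF \<beta>]] by blast
  then show ?thesis unfolding roots_def using x G \<Phi>_dual[OF \<beta>] \<Phi>_\<Lambda>(3)[OF \<beta>] by blast
qed

text \<open>A positive inner product means a positive Cartan integer, so
  \<open>br_root_nonzero\<close> yields a nonzero vector of weight
  \<open>\<beta> - \<alpha>\<close>; equal values at \<open>h0\<close> force degree 0.\<close>

lemma root_difference:
  assumes h0: "\<forall>\<alpha>\<in>\<Phi>. \<forall>i. wspace \<alpha> \<subseteq> G i \<longrightarrow> \<alpha> h0 = of_int i"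
    and \<alpha>: "\<alpha> \<in> \<Phi>" and \<beta>: "\<beta> \<in> \<Phi>" and "\<alpha> \<noteq> \<beta>" "\<alpha> h0 = \<beta> h0"
    and pos: "ip (coords \<beta>) (coords \<alpha>) > 0"
  shows "\<beta> - \<alpha> \<in> roots H (G 0)"
proof -
  obtain m where m: "2 * ip (coords \<beta>) (coords \<alpha>) = of_int m * ip (coords \<alpha>) (coords \<alpha>)"
    using ip_integer[OF \<beta> \<alpha>] by blast
  have "ip (coords \<alpha>) (coords \<alpha>) > 0" using ip_pos \<Phi>_lattice \<Phi>_\<Lambda>(3) \<alpha> by auto
  then have m0: "m > 0" using m pos by (metis mult_pos_pos of_int_0_less_iff zero_less_mult_pos2 zero_less_numeral)
  have "(of_rat (2 * ip (coords \<beta>) (coords \<alpha>)) :: 'k) = of_rat (of_int m * ip (coords \<alpha>) (coords \<alpha>))"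
    using m by simp
  then have mt: "2 * \<beta> (dual_elem \<alpha>) = of_int m * \<alpha> (dual_elem \<alpha>)" using \<alpha> \<beta> by (simp add: of_rat_mult of_rat_ip)
  obtain y where y: "y \<in> wspace (- \<alpha>)" "y \<noteq> 0" using \<Phi>_\<Lambda>(1)[OF \<Phi>_minus[OF \<alpha>]] by (rule \<Lambda>_nonzeroE)
  obtain e where e: "e \<in> wspace \<beta>" "e \<noteq> 0" using \<Phi>_\<Lambda>(1)[OF \<beta>] by (rule \<Lambda>_nonzeroE)
  have "br y e \<noteq> 0" by (rule br_root_nonzero[OF \<alpha> \<beta> mt m0 y e])
  moreover have "br y e \<in> wspace (\<beta> - \<alpha>)" using wspace_br[OF y(1) e(1)] by simp
  moreover have "\<beta> - \<alpha> \<in> H_supported" 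
    using \<Lambda>_outside[OF \<Phi>_\<Lambda>(1)[OF \<alpha>]] \<Lambda>_outside[OF \<Phi>_\<Lambda>(1)[OF \<beta>]] by auto
  ultimately have r: "\<beta> - \<alpha> \<in> \<Phi>" using \<open>\<alpha> \<noteq> \<beta>\<close> by (auto simp: \<Phi>_def \<Lambda>_def)
  then obtain i where i: "wspace (\<beta> - \<alpha>) \<subseteq> G i" using root_homogeneous by blast
  then have "of_int i = (\<beta> - \<alpha>) h0" using h0 r by metis
  then have "i = 0" using assms(5) by simp
  with i r show ?thesis using \<Phi>_roots by blast
qed

end

text \<open>The difference has a coefficient 1 and a coefficient -1, which independence forbids for
  a combination with coefficients of one sign.\<close>

lemma simple_roots_difference:
  fixes \<Phi> \<Pi> :: "('g \<Rightarrow> 'k::field_char_0) set"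
  assumes S: "simple_roots \<Phi> \<Pi>" and \<alpha>: "\<alpha> \<in> \<Pi>" and \<beta>: "\<beta> \<in> \<Pi>" and "\<alpha> \<noteq> \<beta>"
  shows "\<beta> - \<alpha> \<notin> \<Phi>"
proof
  interpret V: vector_space "scale_fun :: 'k \<Rightarrow> ('g \<Rightarrow> 'k) \<Rightarrow> _" by (rule vector_space_fun)
  assume "\<beta> - \<alpha> \<in> \<Phi>"
  with S obtain c :: "('g \<Rightarrow> 'k) \<Rightarrow> nat" where
    "\<beta> - \<alpha> = (\<Sum>\<gamma>\<in>\<Pi>. scale_fun (of_nat (c \<gamma>)) \<gamma>) \<or> \<beta> - \<alpha> = - (\<Sum>\<gamma>\<in>\<Pi>. scale_fun (of_nat (c \<gamma>)) \<gamma>)"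
    unfolding simple_roots_def by blast
  then have c: "\<beta> - \<alpha> - (\<Sum>\<gamma>\<in>\<Pi>. scale_fun (of_nat (c \<gamma>)) \<gamma>) = 0 \<or> \<alpha> - \<beta> - (\<Sum>\<gamma>\<in>\<Pi>. scale_fun (of_nat (c \<gamma>)) \<gamma>) = 0"
    by (auto simp: algebra_simps)
  have fin: "finite \<Pi>" and ind: "V.independent \<Pi>" using S by (auto simp: simple_roots_def)
  have *: False if xy: "x \<in> \<Pi>" "y \<in> \<Pi>" "x \<noteq> y" and 0: "x - y - (\<Sum>\<gamma>\<in>\<Pi>. scale_fun (of_nat (c \<gamma>)) \<gamma>) = 0" for x y
  proof -
    \<comment> \<open>At \<open>y\<close> this coefficient is -1 - c(y), nonzero in characteristic
      zero whatever the natural number c(y) is.\<close>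
    let ?u = "\<lambda>\<gamma>. (if \<gamma> = x then 1 else 0) - (if \<gamma> = y then 1 else 0) - of_nat (c \<gamma>) :: 'k"
    have d: "(\<Sum>\<gamma>\<in>\<Pi>. scale_fun (if \<gamma> = z then 1 else 0) \<gamma>) = z" if "z \<in> \<Pi>" for z
    proof -
      have "(\<Sum>\<gamma>\<in>\<Pi>. scale_fun (if \<gamma> = z then 1 else 0) \<gamma>) = (\<Sum>\<gamma>\<in>\<Pi>. if \<gamma> = z then \<gamma> else 0)"
        by (intro sum.cong) auto
      then show ?thesis using that fin by simp
    qed
    have "(\<Sum>\<gamma>\<in>\<Pi>. scale_fun (?u \<gamma>) \<gamma>) = (\<Sum>\<gamma>\<in>\<Pi>. scale_fun (if \<gamma> = x then 1 else 0) \<gamma>)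
        - (\<Sum>\<gamma>\<in>\<Pi>. scale_fun (if \<gamma> = y then 1 else 0) \<gamma>) - (\<Sum>\<gamma>\<in>\<Pi>. scale_fun (of_nat (c \<gamma>)) \<gamma>)"
      unfolding sum_subtractf[symmetric] by (simp only: V.scale_left_diff_distrib)
    also have "\<dots> = 0" using 0 d xy by simp
    finally have "?u y = 0" using V.independentD[OF ind fin subset_refl _ xy(2), of ?u] by blast
    then have "- 1 - of_nat (c y) = (0 :: 'k)" using xy(3) by simp
    moreover have "of_nat (Suc (c y)) = - (- 1 - of_nat (c y) :: 'k)" by simp
    ultimately have "of_nat (Suc (c y)) = (0 :: 'k)" by (simp only: minus_zero)
    then show False by (simp only: of_nat_eq_0_iff)
  qed
  show False using c *[OF \<beta> \<alpha>] *[OF \<alpha> \<beta>] \<open>\<alpha> \<noteq> \<beta>\<close> by auto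
qed

text \<open>Together with distinctness this excludes proportionality, as strict Cauchy-Schwarz
  requires.\<close>

lemma simple_roots_sum:
  fixes \<Phi> \<Pi> :: "('g \<Rightarrow> 'k::field) set"
  assumes "simple_roots \<Phi> \<Pi>" "\<alpha> \<in> \<Pi>" "\<beta> \<in> \<Pi>" "\<alpha> \<noteq> \<beta>"
  shows "\<alpha> + \<beta> \<noteq> 0"
proof
  interpret V: vector_space "scale_fun :: 'k \<Rightarrow> ('g \<Rightarrow> 'k) \<Rightarrow> _" by (rule vector_space_fun)
  assume "\<alpha> + \<beta> = 0"
  then have 0: "(\<Sum>v\<in>{\<alpha>, \<beta>}. scale_fun ((\<lambda>_. 1) v) v) = 0" using assms(4) by simp
  have "V.independent \<Pi>" using assms(1) by (simp add: simple_roots_def)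
  from V.independentD[OF this _ _ 0, of \<alpha>] assms show False by simp
qed

section \<open>Bounding the number of elements covered by a root\<close>

context graded_simple_lie_algebra
begin

lemma fun_neq_0: "x h \<noteq> 0 \<Longrightarrow> x \<noteq> 0"
  by auto

lemma ip_posI: "x \<noteq> 0 \<Longrightarrow> x \<in> lattice \<Longrightarrow> coords x = u \<Longrightarrow> ip u u > 0"
  using ip_pos by blast

text \<open>The coordinates of the roots \<alpha> in question form a \<open>star\<close> around
  those of \<mu>, and \<open>no_four\<close> contradicts the positive length of 2 \<mu> - a - b - c
  - d. Most of the verification consists in showing that certain combinations are nonzero.\<close>

lemma card_covered:
  assumes S: "simple_roots (roots H (G 0)) \<Pi>" and i: "i \<noteq> 0" and \<mu>: "\<mu> \<in> roots H (G i)"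
  shows "card {\<alpha>\<in>\<Pi>. \<mu> - \<alpha> \<in> roots H (G i)} \<le> 3"
proof (rule ccontr)
  let ?B = "{\<alpha>\<in>\<Pi>. \<mu> - \<alpha> \<in> roots H (G i)}"
  assume "\<not> ?thesis"
  then have "4 \<le> card ?B" by simp
  then obtain C where C: "C \<subseteq> ?B" "card C = 4" by (meson obtain_subset_with_card_n)
  then obtain a b c d where abcd: "C = {a, b, c, d}" "a \<noteq> b" "a \<noteq> c" "a \<noteq> d" "b \<noteq> c" "b \<noteq> d" "c \<noteq> d"
    by (auto simp: card_Suc_eq numeral_eq_Suc)
  \<comment> \<open>Evaluation at \<open>h0\<close> reads off degrees: \<open>i\<close> at \<mu> and
    at \<mu> - \<alpha>, 0 at \<alpha>. The nonvanishing of combinations involving \<mu> is mostly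
    tested there.\<close>
  obtain h0 where h0: "\<forall>\<alpha>\<in>\<Phi>. \<forall>i. wspace \<alpha> \<subseteq> G i \<longrightarrow> \<alpha> h0 = of_int i" using grading_element by blast
  have deg: "\<alpha> \<in> \<Phi>" "\<alpha> h0 = of_int j" if "\<alpha> \<in> roots H (G j)" for \<alpha> j
    using roots_\<Phi>[OF that] h0 by auto
  have \<Pi>0: "\<alpha> \<in> roots H (G 0)" if "\<alpha> \<in> \<Pi>" for \<alpha> using S that by (auto simp: simple_roots_def)
  have i0: "of_int i \<noteq> (0 :: 'k)" using i by simp
  have \<mu>\<Phi>: "\<mu> \<in> \<Phi>" and \<mu>h: "\<mu> h0 = of_int i" using deg[OF \<mu>] by auto
  have B: "\<alpha> \<in> \<Pi>" "\<alpha> \<in> \<Phi>" "\<alpha> h0 = 0" "\<mu> - \<alpha> \<in> \<Phi>" "(\<mu> - \<alpha>) h0 = of_int i" if "\<alpha> \<in> ?B" for \<alpha>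
    using that deg[OF \<Pi>0] deg[of "\<mu> - \<alpha>" i] by auto
  note L = \<Phi>_lattice
  have cd: "coords (\<mu> - \<alpha>) = coords \<mu> - coords \<alpha>" if "\<alpha> \<in> ?B" for \<alpha>
    using lattice_diff(2) L \<mu>\<Phi> B(2)[OF that] by blast
  have S: "\<exists>\<gamma>\<in>\<Phi>. x = coords \<gamma>" if "x \<in> insert (coords \<mu>) (coords ` ?B \<union> (-) (coords \<mu>) ` coords ` ?B)" for x
  proof -
    have "x = coords \<mu> \<or> x \<in> coords ` ?B \<or> x \<in> (-) (coords \<mu>) ` coords ` ?B" using that by blast
    then show ?thesis
    proof (elim disjE)
      assume "x \<in> coords ` ?B"
      then show ?thesis using B(2) by blast
    next
      assume "x \<in> (-) (coords \<mu>) ` coords ` ?B"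
      then obtain \<alpha> where \<alpha>: "\<alpha> \<in> ?B" "x = coords \<mu> - coords \<alpha>" by blast
      then show ?thesis using cd[OF \<alpha>(1)] B(4)[OF \<alpha>(1)] by metis
    qed (use \<mu>\<Phi> in blast)
  qed
  have not_in: "\<beta> - \<alpha> \<notin> roots H (G 0)" if "\<alpha> \<in> ?B" "\<beta> \<in> ?B" "\<alpha> \<noteq> \<beta>" for \<alpha> \<beta>
    by (rule simple_roots_difference[OF \<open>simple_roots _ \<Pi>\<close>]) (use that in auto)
  interpret star ip "coords \<mu>" "coords ` ?B"
  proof
    show "ip (x + y) z = ip x z + ip y z" for x y z by (rule ip_add)
    show "ip x y = ip y x" for x y by (rule ip_sym)
    show "0 < ip x x" if "x \<in> insert (coords \<mu>) (coords ` ?B \<union> (-) (coords \<mu>) ` coords ` ?B)" for x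
      using S[OF that] ip_pos L \<Phi>_\<Lambda>(3) by blast
    show "\<exists>m :: int. 2 * ip x y = of_int m * ip y y"
      if "x \<in> insert (coords \<mu>) (coords ` ?B \<union> (-) (coords \<mu>) ` coords ` ?B)"
        "y \<in> insert (coords \<mu>) (coords ` ?B \<union> (-) (coords \<mu>) ` coords ` ?B)" for x y
      using S[OF that(1)] S[OF that(2)] ip_integer by blast
  next
    fix x assume "x \<in> coords ` ?B"
    then obtain \<alpha> where \<alpha>: "\<alpha> \<in> ?B" and x: "x = coords \<alpha>" by blast
    have "\<mu> \<noteq> \<alpha>" using \<mu>h B(3)[OF \<alpha>] i0 by auto
    moreover have "\<mu> + \<alpha> \<noteq> 0"
    proof
      assume "\<mu> + \<alpha> = 0"
      from fun_cong[OF this, of h0] show False using \<mu>h B(3)[OF \<alpha>] i0 by simp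
    qed
    ultimately show "(ip (coords \<mu>) x)\<^sup>2 < ip (coords \<mu>) (coords \<mu>) * ip x x"
      unfolding x using \<mu>\<Phi> B(2)[OF \<alpha>] by (intro ip_cauchy_schwarz)
    have "\<alpha> \<noteq> 0" using \<Phi>_\<Lambda>(3) B(2)[OF \<alpha>] by blast
    then have "\<mu> \<noteq> \<mu> - \<alpha>" by simp
    moreover have "\<mu> + (\<mu> - \<alpha>) \<noteq> 0"
    proof
      assume "\<mu> + (\<mu> - \<alpha>) = 0"
      from fun_cong[OF this, of h0] have "2 * of_int i = (0 :: 'k)" using \<mu>h B(3)[OF \<alpha>] by simp
      then show False using i0 by simp
    qed
    ultimately show "(ip (coords \<mu>) (coords \<mu> - x))\<^sup>2 < ip (coords \<mu>) (coords \<mu>) * ip (coords \<mu> - x) (coords \<mu> - x)"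
      unfolding x cd[OF \<alpha>, symmetric] using \<mu>\<Phi> B(4)[OF \<alpha>] by (intro ip_cauchy_schwarz)
  next
    fix x y assume "x \<in> coords ` ?B" "y \<in> coords ` ?B"
    then obtain \<alpha> \<beta> where \<alpha>: "\<alpha> \<in> ?B" and x: "x = coords \<alpha>" and \<beta>: "\<beta> \<in> ?B" and y: "y = coords \<beta>" by blast
    note b = B[OF \<alpha>] B[OF \<beta>]
    have "\<alpha> \<noteq> \<mu> - \<beta>" using b i0 by metis
    moreover have "\<alpha> + (\<mu> - \<beta>) \<noteq> 0"
    proof
      assume "\<alpha> + (\<mu> - \<beta>) = 0"
      from fun_cong[OF this, of h0] show False using \<mu>h b i0 by simp
    qed
    ultimately show "(ip x (coords \<mu> - y))\<^sup>2 < ip x x * ip (coords \<mu> - y) (coords \<mu> - y)"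
      unfolding x y cd[OF \<beta>, symmetric] using b by (intro ip_cauchy_schwarz)
    assume "x \<noteq> y"
    then have ne: "\<alpha> \<noteq> \<beta>" using x y by auto
    have ob: "ip x y \<le> 0"
    proof (rule ccontr)
      assume "\<not> ?thesis"
      then have "ip (coords \<beta>) (coords \<alpha>) > 0" unfolding x y by (simp add: ip_sym)
      then have "\<beta> - \<alpha> \<in> roots H (G 0)" using b ne by (intro root_difference[OF h0]) auto
      with not_in[OF \<alpha> \<beta> ne] show False by blast
    qed
    then show "ip x y \<le> 0" .
    show "ip (coords \<mu> - x) (coords \<mu> - y) \<le> 0"
    proof (rule ccontr)
      assume "\<not> ?thesis"
      then have "ip (coords (\<mu> - \<alpha>)) (coords (\<mu> - \<beta>)) > 0" unfolding x y cd[OF \<alpha>] cd[OF \<beta>] by simp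
      then have "(\<mu> - \<alpha>) - (\<mu> - \<beta>) \<in> roots H (G 0)" using b ne by (intro root_difference[OF h0]) auto
      then have "\<beta> - \<alpha> \<in> roots H (G 0)" by simp
      with not_in[OF \<alpha> \<beta> ne] show False by blast
    qed
    have "\<alpha> + \<beta> \<noteq> 0" by (rule simple_roots_sum[OF \<open>simple_roots _ \<Pi>\<close> b(1) b(6) ne])
    then show "(ip x y)\<^sup>2 < ip x x * ip y y" unfolding x y using b ne by (intro ip_cauchy_schwarz)
    have "\<mu> - \<alpha> \<noteq> \<mu> - \<beta>" using ne by simp
    moreover have "\<mu> - \<alpha> + (\<mu> - \<beta>) \<noteq> 0"
    proof
      assume "\<mu> - \<alpha> + (\<mu> - \<beta>) = 0"
      from fun_cong[OF this, of h0] have "2 * of_int i = (0 :: 'k)" using \<mu>h b by simp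
      then show False using i0 by simp
    qed
    ultimately show "(ip (coords \<mu> - x) (coords \<mu> - y))\<^sup>2
        < ip (coords \<mu> - x) (coords \<mu> - x) * ip (coords \<mu> - y) (coords \<mu> - y)"
      unfolding x y cd[OF \<alpha>, symmetric] cd[OF \<beta>, symmetric] using b by (intro ip_cauchy_schwarz)
  next
    fix x y z assume "x \<in> coords ` ?B" "y \<in> coords ` ?B" "z \<in> coords ` ?B"
    then obtain \<alpha> \<beta> \<gamma> where \<alpha>: "\<alpha> \<in> ?B" and x: "x = coords \<alpha>" and \<beta>: "\<beta> \<in> ?B" and y: "y = coords \<beta>"
      and \<gamma>: "\<gamma> \<in> ?B" and z: "z = coords \<gamma>" by blast
    note b = B[OF \<alpha>] B[OF \<beta>] B[OF \<gamma>]
    have l: "\<alpha> \<in> lattice" "\<beta> \<in> lattice" "\<gamma> \<in> lattice" "\<mu> \<in> lattice" using b \<mu>\<Phi> L by auto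
    let ?v = "\<alpha> + \<beta> + \<gamma> - \<mu>"
    have "?v h0 \<noteq> 0" using b \<mu>h i0 by simp
    then have "?v \<noteq> 0" by (rule fun_neq_0)
    moreover have "?v \<in> lattice" "coords ?v = x + y + z - coords \<mu>"
      unfolding x y z using l by (simp_all add: lattice_add lattice_diff)
    ultimately show "ip (x + y + z - coords \<mu>) (x + y + z - coords \<mu>) > 0" by (rule ip_posI)
    let ?w = "\<mu> - \<alpha> + (\<mu> - \<beta>) + (\<mu> - \<gamma>) - \<mu>"
    have "?w h0 = 2 * of_int i" using b \<mu>h by simp
    then have "?w h0 \<noteq> 0" using i0 by simp
    then have "?w \<noteq> 0" by (rule fun_neq_0)
    moreover have "?w \<in> lattice"
      "coords ?w = coords \<mu> - x + (coords \<mu> - y) + (coords \<mu> - z) - coords \<mu>"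
      unfolding x y z using l by (simp_all only: lattice_add lattice_diff)
    ultimately show "ip (coords \<mu> - x + (coords \<mu> - y) + (coords \<mu> - z) - coords \<mu>)
        (coords \<mu> - x + (coords \<mu> - y) + (coords \<mu> - z) - coords \<mu>) > 0" by (rule ip_posI)
  qed
  \<comment> \<open>The star consists of coordinate vectors, so the four distinct roots must stay
    distinct after \<open>coords\<close>.\<close>
  have coords_inj: "coords x \<noteq> coords y" if "x \<in> ?B" "y \<in> ?B" "x \<noteq> y" for x y
  proof
    assume eq: "coords x = coords y"
    have l: "x \<in> lattice" "y \<in> lattice"
      using L[OF B(2)[OF that(1)]] L[OF B(2)[OF that(2)]] by auto
    have "ip (coords (x - y)) (coords (x - y)) > 0"
      using that(3) lattice_diff(1)[OF l] by (intro ip_pos) auto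
    then show False unfolding lattice_diff(2)[OF l] eq by (simp add: ip_def)
  qed
  have abcdB: "a \<in> ?B" "b \<in> ?B" "c \<in> ?B" "d \<in> ?B" using C(1) abcd(1) by auto
  have l: "a \<in> lattice" "b \<in> lattice" "c \<in> lattice" "d \<in> lattice" "\<mu> \<in> lattice"
    using abcdB[THEN B(2), THEN L] L[OF \<mu>\<Phi>] by auto
  let ?v = "\<mu> + \<mu> - a - b - c - d"
  have "?v h0 = 2 * of_int i" using abcdB[THEN B(3)] \<mu>h by simp
  then have "?v h0 \<noteq> 0" using i0 by simp
  then have "?v \<noteq> 0" by (rule fun_neq_0)
  moreover have "?v \<in> lattice"
    "coords ?v = coords \<mu> + coords \<mu> - coords a - coords b - coords c - coords d"
    using l by (simp_all only: lattice_add lattice_diff)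
  ultimately have "ip (coords \<mu> + coords \<mu> - coords a - coords b - coords c - coords d)
     (coords \<mu> + coords \<mu> - coords a - coords b - coords c - coords d) > 0" by (rule ip_posI)
  moreover have "ip (coords \<mu> + coords \<mu> - coords a - coords b - coords c - coords d)
     (coords \<mu> + coords \<mu> - coords a - coords b - coords c - coords d) \<le> 0"
    using abcdB abcd coords_inj by (intro no_four) auto
  ultimately show False by simp
qed

end

theorem proposition5p1:
  fixes scale :: "'k::{field_char_0, alg_closed_field} \<Rightarrow> 'g::ab_group_add \<Rightarrow> 'g"
    and br :: "'g \<Rightarrow> 'g \<Rightarrow> 'g"
    and G :: "int \<Rightarrow> 'g set"
    and \<tt> :: "'g set"
    and \<Pi> :: "('g \<Rightarrow> 'k) set"
    and i :: int
  assumes "lie_algebra scale br"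
    and "lie_algebra.finite_dim scale"
    and "lie_algebra.simple scale br"
    and "lie_algebra.Z_grading scale br G"
    and "lie_algebra.cartan_subalgebra scale br \<tt>"
    and "\<tt> \<subseteq> G 0"
    and "simple_roots (lie_algebra.roots scale br \<tt> (G 0)) \<Pi>"
    and "i \<noteq> 0"
    and "G i \<noteq> {0}"
  shows "degree (upper_covering_poly (lie_algebra.roots scale br \<tt> (G i))
           (root_order \<Pi> (lie_algebra.roots scale br \<tt> (G i)))) \<le> 3"
proof -
  interpret L: lie_algebra scale br by fact
  obtain Basis where "finite_dimensional_vector_space scale Basis"
    using assms(2) L.finite_dim_def by blast
  then interpret F: finite_dimensional_vector_space scale Basis .
  interpret graded_simple_lie_algebra scale br Basis \<tt> G
    by unfold_locales (use assms in auto)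
  let ?P = "L.roots \<tt> (G i)" and ?le = "root_order \<Pi> (L.roots \<tt> (G i))"
  have fin: "finite ?P" using roots_\<Phi>(1) finite_\<Phi> by (meson finite_subset subsetI)
  have "card {\<gamma>\<in>?P. covers ?P ?le \<mu> \<gamma>} \<le> 3" if \<mu>: "\<mu> \<in> ?P" for \<mu>
  proof -
    let ?B = "{\<alpha>\<in>\<Pi>. \<mu> - \<alpha> \<in> ?P}"
    \<comment> \<open>Each covered element is \<mu> minus a simple root, so covered elements are
      counted by the simple roots bounded in \<open>card_covered\<close>.\<close>
    have "{\<gamma>\<in>?P. covers ?P ?le \<mu> \<gamma>} \<subseteq> (-) \<mu> ` ?B"
    proof
      fix \<gamma> assume "\<gamma> \<in> {\<gamma>\<in>?P. covers ?P ?le \<mu> \<gamma>}"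
      then have "\<gamma> \<in> ?P" "\<mu> - \<gamma> \<in> \<Pi>" by (auto simp: covers_root_order_iff[OF assms(7)])
      then show "\<gamma> \<in> (-) \<mu> ` ?B" by (intro image_eqI[of _ _ "\<mu> - \<gamma>"]) auto
    qed
    moreover have "finite ?B" using assms(7) by (simp add: simple_roots_def)
    ultimately have "card {\<gamma>\<in>?P. covers ?P ?le \<mu> \<gamma>} \<le> card ?B"
      by (meson card_image_le card_mono finite_imageI le_trans)
    then show ?thesis using card_covered[OF assms(7,8) \<mu>] by linarith
  qed
  then have "covering_exactly ?P ?le j = {}" if "j > 3" for j
    using that by (force simp: covering_exactly_def)
  then have "coeff (upper_covering_poly ?P ?le) j = 0" if "j > 3" for j
    using that by (simp add: coeff_upper_covering_poly[OF fin])
  then show ?thesis by (intro degree_le) auto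
qed

end
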